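(* Consider the problem $\min\{f(z)+h(z): Az=b,\ z\in\mathbb{R}^n\}$ under assumptions (C1)–(C3) of the context, let $\hat c$ be as in (C3), let $z_0\in\operatorname{dom}h$, $\sigma\in(0,1)$, and a tolerance pair $(\hat\rho,\hat\eta)\in\mathbb{R}_{++}^2$ be given, and define $$\lambda:=\frac{1}{2m_f},\qquad T_{\hat\eta}:=\frac{2R_{\hat c}(\lambda)}{\hat\eta^2(1-\sigma)\lambda}+\hat c,\qquad \Theta:=\frac{L_f+T_{\hat\eta}\|A\|^2}{m_f},$$ where $R_{\hat c}(\lambda)$ is defined in the context. Then the QP-AIPP method (described in the context) with inputs $z_0,\sigma,L_f,m_f,(\hat\rho,\hat\eta)$ terminates and outputs a triple $(\hat z,\hat v,\hat p)$ satisfying $$\hat v\in\nabla f(\hat z)+\partial h(\hat z)+A^*\hat p,\qquad \|\hat v\|\le\hat\rho,\qquad \|A\hat z-b\|\le\hat\eta,$$ in a total number of inner (ACG) iterations bounded by $$\mathcal{O}\left(\sqrt{\Theta}\left[\frac{m_f^2R_{\hat c}(\lambda)}{\hat\rho^2}+\log_1^+(\Theta)\right]\right),$$ where the constant hidden in $\mathcal{O}(\cdot)$ depends only on $\sigma$.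
   Context: Notation: $\mathbb{R}_+$, $\mathbb{R}_{++}$ are the nonnegative and positive reals; $\|\cdot\|$ is the Euclidean norm (operator norm for matrices); $\log_1^+(t):=\max\{\log t,1\}$ for $t>0$; $\ell_\psi(u;z):=\psi(z)+\langle\nabla\psi(z),u-z\rangle$. For $\psi:\mathbb{R}^n\to(-\infty,\infty]$, $\varepsilon\ge0$ and $z\in\operatorname{dom}\psi$, $\partial_\varepsilon\psi(z):=\{v:\psi(u)\ge\psi(z)+\langle v,u-z\rangle-\varepsilon\ \ \forall u\in\mathbb{R}^n\}$ (no convexity of $\psi$ required) and $\partial\psi:=\partial_0\psi$. Functions such as $g+h$ are taken to be $+\infty$ outside $\operatorname{dom}h$. Assumptions. $A\in\mathbb{R}^{l\times n}$, $b\in\mathbb{R}^l$ and: (C1) $h:\mathbb{R}^n\to(-\infty,\infty]$ is proper, lower semicontinuous and convex, $A\ne0$, and $\mathcal{F}:=\{z\in\operatorname{dom}h:Az=b\}\neq\emptyset$; (C2) $f$ is differentiable on $\operatorname{dom}h$ and there are scalars $0<m_f\le L_f$ such that for all $u,z\in\operatorname{dom}h$: $\|\nabla f(z)-\nabla f(u)\|\le L_f\|z-u\|$ and $-\frac{m_f}{2}\|u-z\|^2+\ell_f(u;z)\le f(u)$; (C3) there exists $\hat c\ge0$ such that $\hat\varphi_{\hat c}>-\infty$, where $\varphi_c(z):=(f+h)(z)+\frac c2\|Az-b\|^2$ and $\hat\varphi_c:=\inf_{z\in\mathbb{R}^n}\varphi_c(z)$. Define $R_{\hat c}(\lambda):=\inf\{\frac12\|z_0-u\|^2+(1-\sigma)\lambda[\varphi_{\hat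 c}(u)-\hat\varphi_{\hat c}]:u\in\mathcal{F}\}$. ACG method. Applied to $\min_x\{\psi(x):=\psi_s(x)+\psi_n(x)\}$, where $\psi_n$ is proper closed $\mu$-strongly convex and $\psi_s$ is convex, differentiable on $\operatorname{dom}\psi_n$ with $\psi_s(u)-\ell_{\psi_s}(u;x)\le\frac L2\|u-x\|^2$ on $\operatorname{dom}\psi_n$, from a starting point $x_0\in\operatorname{dom}\psi_n$: set $y_0=x_0$, $A_0=0$, $\Gamma_0\equiv0$, and for $j=0,1,2,\dots$ compute $A_{j+1}=A_j+\frac{\mu A_j+1+\sqrt{(\mu A_j+1)^2+4L(\mu A_j+1)A_j}}{2L}$, $\tilde x_j=\frac{A_j}{A_{j+1}}x_j+\frac{A_{j+1}-A_j}{A_{j+1}}y_j$, $\Gamma_{j+1}=\frac{A_j}{A_{j+1}}\Gamma_j+\frac{A_{j+1}-A_j}{A_{j+1}}\ell_{\psi_s}(\cdot;\tilde x_j)$, $y_{j+1}=\operatorname{argmin}_y\{\Gamma_{j+1}(y)+\psi_n(y)+\frac{1}{2A_{j+1}}\|y-y_0\|^2\}$, $x_{j+1}=\frac{A_j}{A_{j+1}}x_j+\frac{A_{j+1}-A_j}{A_{j+1}}y_{j+1}$, $u_{j+1}=\frac{y_0-y_{j+1}}{A_{j+1}}$, $\eta_{j+1}=\psi(x_{j+1})-\Gamma_{j+1}(y_{j+1})-\psi_n(y_{j+1})-\langle u_{j+1},x_{j+1}-y_{j+1}\rangle$. Each such pass is one ACG (inner) iteration, producing the triple $(x_{j+1},u_{j+1},\eta_{j+1})$.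 AIPP method for $\min\{g(z)+h(z)\}$, where $-\frac m2\|u-z\|^2\le g(u)-\ell_g(u;z)\le\frac M2\|u-z\|^2$ on $\operatorname{dom}h$. Inputs: $z_0\in\operatorname{dom}h$, $\sigma\in(0,1)$, $(m,M)$, $0<\lambda\le1/(2m)$, tolerances $(\bar\rho,\bar\varepsilon)\in\mathbb{R}_{++}^2$. Set $k=1$. Step 1: run the ACG method from $x_0=z_{k-1}$ with $\psi_s=\lambda g+\frac14\|\cdot-z_{k-1}\|^2$, $\psi_n=\lambda h+\frac14\|\cdot-z_{k-1}\|^2$ (with $\mu=1/2$, $L=\lambda M+1/2$) for at least $\lceil6\sqrt{2\lambda M+1}\rceil$ iterations, and until a triple $(x,u,\eta)$ is obtained with $u\in\partial_\eta(\lambda(g+h)+\frac12\|\cdot-z_{k-1}\|^2)(x)$ and $\|u\|^2+2\eta\le\sigma\|z_{k-1}-x+u\|^2$ (the inclusion holds for every ACG iterate, so only the inequality is checked). Step 2: if $\|z_{k-1}-x+u\|\le\lambda\bar\rho/5$, go to Step 3; otherwise set $(z_k,\tilde v_k,\tilde\varepsilon_k)=(x,u,\eta)$, $k\leftarrow k+1$ and go to Step 1. Step 3: continue the last ACG run until an iterate $(\tilde x,\tilde u,\tilde\eta)$ is found satisfying the two conditions of Step 1 (with $(x,u,\eta)$ replaced by $(\tilde x,\tilde u,\tilde\eta)$) and $\tilde\eta/\lambda\le\bar\varepsilon$; set $(z_k,\tilde v_k,\tilde\varepsilon_k)=(\tilde x,\tilde u,\tilde\eta)$ and output $(\lambda,z^-,z,w,\varepsilon)=(\lambda,z_{k-1},z_k,\tilde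 v_k/\lambda,\tilde\varepsilon_k/\lambda)$. QP-AIPP method. Inputs: $z_0\in\operatorname{dom}h$, $\sigma\in(0,1)$, $L_f$, $m_f$, $(\hat\rho,\hat\eta)\in\mathbb{R}_{++}^2$. Step 0: set $\lambda=\frac1{2m_f}$, $c=\hat c+\frac{L_f}{\|A\|^2}$. Step 1: apply the AIPP method from $z_0$ with inputs $\sigma,\lambda$, $(m,M)=(m_f,L_f+c\|A\|^2)$ and $(\bar\rho,\bar\varepsilon)=\left(\frac{\hat\rho}4,\frac{\hat\rho^2}{32(M+2m)}\right)$ to the problem $\min\{g_c+h\}$ with $g_c:=f+\frac c2\|A(\cdot)-b\|^2$, obtaining $(\lambda,z^-,z,w,\varepsilon)$. Step 2: with $g=g_c$ compute $z_g=\operatorname{argmin}_u\{\ell_g(u;z)+h(u)+\frac{M+\lambda^{-1}}2\|u-z\|^2\}$, $q_g=(M+\lambda^{-1})(z-z_g)$ and $v_g=q_g+\nabla g(z_g)-\nabla g(z)$. Step 3: if $\|Az_g-b\|>\hat\eta$, replace $c$ by $2c$ and go to Step 1; otherwise stop and output $(\hat z,\hat v,\hat p)=(z_g,v_g,c(Az_g-b))$. The total number of inner iterations is the total number of ACG iterations performed over all calls. *)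

theory Defs
  imports "HOL-Analysis.Analysis"
begin

section \<open>Euclidean spaces of variable dimension\<close>

text \<open>
  The constant hidden in the iteration bound may depend neither on the problem data nor on the
  dimensions, so the dimensions have to be quantified inside a formula.  All spaces
  $\mathbb{R}^n$ therefore live in one inner product space: the finitely supported real sequences
  with the Euclidean inner product, in which $\mathbb{R}^n$ is the set of sequences
  supported on the first \<open>n\<close> coordinates.
\<close>

typedef rvec = "{x :: nat \<Rightarrow> real. finite {i. x i \<noteq> 0}}"
  morphisms coord Abs_rvec
  by (rule exI[of _ "\<lambda>_. 0"]) simp

setup_lifting type_definition_rvec

lemma rvec_eqI: "(\<And>i. coord x i = coord y i) \<Longrightarrow> x = y"
  by (simp add: coord_inject[symmetric] fun_eq_iff)

lemma finite_support_coord: "finite {i. coord x i \<noteq> 0}"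
  using coord[of x] by simp

instantiation rvec :: real_vector
begin

lift_definition zero_rvec :: rvec is "\<lambda>_. 0" by simp

lift_definition plus_rvec :: "rvec \<Rightarrow> rvec \<Rightarrow> rvec" is "\<lambda>x y i. x i + y i"
  subgoal for x y
    by (rule finite_subset[of _ "{i. x i \<noteq> 0} \<union> {i. y i \<noteq> 0}"]) auto
  done

lift_definition minus_rvec :: "rvec \<Rightarrow> rvec \<Rightarrow> rvec" is "\<lambda>x y i. x i - y i"
  subgoal for x y
    by (rule finite_subset[of _ "{i. x i \<noteq> 0} \<union> {i. y i \<noteq> 0}"]) auto
  done

lift_definition uminus_rvec :: "rvec \<Rightarrow> rvec" is "\<lambda>x i. - x i" by simp

lift_definition scaleR_rvec :: "real \<Rightarrow> rvec \<Rightarrow> rvec" is "\<lambda>a x i. a * x i"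
  by (rule finite_subset[rotated]) auto

instance
  by standard (transfer; simp add: fun_eq_iff algebra_simps)+

end

lemma coord_zero [simp]: "coord 0 i = 0"
  and coord_add [simp]: "coord (x + y) i = coord x i + coord y i"
  and coord_diff [simp]: "coord (x - y) i = coord x i - coord y i"
  and coord_uminus [simp]: "coord (- x) i = - coord x i"
  and coord_scaleR [simp]: "coord (a *\<^sub>R x) i = a * coord x i"
  by (transfer, simp)+

instantiation rvec :: real_inner
begin

definition inner_rvec :: "rvec \<Rightarrow> rvec \<Rightarrow> real"
  where "inner_rvec x y = (\<Sum>i | coord x i \<noteq> 0. coord x i * coord y i)"

definition norm_rvec :: "rvec \<Rightarrow> real"
  where "norm_rvec x = sqrt (x \<bullet> x)"

definition dist_rvec :: "rvec \<Rightarrow> rvec \<Rightarrow> real"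
  where "dist_rvec x y = norm (x - y)"

definition sgn_rvec :: "rvec \<Rightarrow> rvec"
  where "sgn_rvec x = inverse (norm x) *\<^sub>R x"

definition uniformity_rvec :: "(rvec \<times> rvec) filter"
  where "uniformity_rvec = (INF e\<in>{0<..}. principal {(x, y). dist x y < e})"

definition open_rvec :: "rvec set \<Rightarrow> bool"
  where "open_rvec U \<longleftrightarrow> (\<forall>x\<in>U. \<forall>\<^sub>F (x', y) in uniformity. x' = x \<longrightarrow> y \<in> U)"

lemma inner_rvec_superset:
  assumes "finite S" "{i. coord x i \<noteq> 0} \<subseteq> S"
  shows "x \<bullet> y = (\<Sum>i\<in>S. coord x i * coord y i)"
  unfolding inner_rvec_def by (rule sum.mono_neutral_left) (use assms in auto)

instance
proof
  fix x y z :: rvec and a :: real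
  let ?S = "{i. coord x i \<noteq> 0} \<union> {i. coord y i \<noteq> 0}"
  have S: "finite ?S" by (simp add: finite_support_coord)
  show "x \<bullet> y = y \<bullet> x"
    by (simp add: inner_rvec_superset[OF S, of x] inner_rvec_superset[OF S, of y] mult.commute)
  show "(x + y) \<bullet> z = x \<bullet> z + y \<bullet> z"
  proof -
    have *: "{i. coord (x + y) i \<noteq> 0} \<subseteq> ?S" by auto
    show ?thesis
      by (simp add: inner_rvec_superset[OF S *] inner_rvec_superset[OF S, of x]
          inner_rvec_superset[OF S, of y] sum.distrib algebra_simps)
  qed
  show "(a *\<^sub>R x) \<bullet> y = a * (x \<bullet> y)"
  proof -
    have *: "{i. coord (a *\<^sub>R x) i \<noteq> 0} \<subseteq> ?S" by auto
    show ?thesis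
      by (simp add: inner_rvec_superset[OF S *] inner_rvec_superset[OF S, of x]
          sum_distrib_left algebra_simps)
  qed
  show "0 \<le> x \<bullet> x"
    unfolding inner_rvec_def by (rule sum_nonneg) simp
  show "x \<bullet> x = 0 \<longleftrightarrow> x = 0"
  proof
    assume "x \<bullet> x = 0"
    then have "\<forall>i\<in>{i. coord x i \<noteq> 0}. coord x i * coord x i = 0"
      unfolding inner_rvec_def by (subst (asm) sum_nonneg_eq_0_iff)
        (auto simp: finite_support_coord)
    then show "x = 0" by (intro rvec_eqI) auto
  qed (simp add: inner_rvec_def)
qed (simp_all add: norm_rvec_def dist_rvec_def sgn_rvec_def uniformity_rvec_def open_rvec_def)

end

definition Rn :: "nat \<Rightarrow> rvec set"
  where "Rn n = {x. \<forall>i\<ge>n. coord x i = 0}"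

lift_definition basis_rvec :: "nat \<Rightarrow> rvec" is "\<lambda>k i. if i = k then 1 else 0"
  by simp

text \<open>
  The map $x \mapsto Ax$ of an $l\times n$ matrix.  Coordinates of \<open>x\<close> beyond \<open>n\<close> are ignored, so
  \<^const>\<open>onorm\<close> of this map is the operator norm of $A:\mathbb{R}^n\to\mathbb{R}^l$.
\<close>

definition mat_vec :: "nat \<Rightarrow> nat \<Rightarrow> (nat \<Rightarrow> nat \<Rightarrow> real) \<Rightarrow> rvec \<Rightarrow> rvec"
  where "mat_vec l n A x = (\<Sum>i<l. (\<Sum>j<n. A i j * coord x j) *\<^sub>R basis_rvec i)"

definition mat_norm :: "nat \<Rightarrow> nat \<Rightarrow> (nat \<Rightarrow> nat \<Rightarrow> real) \<Rightarrow> real"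
  where "mat_norm l n A = onorm (mat_vec l n A)"

definition mat_adjoint :: "(nat \<Rightarrow> nat \<Rightarrow> real) \<Rightarrow> nat \<Rightarrow> nat \<Rightarrow> real"
  where "mat_adjoint A = (\<lambda>i j. A j i)"


section \<open>Functions on \<open>\<real>\<^sup>n\<close>\<close>

text \<open>
  Only the values of a function on \<^term>\<open>Rn n\<close> are ever used.  The smooth part \<open>f\<close> is real
  valued everywhere: its values off the domain of \<open>h\<close> cannot matter, since all sums with
  \<open>h\<close> are infinite there.
\<close>

definition edom :: "nat \<Rightarrow> (rvec \<Rightarrow> ereal) \<Rightarrow> rvec set"
  where "edom n \<psi> = {z \<in> Rn n. \<psi> z < \<infinity>}"

definition proper_on :: "nat \<Rightarrow> (rvec \<Rightarrow> ereal) \<Rightarrow> bool"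
  where "proper_on n \<psi> \<longleftrightarrow> (\<forall>z\<in>Rn n. \<psi> z \<noteq> -\<infinity>) \<and> edom n \<psi> \<noteq> {}"

definition lsc_on :: "nat \<Rightarrow> (rvec \<Rightarrow> ereal) \<Rightarrow> bool"
  where "lsc_on n \<psi> \<longleftrightarrow> (\<forall>z\<in>Rn n. \<psi> z \<le> Liminf (at z within Rn n) \<psi>)"

definition econvex_on :: "nat \<Rightarrow> (rvec \<Rightarrow> ereal) \<Rightarrow> bool"
  where "econvex_on n \<psi> \<longleftrightarrow>
    (\<forall>x\<in>Rn n. \<forall>y\<in>Rn n. \<forall>t. 0 < t \<and> t < 1 \<longrightarrow>
       \<psi> ((1 - t) *\<^sub>R x + t *\<^sub>R y) \<le> ereal (1 - t) * \<psi> x + ereal t * \<psi> y)"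

definition eps_subdiff :: "nat \<Rightarrow> real \<Rightarrow> (rvec \<Rightarrow> ereal) \<Rightarrow> rvec \<Rightarrow> rvec set"
  where "eps_subdiff n \<epsilon> \<psi> z =
    {v \<in> Rn n. z \<in> edom n \<psi> \<and> (\<forall>u\<in>Rn n. \<psi> u \<ge> \<psi> z + ereal (v \<bullet> (u - z) - \<epsilon>))}"

definition grad :: "nat \<Rightarrow> (rvec \<Rightarrow> real) \<Rightarrow> rvec \<Rightarrow> rvec"
  where "grad n f z =
    (THE D. D \<in> Rn n \<and> (f has_derivative (\<lambda>d. D \<bullet> d)) (at z within Rn n))"

text \<open>\<open>linearization n \<psi> z u\<close> is $\ell_\psi(u;z)$.\<close>

definition linearization :: "nat \<Rightarrow> (rvec \<Rightarrow> real) \<Rightarrow> rvec \<Rightarrow> rvec \<Rightarrow> real"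
  where "linearization n \<psi> z u = \<psi> z + grad n \<psi> z \<bullet> (u - z)"

definition argmin_Rn :: "nat \<Rightarrow> (rvec \<Rightarrow> ereal) \<Rightarrow> rvec"
  where "argmin_Rn n F = (ARG_MIN F u. u \<in> Rn n)"

definition log1_plus :: "real \<Rightarrow> real"
  where "log1_plus t = max (ln t) 1"


section \<open>The linearly constrained problem\<close>

definition feasible ::
  "nat \<Rightarrow> nat \<Rightarrow> (nat \<Rightarrow> nat \<Rightarrow> real) \<Rightarrow> rvec \<Rightarrow> (rvec \<Rightarrow> ereal) \<Rightarrow> rvec set"
  where "feasible l n A b h = {z \<in> edom n h. mat_vec l n A z = b}"

definition phi ::
  "nat \<Rightarrow> nat \<Rightarrow> (nat \<Rightarrow> nat \<Rightarrow> real) \<Rightarrow> rvec \<Rightarrow> (rvec \<Rightarrow> real) \<Rightarrow> (rvec \<Rightarrow> ereal)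
    \<Rightarrow> real \<Rightarrow> rvec \<Rightarrow> ereal"
  where "phi l n A b f h c z =
    ereal (f z) + h z + ereal (c / 2 * (norm (mat_vec l n A z - b))\<^sup>2)"

definition phi_inf ::
  "nat \<Rightarrow> nat \<Rightarrow> (nat \<Rightarrow> nat \<Rightarrow> real) \<Rightarrow> rvec \<Rightarrow> (rvec \<Rightarrow> real) \<Rightarrow> (rvec \<Rightarrow> ereal)
    \<Rightarrow> real \<Rightarrow> ereal"
  where "phi_inf l n A b f h c = (INF z\<in>Rn n. phi l n A b f h c z)"

definition cond_C1 ::
  "nat \<Rightarrow> nat \<Rightarrow> (nat \<Rightarrow> nat \<Rightarrow> real) \<Rightarrow> rvec \<Rightarrow> (rvec \<Rightarrow> ereal) \<Rightarrow> bool"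
  where "cond_C1 l n A b h \<longleftrightarrow>
    proper_on n h \<and> lsc_on n h \<and> econvex_on n h \<and>
    (\<exists>i<l. \<exists>j<n. A i j \<noteq> 0) \<and> b \<in> Rn l \<and> feasible l n A b h \<noteq> {}"

definition cond_C2 ::
  "nat \<Rightarrow> (rvec \<Rightarrow> real) \<Rightarrow> (rvec \<Rightarrow> ereal) \<Rightarrow> real \<Rightarrow> real \<Rightarrow> bool"
  where "cond_C2 n f h m L \<longleftrightarrow>
    0 < m \<and> m \<le> L \<and>
    (\<forall>z\<in>edom n h. f differentiable (at z within Rn n)) \<and>
    (\<forall>u\<in>edom n h. \<forall>z\<in>edom n h.
       norm (grad n f z - grad n f u) \<le> L * norm (z - u) \<and>
       - (m / 2) * (norm (u - z))\<^sup>2 + linearization n f z u \<le> f u)"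

definition cond_C3 ::
  "nat \<Rightarrow> nat \<Rightarrow> (nat \<Rightarrow> nat \<Rightarrow> real) \<Rightarrow> rvec \<Rightarrow> (rvec \<Rightarrow> real) \<Rightarrow> (rvec \<Rightarrow> ereal)
    \<Rightarrow> real \<Rightarrow> bool"
  where "cond_C3 l n A b f h chat \<longleftrightarrow> chat \<ge> 0 \<and> phi_inf l n A b f h chat > -\<infinity>"

text \<open>
  $R_{\hat c}(\lambda)$; under the standing assumptions the infimum is a nonnegative real number,
  so the conversion from \<^typ>\<open>ereal\<close> loses nothing.
\<close>

definition R_val ::
  "nat \<Rightarrow> nat \<Rightarrow> (nat \<Rightarrow> nat \<Rightarrow> real) \<Rightarrow> rvec \<Rightarrow> (rvec \<Rightarrow> real) \<Rightarrow> (rvec \<Rightarrow> ereal)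
    \<Rightarrow> real \<Rightarrow> real \<Rightarrow> rvec \<Rightarrow> real \<Rightarrow> real"
  where "R_val l n A b f h chat \<sigma> z0 lam = real_of_ereal
    (INF u\<in>feasible l n A b h.
       ereal ((norm (z0 - u))\<^sup>2 / 2)
         + ereal ((1 - \<sigma>) * lam) * (phi l n A b f h chat u - phi_inf l n A b f h chat))"


section \<open>The ACG method\<close>

record acg_state =
  acg_A :: real
  acg_x :: rvec
  acg_y :: rvec
  acg_Gamma :: "rvec \<Rightarrow> real"

definition acg_step ::
  "nat \<Rightarrow> real \<Rightarrow> real \<Rightarrow> (rvec \<Rightarrow> real) \<Rightarrow> (rvec \<Rightarrow> ereal) \<Rightarrow> rvec \<Rightarrow> acg_state \<Rightarrow> acg_state"
  where "acg_step n \<mu> L \<psi>s \<psi>n x0 s =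
    (let a = acg_A s;
         a' = a + (\<mu> * a + 1 + sqrt ((\<mu> * a + 1)\<^sup>2 + 4 * L * (\<mu> * a + 1) * a)) / (2 * L);
         xt = (a / a') *\<^sub>R acg_x s + ((a' - a) / a') *\<^sub>R acg_y s;
         \<Gamma>' = (\<lambda>u. a / a' * acg_Gamma s u + (a' - a) / a' * linearization n \<psi>s xt u);
         y' = argmin_Rn n (\<lambda>y. ereal (\<Gamma>' y) + \<psi>n y + ereal (1 / (2 * a') * (norm (y - x0))\<^sup>2));
         x' = (a / a') *\<^sub>R acg_x s + ((a' - a) / a') *\<^sub>R y'
     in \<lparr>acg_A = a', acg_x = x', acg_y = y', acg_Gamma = \<Gamma>'\<rparr>)"

definition acg_iter ::
  "nat \<Rightarrow> real \<Rightarrow> real \<Rightarrow> (rvec \<Rightarrow> real) \<Rightarrow> (rvec \<Rightarrow> ereal) \<Rightarrow> rvec \<Rightarrow> nat \<Rightarrow> acg_state"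
  where "acg_iter n \<mu> L \<psi>s \<psi>n x0 j =
    (acg_step n \<mu> L \<psi>s \<psi>n x0 ^^ j) \<lparr>acg_A = 0, acg_x = x0, acg_y = x0, acg_Gamma = (\<lambda>_. 0)\<rparr>"

text \<open>
  The triple $(x_j,u_j,\eta_j)$ produced by the \<open>j\<close>-th iteration, meaningful for \<open>j \<ge> 1\<close>.
\<close>

definition acg_triple ::
  "nat \<Rightarrow> real \<Rightarrow> real \<Rightarrow> (rvec \<Rightarrow> real) \<Rightarrow> (rvec \<Rightarrow> ereal) \<Rightarrow> rvec \<Rightarrow> nat \<Rightarrow> rvec \<times> rvec \<times> real"
  where "acg_triple n \<mu> L \<psi>s \<psi>n x0 j =
    (let s = acg_iter n \<mu> L \<psi>s \<psi>n x0 j;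
         x = acg_x s; y = acg_y s;
         u = (1 / acg_A s) *\<^sub>R (x0 - y);
         \<eta> = real_of_ereal (ereal (\<psi>s x) + \<psi>n x) - acg_Gamma s y - real_of_ereal (\<psi>n y)
               - u \<bullet> (x - y)
     in (x, u, \<eta>))"


section \<open>The AIPP method\<close>

text \<open>The ACG run of one outer iteration, started at the prox center \<open>z\<close>.\<close>

definition prox_acg ::
  "nat \<Rightarrow> (rvec \<Rightarrow> real) \<Rightarrow> (rvec \<Rightarrow> ereal) \<Rightarrow> real \<Rightarrow> real \<Rightarrow> rvec \<Rightarrow> nat \<Rightarrow> rvec \<times> rvec \<times> real"
  where "prox_acg n g h lam M z =
    acg_triple n (1 / 2) (lam * M + 1 / 2)
      (\<lambda>x. lam * g x + 1 / 4 * (norm (x - z))\<^sup>2)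
      (\<lambda>x. ereal lam * h x + ereal (1 / 4 * (norm (x - z))\<^sup>2)) z"

text \<open>
  The acceptance test for $(x,u,\eta)$ is the inequality alone: the inclusion
  $u\in\partial_\eta(\lambda(g+h)+\frac12\|\cdot-z\|^2)(x)$ holds for every ACG iterate.
\<close>

definition prox_crit :: "real \<Rightarrow> rvec \<Rightarrow> rvec \<times> rvec \<times> real \<Rightarrow> bool"
  where "prox_crit \<sigma> z = (\<lambda>(x, u, \<eta>). (norm u)\<^sup>2 + 2 * \<eta> \<le> \<sigma> * (norm (z - x + u))\<^sup>2)"

definition is_first :: "(nat \<Rightarrow> bool) \<Rightarrow> nat \<Rightarrow> bool"
  where "is_first P j \<longleftrightarrow> P j \<and> (\<forall>i<j. \<not> P i)"

definition aipp_step1 ::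
  "nat \<Rightarrow> (rvec \<Rightarrow> real) \<Rightarrow> (rvec \<Rightarrow> ereal) \<Rightarrow> real \<Rightarrow> real \<Rightarrow> real \<Rightarrow> rvec \<Rightarrow> nat \<Rightarrow> bool"
  where "aipp_step1 n g h \<sigma> lam M z =
    is_first (\<lambda>j. j \<ge> nat \<lceil>6 * sqrt (2 * lam * M + 1)\<rceil> \<and> prox_crit \<sigma> z (prox_acg n g h lam M z j))"

text \<open>
  \<open>aipp n g h \<sigma> lam M \<rho> \<epsilon> z out N\<close>: the method, when at Step 1 with current prox center \<open>z\<close>,
  terminates with output \<open>out\<close> = $(z^-,z,w,\varepsilon)$ (the component $\lambda$ being an input)
  after \<open>N\<close> further ACG iterations.  In the last outer iteration the ACG run of Step 1 is
  continued rather than restarted, so its iterations are counted once.  The input \<open>m\<close> only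
  restricts \<open>lam\<close>.
\<close>

inductive aipp ::
  "nat \<Rightarrow> (rvec \<Rightarrow> real) \<Rightarrow> (rvec \<Rightarrow> ereal) \<Rightarrow> real \<Rightarrow> real \<Rightarrow> real \<Rightarrow> real \<Rightarrow> real
    \<Rightarrow> rvec \<Rightarrow> rvec \<times> rvec \<times> rvec \<times> real \<Rightarrow> nat \<Rightarrow> bool"
  for n g h \<sigma> lam M \<rho> \<epsilon>
where
  aipp_continue:
    "\<lbrakk> aipp_step1 n g h \<sigma> lam M z j; prox_acg n g h lam M z j = (x, u, \<eta>);
       norm (z - x + u) > lam * \<rho> / 5;
       aipp n g h \<sigma> lam M \<rho> \<epsilon> x out N \<rbrakk>
     \<Longrightarrow> aipp n g h \<sigma> lam M \<rho> \<epsilon> z out (j + N)"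
| aipp_stop:
    "\<lbrakk> aipp_step1 n g h \<sigma> lam M z j; prox_acg n g h lam M z j = (x, u, \<eta>);
       norm (z - x + u) \<le> lam * \<rho> / 5;
       is_first (\<lambda>i. i \<ge> j \<and> prox_crit \<sigma> z (prox_acg n g h lam M z i)
                    \<and> snd (snd (prox_acg n g h lam M z i)) / lam \<le> \<epsilon>) i;
       prox_acg n g h lam M z i = (x', u', \<eta>') \<rbrakk>
     \<Longrightarrow> aipp n g h \<sigma> lam M \<rho> \<epsilon> z (z, x', (1 / lam) *\<^sub>R u', \<eta>' / lam) i"


section \<open>The QP-AIPP method\<close>

definition penalized ::
  "nat \<Rightarrow> nat \<Rightarrow> (nat \<Rightarrow> nat \<Rightarrow> real) \<Rightarrow> rvec \<Rightarrow> (rvec \<Rightarrow> real) \<Rightarrow> real \<Rightarrow> rvec \<Rightarrow> real"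
  where "penalized l n A b f c z = f z + c / 2 * (norm (mat_vec l n A z - b))\<^sup>2"

text \<open>The pair $(z_g,v_g)$ computed from the AIPP output \<open>z\<close>.\<close>

definition refine ::
  "nat \<Rightarrow> (rvec \<Rightarrow> real) \<Rightarrow> (rvec \<Rightarrow> ereal) \<Rightarrow> real \<Rightarrow> real \<Rightarrow> rvec \<Rightarrow> rvec \<times> rvec"
  where "refine n g h lam M z =
    (let zg = argmin_Rn n (\<lambda>u. ereal (linearization n g z u) + h u
                 + ereal ((M + 1 / lam) / 2 * (norm (u - z))\<^sup>2));
         qg = (M + 1 / lam) *\<^sub>R (z - zg);
         vg = qg + grad n g zg - grad n g z
     in (zg, vg))"

text \<open>One pass through Steps 1 and 2 for the penalty parameter \<open>c\<close>, using \<open>N\<close> ACG iterations.\<close>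

definition qp_pass ::
  "nat \<Rightarrow> nat \<Rightarrow> (nat \<Rightarrow> nat \<Rightarrow> real) \<Rightarrow> rvec \<Rightarrow> (rvec \<Rightarrow> real) \<Rightarrow> (rvec \<Rightarrow> ereal)
    \<Rightarrow> rvec \<Rightarrow> real \<Rightarrow> real \<Rightarrow> real \<Rightarrow> real \<Rightarrow> real \<Rightarrow> rvec \<times> rvec \<Rightarrow> nat \<Rightarrow> bool"
  where "qp_pass l n A b f h z0 \<sigma> L m \<rho> c zv N \<longleftrightarrow>
    (let lam = 1 / (2 * m);
         M = L + c * (mat_norm l n A)\<^sup>2;
         g = penalized l n A b f c
     in \<exists>zm z w \<epsilon>.
          aipp n g h \<sigma> lam M (\<rho> / 4) (\<rho>\<^sup>2 / (32 * (M + 2 * m))) z0 (zm, z, w, \<epsilon>) N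
          \<and> zv = refine n g h lam M z)"

text \<open>
  \<open>qp_aipp_from \<dots> c out N\<close>: the method, when at Step 1 with penalty parameter \<open>c\<close>, terminates with
  output \<open>out\<close> after \<open>N\<close> further ACG iterations.
\<close>

inductive qp_aipp_from ::
  "nat \<Rightarrow> nat \<Rightarrow> (nat \<Rightarrow> nat \<Rightarrow> real) \<Rightarrow> rvec \<Rightarrow> (rvec \<Rightarrow> real) \<Rightarrow> (rvec \<Rightarrow> ereal)
    \<Rightarrow> rvec \<Rightarrow> real \<Rightarrow> real \<Rightarrow> real \<Rightarrow> real \<Rightarrow> real
    \<Rightarrow> real \<Rightarrow> rvec \<times> rvec \<times> rvec \<Rightarrow> nat \<Rightarrow> bool"
  for l n A b f h z0 \<sigma> L m \<rho> \<eta>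
where
  qp_double:
    "\<lbrakk> qp_pass l n A b f h z0 \<sigma> L m \<rho> c (zg, vg) N;
       norm (mat_vec l n A zg - b) > \<eta>;
       qp_aipp_from l n A b f h z0 \<sigma> L m \<rho> \<eta> (2 * c) out N' \<rbrakk>
     \<Longrightarrow> qp_aipp_from l n A b f h z0 \<sigma> L m \<rho> \<eta> c out (N + N')"
| qp_stop:
    "\<lbrakk> qp_pass l n A b f h z0 \<sigma> L m \<rho> c (zg, vg) N;
       norm (mat_vec l n A zg - b) \<le> \<eta> \<rbrakk>
     \<Longrightarrow> qp_aipp_from l n A b f h z0 \<sigma> L m \<rho> \<eta> c
           (zg, vg, c *\<^sub>R (mat_vec l n A zg - b)) N"

text \<open>
  The method is deterministic (all minimizers involved are unique), hence it terminates
  iff \<open>qp_aipp\<close> holds for some output and some total number \<open>N\<close> of ACG iterations.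
\<close>

definition qp_aipp ::
  "nat \<Rightarrow> nat \<Rightarrow> (nat \<Rightarrow> nat \<Rightarrow> real) \<Rightarrow> rvec \<Rightarrow> (rvec \<Rightarrow> real) \<Rightarrow> (rvec \<Rightarrow> ereal)
    \<Rightarrow> real \<Rightarrow> rvec \<Rightarrow> real \<Rightarrow> real \<Rightarrow> real \<Rightarrow> real \<Rightarrow> real
    \<Rightarrow> rvec \<times> rvec \<times> rvec \<Rightarrow> nat \<Rightarrow> bool"
  where "qp_aipp l n A b f h chat z0 \<sigma> L m \<rho> \<eta> =
    qp_aipp_from l n A b f h z0 \<sigma> L m \<rho> \<eta> (chat + L / (mat_norm l n A)\<^sup>2)"

end

theory Submission
  imports Defs
begin

text \<open>
  Fix a penalty parameter \<open>c\<close> and write \<open>\<phi>\<close> for the penalized objective, \<open>lam = 1 / (2 m)\<close>.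
  With this proximal parameter each subproblem, minimizing \<open>lam * \<phi>\<close> plus half the squared
  distance to the current center \<open>z\<close>, is strongly convex, although \<open>f\<close> is not convex.

  The accelerated method maintains an affine minorant \<open>\<Gamma>\<close> of the smooth part and a weight \<open>A\<close>
  such that \<open>A\<close> times the objective at \<open>x\<close> is at most the minimum of
  \<open>A * (\<Gamma> + \<psi>n) + \<parallel>\<cdot> - z\<parallel>\<^sup>2 / 2\<close> (lemma \<open>acg_step_inv\<close>). Hence \<open>u\<close> is an \<open>\<eta>\<close>-subgradient at \<open>x\<close>, and
  \<open>\<parallel>u\<parallel>\<close> and \<open>\<eta>\<close> are of the order \<open>1 / A\<close> relative to \<open>\<parallel>x - z\<parallel>\<close> and its square
  (\<open>acg_triple_properties\<close>, \<open>prox_estimates\<close>). As \<open>A\<close> grows quadratically, the relative test of a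
  proximal step holds after a multiple of \<open>S = sqrt (2 lam M + 1)\<close> iterations; as it also grows
  geometrically with ratio \<open>1 + 1 / S\<close>, the absolute tolerance of the last step costs only a further
  factor \<open>ln S\<close>. Different iterates of one run have comparable distances to \<open>z\<close>
  (\<open>prox_iterates_comparable\<close>), so continuing the last run does not spoil its small residual.

  An accepted proximal step with a large residual lowers \<open>lam * \<phi>\<close> by a fixed amount
  (\<open>prox_step_decrease\<close>), and already the first step makes \<open>\<phi>\<close> exceed its value at any competitor
  by no more than a multiple of the squared distance to it (\<open>prox_step_value\<close>). Taking feasible
  competitors, on which the penalty vanishes, bounds the number of steps by \<open>R\<close> independently of \<open>c\<close>
  (\<open>aipp_properties\<close>). The same comparison bounds \<open>(c - chat) / 2 * \<parallel>A z - b\<parallel>\<^sup>2\<close> by a multiple of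
  \<open>R\<close>, so that every pass with \<open>c \<ge> T\<close> ends in an almost feasible point
  (\<open>pass_properties\<close>, \<open>large_penalty_stops\<close>). Finally, a pass costs a multiple of \<open>sqrt c\<close>, and along
  the doubling of \<open>c\<close> these costs form a geometric series dominated by its last term, where
  \<open>c \<le> max c0 (2 T)\<close> (\<open>qp_aipp_from_properties\<close>).

  Proximal points exist because minimizing sequences of strongly convex functions are Cauchy
  sequences and \<open>Rn n\<close> is complete (\<open>prox_point_exists\<close>).
\<close>

section \<open>The coordinate spaces\<close>

lemma coord_sum [simp]: "coord (sum g S) i = (\<Sum>k\<in>S. coord (g k) i)"
  by (induction S rule: infinite_finite_induct) auto

lemma coord_basis_rvec [simp]: "coord (basis_rvec k) i = (if i = k then 1 else 0)"
  by transfer simp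

lemma inner_basis_rvec [simp]: "x \<bullet> basis_rvec k = coord x k"
proof -
  have "x \<bullet> basis_rvec k = basis_rvec k \<bullet> x" by (rule inner_commute)
  also have "\<dots> = (\<Sum>i\<in>{k}. coord (basis_rvec k) i * coord x i)"
    by (rule inner_rvec_superset) (auto split: if_splits)
  finally show ?thesis by simp
qed

lemma norm_basis_rvec [simp]: "norm (basis_rvec k) = 1"
  by (simp add: norm_eq_sqrt_inner)

lemma abs_coord_le_norm: "\<bar>coord x i\<bar> \<le> norm x"
  using Cauchy_Schwarz_ineq2[of x "basis_rvec i"] by simp

lemma add_in_Rn [simp]: "x \<in> Rn n \<Longrightarrow> y \<in> Rn n \<Longrightarrow> x + y \<in> Rn n"
  and diff_in_Rn [simp]: "x \<in> Rn n \<Longrightarrow> y \<in> Rn n \<Longrightarrow> x - y \<in> Rn n"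
  and scaleR_in_Rn [simp]: "x \<in> Rn n \<Longrightarrow> a *\<^sub>R x \<in> Rn n"

  by (auto simp: Rn_def)

lemma inner_Rn: "x \<in> Rn n \<Longrightarrow> x \<bullet> y = (\<Sum>i<n. coord x i * coord y i)"
  by (rule inner_rvec_superset) (auto simp: Rn_def not_less[symmetric])

lemma Rn_expansion: "x \<in> Rn n \<Longrightarrow> x = (\<Sum>i<n. coord x i *\<^sub>R basis_rvec i)"
  by (rule rvec_eqI) (auto simp: Rn_def if_distrib[where f="\<lambda>t. _ * t"] cong: if_cong)

lemma complete_Rn: "complete (Rn n)"
  unfolding complete_def
proof (intro allI impI)
  fix f :: "nat \<Rightarrow> rvec"
  assume A: "(\<forall>k. f k \<in> Rn n) \<and> Cauchy f"
  have "Cauchy (\<lambda>k. coord (f k) i)" for i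
  proof (rule CauchyI)
    fix e :: real assume "e > 0"
    then obtain N where N: "\<forall>k\<ge>N. \<forall>l\<ge>N. norm (f k - f l) < e"
      using A CauchyD by blast
    have "norm (coord (f k) i - coord (f l) i) \<le> norm (f k - f l)" for k l
      using abs_coord_le_norm[of "f k - f l" i] by simp
    then show "\<exists>M. \<forall>m\<ge>M. \<forall>n\<ge>M. norm (coord (f m) i - coord (f n) i) < e"
      using N by (meson order_le_less_trans)
  qed
  then have "\<exists>l. (\<lambda>k. coord (f k) i) \<longlonglongrightarrow> l" for i
    using Cauchy_convergent convergentD by blast
  then obtain l where l: "\<And>i. (\<lambda>k. coord (f k) i) \<longlonglongrightarrow> l i" by metis
  define x where "x = (\<Sum>i<n. l i *\<^sub>R basis_rvec i)"
  have x: "x \<in> Rn n" by (auto simp: x_def Rn_def)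
  have "(\<lambda>k. \<Sum>i<n. coord (f k) i *\<^sub>R basis_rvec i) \<longlonglongrightarrow> x"
    unfolding x_def by (intro tendsto_intros l)
  moreover have "(\<lambda>k. \<Sum>i<n. coord (f k) i *\<^sub>R basis_rvec i) = f"
    using A by (intro ext) (simp flip: Rn_expansion)
  ultimately have "f \<longlonglongrightarrow> x" by simp
  then show "\<exists>l\<in>Rn n. f \<longlonglongrightarrow> l" using x by blast
qed

lemma coord_mat_vec: "coord (mat_vec l n A x) i = (if i < l then \<Sum>j<n. A i j * coord x j else 0)"
  by (auto simp: mat_vec_def if_distrib[where f="\<lambda>t. _ * t"] cong: if_cong)

lemma mat_vec_in_Rn [simp]: "mat_vec l n A x \<in> Rn l"
  by (simp add: Rn_def coord_mat_vec)

lemma linear_mat_vec: "linear (mat_vec l n A)"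
  by (rule linearI; rule rvec_eqI)
     (auto simp: coord_mat_vec sum.distrib sum_distrib_left algebra_simps)

lemma bounded_linear_mat_vec: "bounded_linear (mat_vec l n A)"
proof -
  have "norm (mat_vec l n A x) \<le> norm x * (\<Sum>i<l. \<Sum>j<n. \<bar>A i j\<bar>)" for x
  proof -
    have "norm (mat_vec l n A x) \<le> (\<Sum>i<l. \<bar>\<Sum>j<n. A i j * coord x j\<bar>)"
      unfolding mat_vec_def by (rule order_trans[OF norm_sum]) simp
    also have "\<dots> \<le> (\<Sum>i<l. \<Sum>j<n. \<bar>A i j\<bar> * norm x)"
      by (intro sum_mono order_trans[OF sum_abs]) (auto simp: abs_mult intro: mult_left_mono abs_coord_le_norm)
    finally show ?thesis by (simp add: sum_distrib_left mult.commute)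
  qed
  then show ?thesis
    using linear_mat_vec linear_conv_bounded_linear
    by (intro bounded_linear_intro[where K="\<Sum>i<l. \<Sum>j<n. \<bar>A i j\<bar>"])
       (auto simp: linear_add linear_scale)
qed

lemma norm_mat_vec_le: "norm (mat_vec l n A x) \<le> mat_norm l n A * norm x"
  unfolding mat_norm_def using onorm[OF bounded_linear_mat_vec] .

lemma mat_norm_pos:
  assumes "i < l" "j < n" "A i j \<noteq> 0"
  shows "mat_norm l n A > 0"
proof -
  have "coord (mat_vec l n A (basis_rvec j)) i = A i j"
    using assms by (simp add: coord_mat_vec if_distrib[where f="\<lambda>t. _ * t"] cong: if_cong)
  then have "\<bar>A i j\<bar> \<le> mat_norm l n A * norm (basis_rvec j)"
    by (metis abs_coord_le_norm norm_mat_vec_le order_trans)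
  then show ?thesis using assms by simp
qed

lemma mat_adjoint: "mat_vec l n A x \<bullet> y = x \<bullet> mat_vec n l (mat_adjoint A) y"
proof -
  have "mat_vec l n A x \<bullet> y = (\<Sum>i<l. \<Sum>j<n. A i j * coord x j * coord y i)"
    by (simp add: inner_Rn[OF mat_vec_in_Rn] coord_mat_vec sum_distrib_right)
  also have "\<dots> = (\<Sum>j<n. \<Sum>i<l. A i j * coord x j * coord y i)"
    by (rule sum.swap)
  also have "\<dots> = mat_vec n l (mat_adjoint A) y \<bullet> x"
    by (simp add: inner_Rn[OF mat_vec_in_Rn] coord_mat_vec mat_adjoint_def sum_distrib_left sum_distrib_right mult_ac)
  finally show ?thesis by (simp add: inner_commute)
qed

section \<open>Gradients\<close>

text \<open>
  Restricting to a line turns everything that is needed about gradients into a statement about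
  real functions of one real variable.
\<close>

lemma has_derivative_along_line:
  assumes der: "(f has_derivative (\<lambda>d. D \<bullet> d)) (at (x + t *\<^sub>R d) within Rn n)"
    and x: "x \<in> Rn n" and d: "d \<in> Rn n"
  shows "((\<lambda>s. f (x + s *\<^sub>R d)) has_real_derivative D \<bullet> d) (at t)"
proof -
  have line: "((\<lambda>s. x + s *\<^sub>R d) has_derivative (\<lambda>s. s *\<^sub>R d)) (at t)"
    by (auto intro!: derivative_eq_intros)
  have "((\<lambda>s. f (x + s *\<^sub>R d)) has_derivative (\<lambda>s. D \<bullet> (s *\<^sub>R d))) (at t)"
    by (rule has_derivative_in_compose[OF line])
       (rule has_derivative_subset[OF der]; use x d in auto)
  then show ?thesis by (simp add: has_field_derivative_def mult_commute_abs)
qed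

lemma grad_eqI:
  assumes x: "x \<in> Rn n" and D: "D \<in> Rn n"
    and der: "(f has_derivative (\<lambda>d. D \<bullet> d)) (at x within Rn n)"
  shows "grad n f x = D"
  unfolding grad_def
proof (rule the_equality)
  fix E assume E: "E \<in> Rn n \<and> (f has_derivative (\<lambda>d. E \<bullet> d)) (at x within Rn n)"
  have "E \<bullet> (E - D) = D \<bullet> (E - D)"
    by (rule DERIV_unique[of "\<lambda>s. f (x + s *\<^sub>R (E - D))" _ 0])
       (rule has_derivative_along_line[where n=n]; use E D x der in simp)+
  then have "(E - D) \<bullet> (E - D) = 0" by (simp add: inner_diff_left)
  then show "E = D" by simp
qed (use D der in simp)

text \<open>
  A derivative may act arbitrarily outside \<open>Rn n\<close>; on \<open>Rn n\<close> it is determined by its values on the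
  first \<open>n\<close> basis vectors, which are the coordinates of the gradient.
\<close>

lemma has_derivative_grad:
  assumes x: "x \<in> Rn n" and f: "f differentiable (at x within Rn n)"
  shows "grad n f x \<in> Rn n"
    and "(f has_derivative (\<lambda>d. grad n f x \<bullet> d)) (at x within Rn n)"
proof -
  obtain f' where f': "(f has_derivative f') (at x within Rn n)"
    using f by (auto simp: differentiable_def)
  then have lin: "linear f'" using has_derivative_linear by blast
  define D where "D = (\<Sum>i<n. f' (basis_rvec i) *\<^sub>R basis_rvec i)"
  have D: "D \<in> Rn n" by (auto simp: D_def Rn_def)
  have eq: "f' d = D \<bullet> d" if "d \<in> Rn n" for d
  proof -
    have "f' d = f' (\<Sum>i<n. coord d i *\<^sub>R basis_rvec i)" using Rn_expansion[OF that] by simp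
    also have "\<dots> = (\<Sum>i<n. coord d i * f' (basis_rvec i))"
      using lin by (simp add: linear_sum linear_scale)
    finally show ?thesis
      by (simp add: D_def inner_sum_left inner_commute[of "basis_rvec _"] mult.commute)
  qed
  have "((\<lambda>y. (f y - f x - D \<bullet> (y - x)) /\<^sub>R norm (y - x)) \<longlongrightarrow> 0) (at x within Rn n)"
  proof (rule Lim_transform_eventually)
    show "((\<lambda>y. (f y - f x - f' (y - x)) /\<^sub>R norm (y - x)) \<longlongrightarrow> 0) (at x within Rn n)"
      using f' by (simp add: has_derivative_within divide_inverse_commute diff_diff_eq)
    show "\<forall>\<^sub>F y in at x within Rn n. (f y - f x - f' (y - x)) /\<^sub>R norm (y - x)
        = (f y - f x - D \<bullet> (y - x)) /\<^sub>R norm (y - x)"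
      unfolding eventually_at_filter using x by (intro always_eventually) (auto simp: eq)
  qed
  then have der: "(f has_derivative (\<lambda>d. D \<bullet> d)) (at x within Rn n)"
    by (simp add: has_derivative_within divide_inverse_commute diff_diff_eq bounded_linear_inner_right)
  have "grad n f x = D" by (rule grad_eqI[OF x D der])
  then show "grad n f x \<in> Rn n"
    and "(f has_derivative (\<lambda>d. grad n f x \<bullet> d)) (at x within Rn n)" using D der by auto
qed

text \<open>
  Along the segment from \<open>z\<close> to \<open>u\<close> the difference of the two sides has a derivative of constant
  sign. It exists as a two-sided derivative also at the endpoints, which may lie on the boundary of
  \<open>D\<close>, because \<open>f\<close> is differentiable relative to all of \<open>Rn n\<close>.
\<close>

lemma descent_lemma:
  assumes D: "convex D" "D \<subseteq> Rn n" and diff: "\<And>x. x \<in> D \<Longrightarrow> f differentiable (at x within Rn n)"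
    and lip: "\<And>x y. x \<in> D \<Longrightarrow> y \<in> D \<Longrightarrow> norm (grad n f x - grad n f y) \<le> L * norm (x - y)"
    and z: "z \<in> D" and u: "u \<in> D"
  shows "f u \<le> linearization n f z u + L / 2 * (norm (u - z))\<^sup>2"
proof -
  define d where "d = u - z"
  have d: "d \<in> Rn n" and zR: "z \<in> Rn n" using z u D by (auto simp: d_def intro!: diff_in_Rn)
  have seg: "z + t *\<^sub>R d \<in> D" if "0 \<le> t" "t \<le> 1" for t
    using convexD_alt[OF D(1) z u, of t] that by (simp add: d_def algebra_simps)
  define G where "G t = f (z + t *\<^sub>R d) - t * (grad n f z \<bullet> d) - L / 2 * t\<^sup>2 * (norm d)\<^sup>2" for t
  have "G 1 \<le> G 0"
  proof (rule DERIV_nonpos_imp_nonincreasing[where f=G and a=0 and b=1])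
    fix t :: real assume t: "0 \<le> t" "t \<le> 1"
    have xt: "z + t *\<^sub>R d \<in> D" using seg t by blast
    have "((\<lambda>s. f (z + s *\<^sub>R d)) has_real_derivative grad n f (z + t *\<^sub>R d) \<bullet> d) (at t)"
      by (rule has_derivative_along_line[OF _ zR d])
         (use xt D diff has_derivative_grad in blast)
    then have "(G has_real_derivative
        grad n f (z + t *\<^sub>R d) \<bullet> d - grad n f z \<bullet> d - L * t * (norm d)\<^sup>2) (at t)"
      unfolding G_def by (auto intro!: derivative_eq_intros simp: power2_eq_square)
    moreover have "grad n f (z + t *\<^sub>R d) \<bullet> d - grad n f z \<bullet> d - L * t * (norm d)\<^sup>2 \<le> 0"
    proof -
      have "(grad n f (z + t *\<^sub>R d) - grad n f z) \<bullet> d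
          \<le> norm (grad n f (z + t *\<^sub>R d) - grad n f z) * norm d"
        by (rule norm_cauchy_schwarz)
      also have "\<dots> \<le> (L * norm (t *\<^sub>R d)) * norm d"
        using lip[OF xt z] by (intro mult_right_mono) auto
      finally show ?thesis using t by (simp add: inner_diff_left power2_eq_square mult_ac)
    qed
    ultimately show "\<exists>y. (G has_real_derivative y) (at t) \<and> y \<le> 0" by blast
  qed simp
  then show ?thesis by (simp add: G_def linearization_def d_def)
qed

section \<open>Strongly convex functions and their minimizers\<close>

text \<open>The modulus \<open>\<kappa> = 0\<close> is ordinary convexity.\<close>

definition strongly_convex_on :: "'a::real_inner set \<Rightarrow> real \<Rightarrow> ('a \<Rightarrow> real) \<Rightarrow> bool"
  where "strongly_convex_on D \<kappa> Q \<longleftrightarrow> convex D \<and>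
    (\<forall>x\<in>D. \<forall>y\<in>D. \<forall>t. 0 < t \<and> t < 1 \<longrightarrow>
      Q ((1 - t) *\<^sub>R x + t *\<^sub>R y)
        \<le> (1 - t) * Q x + t * Q y - \<kappa> / 2 * t * (1 - t) * (norm (x - y))\<^sup>2)"

lemma strongly_convex_onD:
  assumes "strongly_convex_on D \<kappa> Q" "x \<in> D" "y \<in> D" "0 < t" "t < 1"
  shows "(1 - t) *\<^sub>R x + t *\<^sub>R y \<in> D"
    and "Q ((1 - t) *\<^sub>R x + t *\<^sub>R y)
        \<le> (1 - t) * Q x + t * Q y - \<kappa> / 2 * t * (1 - t) * (norm (x - y))\<^sup>2"
  using assms convexD_alt[of D x y t] by (auto simp: strongly_convex_on_def)

lemma strongly_convex_on_add:
  assumes "strongly_convex_on D \<kappa> P" "strongly_convex_on D \<mu> Q"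
  shows "strongly_convex_on D (\<kappa> + \<mu>) (\<lambda>x. P x + Q x)"
  unfolding strongly_convex_on_def
proof (intro conjI ballI allI impI)
  show "convex D" using assms by (simp add: strongly_convex_on_def)
  fix x y and t :: real assume *: "x \<in> D" "y \<in> D" "0 < t \<and> t < 1"
  show "P ((1 - t) *\<^sub>R x + t *\<^sub>R y) + Q ((1 - t) *\<^sub>R x + t *\<^sub>R y)
      \<le> (1 - t) * (P x + Q x) + t * (P y + Q y) - (\<kappa> + \<mu>) / 2 * t * (1 - t) * (norm (x - y))\<^sup>2"
    using strongly_convex_onD(2)[OF assms(1) *(1,2), of t]
      strongly_convex_onD(2)[OF assms(2) *(1,2), of t] *(3)
    by (simp add: distrib_left distrib_right add_divide_distrib)
qed

lemma strongly_convex_on_scale: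
  assumes "strongly_convex_on D \<kappa> P" "a \<ge> 0"
  shows "strongly_convex_on D (a * \<kappa>) (\<lambda>x. a * P x)"
  unfolding strongly_convex_on_def
proof (intro conjI ballI allI impI)
  show "convex D" using assms by (simp add: strongly_convex_on_def)
  fix x y and t :: real assume *: "x \<in> D" "y \<in> D" "0 < t \<and> t < 1"
  show "a * P ((1 - t) *\<^sub>R x + t *\<^sub>R y)
      \<le> (1 - t) * (a * P x) + t * (a * P y) - a * \<kappa> / 2 * t * (1 - t) * (norm (x - y))\<^sup>2"
    using mult_left_mono[OF strongly_convex_onD(2)[OF assms(1) *(1,2), of t] assms(2)] *(3)
    by (simp add: algebra_simps)
qed

lemma strongly_convex_on_affine:
  "convex D \<Longrightarrow> strongly_convex_on D 0 (\<lambda>x. \<alpha> + v \<bullet> x)"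
  by (simp add: strongly_convex_on_def algebra_simps)

lemma norm_sq_convex_combination:
  fixes x y z :: "'a::real_inner"
  shows "(norm ((1 - t) *\<^sub>R x + t *\<^sub>R y - z))\<^sup>2
    = (1 - t) * (norm (x - z))\<^sup>2 + t * (norm (y - z))\<^sup>2 - t * (1 - t) * (norm (x - y))\<^sup>2"
  by (simp add: power2_norm_eq_inner algebra_simps inner_commute)

lemma strongly_convex_on_quadratic:
  "convex D \<Longrightarrow> strongly_convex_on D K (\<lambda>x. K / 2 * (norm (x - z))\<^sup>2)"
  unfolding strongly_convex_on_def norm_sq_convex_combination
  by (simp add: field_simps)

text \<open>
  At a minimizer the strong convexity inequality along a short segment leaves no room for
  \<open>Q\<close> to grow more slowly than quadratically.
\<close>

lemma strongly_convex_min_growth: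
  assumes Q: "strongly_convex_on D \<kappa> Q" and y: "y \<in> D" and min: "\<And>u. u \<in> D \<Longrightarrow> Q y \<le> Q u"
    and u: "u \<in> D"
  shows "Q y + \<kappa> / 2 * (norm (u - y))\<^sup>2 \<le> Q u"
proof -
  have *: "(1 - t) * (\<kappa> / 2 * (norm (u - y))\<^sup>2) \<le> Q u - Q y" if t: "0 < t" "t < 1" for t
  proof -
    have "Q y \<le> (1 - t) * Q y + t * Q u - \<kappa> / 2 * t * (1 - t) * (norm (y - u))\<^sup>2"
      using min[OF strongly_convex_onD(1)[OF Q y u t]] strongly_convex_onD(2)[OF Q y u t] by linarith
    then have "t * ((1 - t) * (\<kappa> / 2 * (norm (u - y))\<^sup>2)) \<le> t * (Q u - Q y)"
      by (simp add: algebra_simps norm_minus_commute)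
    then show ?thesis using t by (simp add: mult_le_cancel_left)
  qed
  have "((\<lambda>t. (1 - t) * (\<kappa> / 2 * (norm (u - y))\<^sup>2)) \<longlongrightarrow> (1 - 0) * (\<kappa> / 2 * (norm (u - y))\<^sup>2)) (at_right 0)"
    by (intro tendsto_intros)
  moreover have "\<forall>\<^sub>F t in at_right (0::real). (1 - t) * (\<kappa> / 2 * (norm (u - y))\<^sup>2) \<le> Q u - Q y"
    by (rule eventually_at_rightI[where b=1]) (use * in auto)
  ultimately have "(1 - 0) * (\<kappa> / 2 * (norm (u - y))\<^sup>2) \<le> Q u - Q y"
    by (rule tendsto_upperbound) simp
  then show ?thesis by simp
qed

text \<open>
  Completing the square turns the minimality of a proximal point into a subgradient
  inequality which keeps the strong convexity of the function itself.
\<close>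

lemma prox_point_subgradient:
  assumes P: "strongly_convex_on D \<mu> P" and y: "y \<in> D"
    and min: "\<And>u. u \<in> D \<Longrightarrow> P y + K / 2 * (norm (y - z))\<^sup>2 \<le> P u + K / 2 * (norm (u - z))\<^sup>2"
    and u: "u \<in> D"
  shows "P y + K * ((z - y) \<bullet> (u - y)) + \<mu> / 2 * (norm (u - y))\<^sup>2 \<le> P u"
proof -
  have "convex D" using P by (simp add: strongly_convex_on_def)
  from strongly_convex_min_growth[OF strongly_convex_on_add[OF P strongly_convex_on_quadratic[OF this]] y min u]
  have "P y + K / 2 * (norm (y - z))\<^sup>2 + (\<mu> + K) / 2 * (norm (u - y))\<^sup>2
      \<le> P u + K / 2 * (norm (u - z))\<^sup>2" by simp
  moreover have "(norm (u - z))\<^sup>2 = (norm (u - y))\<^sup>2 + (norm (y - z))\<^sup>2 - 2 * ((z - y) \<bullet> (u - y))"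
    by (simp add: power2_norm_eq_inner algebra_simps inner_commute)
  ultimately show ?thesis by (simp add: algebra_simps add_divide_distrib)
qed

text \<open>
  \<open>D\<close> is the effective domain of \<open>F\<close>: everything that follows is about the real function \<open>Q\<close> on \<open>D\<close>.
\<close>

lemma argmin_Rn_attained:
  assumes DR: "D \<subseteq> Rn n"
    and fin: "\<And>u. u \<in> D \<Longrightarrow> F u = ereal (Q u)" and inf: "\<And>u. u \<in> Rn n \<Longrightarrow> u \<notin> D \<Longrightarrow> F u = \<infinity>"
    and y: "y \<in> D" "\<And>u. u \<in> D \<Longrightarrow> Q y \<le> Q u"
  shows "argmin_Rn n F \<in> D" and "u \<in> D \<Longrightarrow> Q (argmin_Rn n F) \<le> Q u"
proof -
  have "is_arg_min F (\<lambda>u. u \<in> Rn n) y"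
    unfolding is_arg_min_def using y DR fin inf by (metis ereal_less_eq(1) ereal_less_eq(3) not_le subsetD)
  then have "is_arg_min F (\<lambda>u. u \<in> Rn n) (argmin_Rn n F)"
    unfolding argmin_Rn_def arg_min_def by (rule someI)
  then have *: "argmin_Rn n F \<in> Rn n" "\<And>u. u \<in> Rn n \<Longrightarrow> F (argmin_Rn n F) \<le> F u"
    by (auto simp: is_arg_min_def not_less)
  show D: "argmin_Rn n F \<in> D"
  proof (rule ccontr)
    assume "argmin_Rn n F \<notin> D"
    then show False using inf[OF *(1)] *(2)[OF subsetD[OF DR y(1)]] fin[OF y(1)] by simp
  qed
  show "Q (argmin_Rn n F) \<le> Q u" if "u \<in> D"
    using *(2)[of u] that DR fin D by auto
qed

section \<open>Closed convex functions\<close>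

locale closed_convex =
  fixes n :: nat and h :: "rvec \<Rightarrow> ereal"
  assumes proper: "proper_on n h" and lsc: "lsc_on n h" and cvx: "econvex_on n h"
begin

abbreviation D :: "rvec set" where "D \<equiv> edom n h"

definition H :: "rvec \<Rightarrow> real" where "H u = real_of_ereal (h u)"

lemma D_subset: "D \<subseteq> Rn n"
  by (auto simp: edom_def)

lemma D_Rn: "u \<in> D \<Longrightarrow> u \<in> Rn n"
  by (auto simp: edom_def)

lemma h_eq_H: "u \<in> D \<Longrightarrow> h u = ereal (H u)"
  using proper by (cases "h u") (auto simp: H_def edom_def proper_on_def)

lemma h_outside: "u \<in> Rn n \<Longrightarrow> u \<notin> D \<Longrightarrow> h u = \<infinity>"
  by (simp add: edom_def)

declare D_Rn [simp]

lemma H_convex: "strongly_convex_on D 0 H"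
proof -
  have *: "(1 - t) *\<^sub>R x + t *\<^sub>R y \<in> D \<and> H ((1 - t) *\<^sub>R x + t *\<^sub>R y) \<le> (1 - t) * H x + t * H y"
    if "x \<in> D" "y \<in> D" "0 < t" "t < 1" for x y and t :: real
  proof -
    let ?w = "(1 - t) *\<^sub>R x + t *\<^sub>R y"
    have "h ?w \<le> ereal (1 - t) * h x + ereal t * h y"
      using cvx that by (simp add: econvex_on_def)
    then have le: "h ?w \<le> ereal ((1 - t) * H x + t * H y)"
      using that by (simp add: h_eq_H)
    moreover have w: "?w \<in> D"
    proof -
      have "h ?w < \<infinity>" using le by (rule order.strict_trans1) simp
      moreover have "?w \<in> Rn n" using that by simp
      ultimately show ?thesis by (simp add: edom_def del: D_Rn)
    qed
    ultimately show ?thesis using h_eq_H[OF w] by auto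
  qed
  have "convex D"
    unfolding convex_alt
  proof (intro ballI allI impI)
    fix x y and t :: real assume "x \<in> D" "y \<in> D" "0 \<le> t \<and> t \<le> 1"
    then show "(1 - t) *\<^sub>R x + t *\<^sub>R y \<in> D"
      using *[of x y t] by (cases "t = 0 \<or> t = 1") auto
  qed
  then show ?thesis using * by (simp add: strongly_convex_on_def)
qed

lemma convex_D: "convex D"
  using H_convex by (simp add: strongly_convex_on_def)

text \<open>
  Lower semicontinuity bounds \<open>H\<close> from below on a small ball about \<open>z\<close>, and convexity
  propagates that bound outwards along rays, where it can only decay linearly.
\<close>

lemma H_lower_bound:
  assumes z: "z \<in> D"
  obtains r where "r > 0" "\<And>u. u \<in> D \<Longrightarrow> H z - 1 - norm (u - z) / r \<le> H u"
proof -
  have "\<forall>\<^sub>F u in at z within Rn n. ereal (H z - 1) < h u"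
  proof -
    have "h z \<le> Liminf (at z within Rn n) h" using lsc z by (simp add: lsc_on_def)
    moreover have "ereal (H z - 1) < h z" by (simp add: h_eq_H[OF z])
    ultimately show ?thesis unfolding le_Liminf_iff by blast
  qed
  then obtain e where e: "e > 0"
    "\<And>u. u \<in> Rn n \<Longrightarrow> u \<noteq> z \<Longrightarrow> dist u z < e \<Longrightarrow> ereal (H z - 1) < h u"
    by (auto simp: eventually_at)
  define r where "r = e / 2"
  have r: "r > 0" "r < e" using e by (auto simp: r_def)
  have near: "H z - 1 \<le> H u" if "u \<in> D" "norm (u - z) \<le> r" for u
    using e(2)[of u] that r h_eq_H[of u] by (cases "u = z") (auto simp: dist_norm)
  show thesis
  proof (rule that[OF r(1)])
    fix u assume u: "u \<in> D"
    show "H z - 1 - norm (u - z) / r \<le> H u"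
    proof (cases "norm (u - z) \<le> r")
      case True
      have "0 \<le> norm (u - z) / r" using r by simp
      then show ?thesis using near[OF u True] by linarith
    next
      case False
      define t where "t = r / norm (u - z)"
      have "r < norm (u - z)" using False by simp
      moreover from this have "0 < norm (u - z)" using r(1) by linarith
      ultimately have t: "0 < t" "t < 1" using r(1) by (simp_all add: t_def divide_less_eq)
      let ?w = "(1 - t) *\<^sub>R z + t *\<^sub>R u"
      have "?w - z = t *\<^sub>R (u - z)" by (simp add: algebra_simps)
      then have "norm (?w - z) = r" using t r(1) by (auto simp: t_def)
      then have "H z - 1 \<le> H ?w"
        using near[of ?w] strongly_convex_onD(1)[OF H_convex z u t] by simp
      also have "\<dots> \<le> (1 - t) * H z + t * H u"
        using strongly_convex_onD(2)[OF H_convex z u t] by simp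
      finally have "t * (H z - 1 / t) \<le> t * H u" using t by (simp add: algebra_simps)
      then have "H z - 1 / t \<le> H u" using t by (simp add: mult_le_cancel_left)
      then show ?thesis using t by (simp add: t_def)
    qed
  qed
qed

text \<open>
  Lower semicontinuity in the form needed for minimizing sequences: a finite limit of values keeps
  the limit point in the domain.
\<close>

lemma H_closed:
  assumes xD: "\<And>k::nat. x k \<in> D" and lim: "x \<longlonglongrightarrow> y" and y: "y \<in> Rn n"
    and Hlim: "(\<lambda>k. H (x k)) \<longlonglongrightarrow> \<beta>"
  shows "y \<in> D" and "H y \<le> \<beta>"
proof -
  have "h y \<le> ereal \<beta>"
  proof (rule ccontr)
    assume "\<not> h y \<le> ereal \<beta>"
    then obtain c where c: "\<beta> < c" "ereal c < h y"
      using ereal_dense2[of "ereal \<beta>" "h y"] unfolding not_le by auto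
    have "\<forall>\<^sub>F u in at y within Rn n. ereal c < h u"
    proof -
      have "h y \<le> Liminf (at y within Rn n) h" using lsc y by (simp add: lsc_on_def)
      then show ?thesis using c(2) unfolding le_Liminf_iff by blast
    qed
    then obtain e where e: "e > 0"
      "\<And>u. u \<in> Rn n \<Longrightarrow> u \<noteq> y \<Longrightarrow> dist u y < e \<Longrightarrow> ereal c < h u"
      by (auto simp: eventually_at)
    have "\<forall>\<^sub>F k in sequentially. dist (x k) y < e" using tendstoD[OF lim e(1)] .
    then have "\<forall>\<^sub>F k in sequentially. c \<le> H (x k)"
    proof eventually_elim
      case (elim k)
      have "ereal c < h (x k)" using e(2)[of "x k"] c elim xD by (cases "x k = y") auto
      then show ?case using h_eq_H[OF xD] by simp
    qed
    then have "c \<le> \<beta>" using tendsto_lowerbound[OF Hlim] by simp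
    with c show False by simp
  qed
  then have "h y < \<infinity>" by (rule order.strict_trans1) simp
  then show "y \<in> D" using y by (simp add: edom_def del: D_Rn)
  then show "H y \<le> \<beta>" using \<open>h y \<le> ereal \<beta>\<close> h_eq_H by simp
qed

text \<open>
  Strong convexity at midpoints makes every minimizing sequence a Cauchy sequence, and \<open>Rn n\<close> is
  complete.
\<close>

lemma prox_point_exists:
  assumes a: "a > 0" and K: "K > 0"
  obtains y where "y \<in> D"
    "\<And>u. u \<in> D \<Longrightarrow> a * H y + v \<bullet> y + K / 2 * (norm (y - z))\<^sup>2
        \<le> a * H u + v \<bullet> u + K / 2 * (norm (u - z))\<^sup>2"
proof -
  define q where "q u = v \<bullet> u + K / 2 * (norm (u - z))\<^sup>2" for u
  define Q where "Q u = a * H u + q u" for u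
  have "strongly_convex_on D (a * 0 + (0 + K)) Q"
    unfolding Q_def q_def
    using strongly_convex_on_add[OF strongly_convex_on_scale[OF H_convex, of a]
        strongly_convex_on_add[OF strongly_convex_on_affine[OF convex_D, of 0 v]
          strongly_convex_on_quadratic[OF convex_D, of K z]]] a by simp
  then have Qc: "strongly_convex_on D K Q" by simp
  obtain w where w: "w \<in> D" using proper by (auto simp: proper_on_def)
  obtain r where r: "r > 0" "\<And>u. u \<in> D \<Longrightarrow> H w - 1 - norm (u - w) / r \<le> H u"
    using H_lower_bound[OF w] by blast
  \<comment> \<open>In terms of \<open>s = norm (u - z)\<close> the function is bounded below by a quadratic polynomial
    in \<open>s\<close> with linear coefficient \<open>- B\<close>.\<close>
  define B where "B = a / r + norm v"
  have Qlow: "a * (H w - 1) - a * norm (z - w) / r + v \<bullet> z - B\<^sup>2 / (2 * K) \<le> Q u" if u: "u \<in> D" for u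
  proof -
    define s where "s = norm (u - z)"
    have "norm (u - w) \<le> s + norm (z - w)"
      unfolding s_def using norm_triangle_ineq[of "u - z" "z - w"] by simp
    then have "a * (norm (u - w) / r) \<le> a * ((s + norm (z - w)) / r)"
      using a r(1) by (intro mult_left_mono divide_right_mono) auto
    moreover have "a * (H w - 1 - norm (u - w) / r) \<le> a * H u"
      using r(2)[OF u] a by simp
    moreover have "v \<bullet> u \<ge> v \<bullet> z - norm v * s"
      using norm_cauchy_schwarz[of v "z - u"] by (simp add: s_def inner_diff_right norm_minus_commute)
    moreover have "K / 2 * s\<^sup>2 - B * s \<ge> - (B\<^sup>2 / (2 * K))"
    proof -
      have "0 \<le> (K * s - B)\<^sup>2 / (2 * K)" using K by simp
      also have "\<dots> = K / 2 * s\<^sup>2 - B * s + B\<^sup>2 / (2 * K)"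
        using K by (simp add: power2_eq_square field_simps)
      finally show ?thesis by simp
    qed
    moreover have "B * s = a * s / r + norm v * s" by (simp add: B_def algebra_simps)
    ultimately show ?thesis
      unfolding Q_def q_def s_def[symmetric] by (simp add: algebra_simps add_divide_distrib)
  qed
  define \<beta> where "\<beta> = (INF u\<in>D. Q u)"
  have bdd: "bdd_below (Q ` D)" using Qlow by (auto intro!: bdd_belowI2)
  have \<beta>: "\<beta> \<le> Q u" if "u \<in> D" for u
    unfolding \<beta>_def using bdd that by (rule cINF_lower)
  have "\<exists>u\<in>D. Q u < \<beta> + 1 / real (Suc k)" for k
  proof -
    have "(INF u\<in>D. Q u) < \<beta> + 1 / real (Suc k)" by (simp add: \<beta>_def)
    then show ?thesis using cINF_less_iff[OF _ bdd] w by blast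
  qed
  then obtain x where xD: "\<And>k. x k \<in> D" and xQ: "\<And>k. Q (x k) < \<beta> + 1 / real (Suc k)"
    by metis
  have mid: "K / 8 * (norm (x i - x j))\<^sup>2 \<le> 1 / real (Suc N)" if "i \<ge> N" "j \<ge> N" for i j N
  proof -
    have inv: "1 / real (Suc i) \<le> 1 / real (Suc N)" "1 / real (Suc j) \<le> 1 / real (Suc N)"
      using that by (auto intro!: divide_left_mono)
    let ?m = "(1 - 1/2) *\<^sub>R x i + (1/2) *\<^sub>R x j"
    have "\<beta> \<le> Q ?m" by (rule \<beta>[OF strongly_convex_onD(1)[OF Qc xD xD]]) auto
    also have "\<dots> \<le> (1 - 1/2) * Q (x i) + 1/2 * Q (x j) - K / 2 * (1/2) * (1 - 1/2) * (norm (x i - x j))\<^sup>2"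
      by (rule strongly_convex_onD(2)[OF Qc xD xD]) auto
    also have "\<dots> = Q (x i) / 2 + Q (x j) / 2 - K / 8 * (norm (x i - x j))\<^sup>2" by simp
    finally show ?thesis using xQ[of i] xQ[of j] inv by linarith
  qed
  have "Cauchy x"
  proof (rule CauchyI)
    fix e :: real assume e: "e > 0"
    obtain N where N: "1 / real (Suc N) < K / 8 * e\<^sup>2"
      using reals_Archimedean[of "K / 8 * e\<^sup>2"] K e by (auto simp: inverse_eq_divide)
    have "norm (x i - x j) < e" if "i \<ge> N" "j \<ge> N" for i j
    proof -
      have "K / 8 * (norm (x i - x j))\<^sup>2 < K / 8 * e\<^sup>2" using mid[OF that] N by linarith
      then have "(norm (x i - x j))\<^sup>2 < e\<^sup>2" using K by simp
      then show ?thesis using e by (simp add: power2_less_imp_less)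
    qed
    then show "\<exists>M. \<forall>m\<ge>M. \<forall>n\<ge>M. norm (x m - x n) < e" by blast
  qed
  moreover have "\<forall>k. x k \<in> Rn n" using xD by simp
  ultimately obtain y where y: "y \<in> Rn n" "x \<longlonglongrightarrow> y"
    using complete_Rn[of n] unfolding complete_def by blast
  have "(\<lambda>k. \<beta> + 1 / real (Suc k)) \<longlonglongrightarrow> \<beta>"
    using tendsto_add[OF tendsto_const[of \<beta>] LIMSEQ_inverse_real_of_nat] by (simp add: inverse_eq_divide)
  then have "(\<lambda>k. Q (x k)) \<longlonglongrightarrow> \<beta>"
    by (rule tendsto_sandwich[OF _ _ tendsto_const, rotated 2])
       (intro always_eventually allI \<beta>[OF xD] less_imp_le[OF xQ])+
  moreover have "(\<lambda>k. q (x k)) \<longlonglongrightarrow> q y"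
    unfolding q_def by (intro tendsto_intros y)
  ultimately have "(\<lambda>k. (Q (x k) - q (x k)) / a) \<longlonglongrightarrow> (\<beta> - q y) / a"
    using a by (intro tendsto_intros) auto
  then have "(\<lambda>k. H (x k)) \<longlonglongrightarrow> (\<beta> - q y) / a" using a by (simp add: Q_def)
  from H_closed[OF xD y(2,1) this] have "y \<in> D" "Q y \<le> \<beta>"
    using a by (auto simp: Q_def field_simps)
  then show thesis
    using order_trans[OF \<open>Q y \<le> \<beta>\<close> \<beta>] by (intro that[of y]) (auto simp: Q_def q_def add.assoc)
qed

end

section \<open>The accelerated gradient method\<close>

text \<open>
  \<open>D\<close> is the effective domain of \<open>\<psi>n\<close> and \<open>P\<close> its finite part. For the solvability of the
  subproblems only objectives of the form \<open>prox_exists\<close> matter, as \<open>\<Gamma>\<close> is affine.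
\<close>

locale acg =
  fixes n :: nat and \<mu> L :: real and \<psi>s :: "rvec \<Rightarrow> real" and \<psi>n :: "rvec \<Rightarrow> ereal"
    and x0 :: rvec and D :: "rvec set" and P :: "rvec \<Rightarrow> real"
  assumes D_Rn: "D \<subseteq> Rn n" and x0: "x0 \<in> D"
    and \<psi>n_finite: "\<And>u. u \<in> D \<Longrightarrow> \<psi>n u = ereal (P u)"
    and \<psi>n_infinite: "\<And>u. u \<in> Rn n \<Longrightarrow> u \<notin> D \<Longrightarrow> \<psi>n u = \<infinity>"
    and P_convex: "strongly_convex_on D \<mu> P"
    and prox_exists: "\<And>v K. 0 < K \<Longrightarrow> \<exists>y\<in>D. \<forall>u\<in>D.
      P y + v \<bullet> y + K / 2 * (norm (y - x0))\<^sup>2 \<le> P u + v \<bullet> u + K / 2 * (norm (u - x0))\<^sup>2"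
    and \<mu>: "0 \<le> \<mu>" and L: "0 < L"
    and lower: "\<And>u x. u \<in> D \<Longrightarrow> x \<in> D \<Longrightarrow> linearization n \<psi>s x u \<le> \<psi>s u"
    and upper: "\<And>u x. u \<in> D \<Longrightarrow> x \<in> D \<Longrightarrow>
      \<psi>s u \<le> linearization n \<psi>s x u + L / 2 * (norm (u - x))\<^sup>2"
begin

text \<open>
  The invariant behind the method: \<open>A * (\<Gamma> + P) + \<parallel>\<cdot> - x0\<parallel>\<^sup>2 / 2\<close> is minimized at \<open>y\<close>, and
  its minimum is at least \<open>A * (\<psi>s + P) x\<close>.
\<close>

definition acg_inv :: "acg_state \<Rightarrow> bool"
  where "acg_inv s \<longleftrightarrow> 0 \<le> acg_A s \<and> acg_x s \<in> D \<and> acg_y s \<in> D \<and>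
    (\<exists>\<alpha> v. acg_Gamma s = (\<lambda>u. \<alpha> + v \<bullet> u)) \<and>
    (\<forall>u\<in>D. acg_A s * acg_Gamma s u \<le> acg_A s * \<psi>s u) \<and>
    (\<forall>u\<in>D. acg_A s * (acg_Gamma s (acg_y s) + P (acg_y s)) + (norm (acg_y s - x0))\<^sup>2 / 2
        + (\<mu> * acg_A s + 1) / 2 * (norm (u - acg_y s))\<^sup>2
      \<le> acg_A s * (acg_Gamma s u + P u) + (norm (u - x0))\<^sup>2 / 2) \<and>
    acg_A s * (\<psi>s (acg_x s) + P (acg_x s))
      \<le> acg_A s * (acg_Gamma s (acg_y s) + P (acg_y s)) + (norm (acg_y s - x0))\<^sup>2 / 2"

definition next_A :: "real \<Rightarrow> real"
  where "next_A a = a + (\<mu> * a + 1 + sqrt ((\<mu> * a + 1)\<^sup>2 + 4 * L * (\<mu> * a + 1) * a)) / (2 * L)"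

lemma next_A_quadratic:
  assumes "0 \<le> a"
  shows "a < next_A a" and "L * (next_A a - a)\<^sup>2 = (\<mu> * a + 1) * next_A a"
proof -
  define q where "q = \<mu> * a + 1"
  define s where "s = sqrt (q\<^sup>2 + 4 * L * q * a)"
  have q: "q > 0" using assms \<mu> by (simp add: q_def add_nonneg_pos)
  have "0 \<le> q\<^sup>2 + 4 * L * q * a" using q L assms by simp
  then have s: "s \<ge> 0" "s\<^sup>2 = q\<^sup>2 + 4 * L * q * a" by (simp_all add: s_def)
  have A: "next_A a = a + (q + s) / (2 * L)" by (simp add: next_A_def q_def s_def)
  show "a < next_A a" unfolding A using q s L by (simp add: add_pos_nonneg)
  have "L * (next_A a - a)\<^sup>2 = (q + s)\<^sup>2 / (4 * L)" unfolding A using L by (simp add: power2_eq_square field_simps)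
  also have "(q + s)\<^sup>2 = q * (4 * L) * (a + (q + s) / (2 * L))"
    using s(2) L by (simp add: power2_eq_square field_simps)
  finally show "L * (next_A a - a)\<^sup>2 = (\<mu> * a + 1) * next_A a"
    unfolding A q_def[symmetric] using L by simp
qed

text \<open>
  The size of \<open>next_A\<close> is what balances the proximal term against the quadratic upper bound
  on \<open>\<psi>s\<close> at the new point \<open>x'\<close>.
\<close>

lemma acg_step_inv:
  assumes inv: "acg_inv s"
  shows "acg_inv (acg_step n \<mu> L \<psi>s \<psi>n x0 s)"
    and "acg_A (acg_step n \<mu> L \<psi>s \<psi>n x0 s) = next_A (acg_A s)"
proof -
  define a a' x y \<Gamma> where "a = acg_A s" and "a' = next_A a" and "x = acg_x s" and "y = acg_y s"
    and "\<Gamma> = acg_Gamma s"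
  have a: "0 \<le> a" and x: "x \<in> D" and y: "y \<in> D" using inv by (simp_all add: acg_inv_def a_def x_def y_def)
  obtain \<alpha> v where \<Gamma>: "\<Gamma> = (\<lambda>u. \<alpha> + v \<bullet> u)" using inv by (auto simp: acg_inv_def \<Gamma>_def)
  have \<Gamma>_le: "\<And>u. u \<in> D \<Longrightarrow> a * \<Gamma> u \<le> a * \<psi>s u"
    and min: "\<And>u. u \<in> D \<Longrightarrow> a * (\<Gamma> y + P y) + (norm (y - x0))\<^sup>2 / 2 + (\<mu> * a + 1) / 2 * (norm (u - y))\<^sup>2
      \<le> a * (\<Gamma> u + P u) + (norm (u - x0))\<^sup>2 / 2"
    and val: "a * (\<psi>s x + P x) \<le> a * (\<Gamma> y + P y) + (norm (y - x0))\<^sup>2 / 2"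
    using inv by (simp_all add: acg_inv_def a_def x_def y_def \<Gamma>_def)
  have a': "a < a'" and quad: "L * (a' - a)\<^sup>2 = (\<mu> * a + 1) * a'"
    using next_A_quadratic[OF a] by (simp_all add: a'_def)
  have a'0: "0 < a'" using a a' by simp
  define t where "t = (a' - a) / a'"
  have t: "0 < t" "t \<le> 1" "1 - t = a / a'" "a' * t = a' - a" "a' * (1 - t) = a"
    using a a' a'0 by (simp_all add: t_def field_simps)
  define xt where "xt = (1 - t) *\<^sub>R x + t *\<^sub>R y"
  have conv: "(1 - t) *\<^sub>R p + t *\<^sub>R q \<in> D" if "p \<in> D" "q \<in> D" for p q
    using P_convex that t(1,2) convexD_alt[of D p q t] by (simp add: strongly_convex_on_def)
  have xt: "xt \<in> D" unfolding xt_def by (rule conv[OF x y])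
  define \<Gamma>' where "\<Gamma>' u = (1 - t) * \<Gamma> u + t * linearization n \<psi>s xt u" for u
  define v' where "v' = (1 - t) *\<^sub>R v + t *\<^sub>R grad n \<psi>s xt"
  define \<alpha>' where "\<alpha>' = (1 - t) * \<alpha> + t * (\<psi>s xt - grad n \<psi>s xt \<bullet> xt)"
  have \<Gamma>': "\<Gamma>' = (\<lambda>u. \<alpha>' + v' \<bullet> u)"
    by (rule ext) (simp add: \<Gamma>'_def \<Gamma> \<alpha>'_def v'_def linearization_def algebra_simps)
  define y' where "y' = argmin_Rn n (\<lambda>y. ereal (\<Gamma>' y) + \<psi>n y + ereal (1 / (2 * a') * (norm (y - x0))\<^sup>2))"
  define x' where "x' = (1 - t) *\<^sub>R x + t *\<^sub>R y'"
  have step: "acg_step n \<mu> L \<psi>s \<psi>n x0 s = \<lparr>acg_A = a', acg_x = x', acg_y = y', acg_Gamma = \<Gamma>'\<rparr>"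
  proof -
    have "acg_A s + (\<mu> * acg_A s + 1 + sqrt ((\<mu> * acg_A s + 1)\<^sup>2 + 4 * L * (\<mu> * acg_A s + 1) * acg_A s))
        / (2 * L) = a'"
      by (simp add: a'_def a_def next_A_def)
    then show ?thesis
      unfolding acg_step_def Let_def by (simp only: a_def[symmetric] t(3)[symmetric] t_def[symmetric]
          x_def[symmetric] y_def[symmetric] xt_def[symmetric] \<Gamma>_def[symmetric] \<Gamma>'_def[symmetric]
          y'_def[symmetric] x'_def[symmetric])
  qed
  define Q where "Q u = \<Gamma>' u + P u + 1 / (2 * a') * (norm (u - x0))\<^sup>2" for u
  have "\<exists>w\<in>D. \<forall>u\<in>D. Q w \<le> Q u"
    using prox_exists[of "1 / a'" v'] a'0 by (simp add: Q_def \<Gamma>' algebra_simps)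
  then obtain w where w: "w \<in> D" "\<And>u. u \<in> D \<Longrightarrow> Q w \<le> Q u" by blast
  have y': "y' \<in> D" and Qmin: "\<And>u. u \<in> D \<Longrightarrow> Q y' \<le> Q u"
    unfolding y'_def
    by (rule argmin_Rn_attained[where Q=Q, OF D_Rn _ _ w];
        simp add: Q_def \<psi>n_finite \<psi>n_infinite)+
  have x': "x' \<in> D" unfolding x'_def by (rule conv[OF x y'])
  have Qc: "strongly_convex_on D (\<mu> + 1 / a') Q"
  proof -
    have c: "convex D" using P_convex by (simp add: strongly_convex_on_def)
    show ?thesis
      using strongly_convex_on_add[OF strongly_convex_on_add[OF strongly_convex_on_affine[OF c, of \<alpha>' v'] P_convex]
        strongly_convex_on_quadratic[OF c, of "1 / a'" x0]]
      by (simp add: Q_def[abs_def] \<Gamma>' mult.commute[of 2])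
  qed
  have aQ: "a' * Q u = a' * (\<Gamma>' u + P u) + (norm (u - x0))\<^sup>2 / 2" for u
    using a'0 by (simp add: Q_def field_simps)
  have min': "a' * (\<Gamma>' y' + P y') + (norm (y' - x0))\<^sup>2 / 2 + (\<mu> * a' + 1) / 2 * (norm (u - y'))\<^sup>2
      \<le> a' * (\<Gamma>' u + P u) + (norm (u - x0))\<^sup>2 / 2" if u: "u \<in> D" for u
  proof -
    have "a' * (Q y' + (\<mu> + 1 / a') / 2 * (norm (u - y'))\<^sup>2) \<le> a' * Q u"
      using strongly_convex_min_growth[OF Qc y' Qmin u] a'0 by (simp add: mult_le_cancel_left)
    moreover have "a' * ((\<mu> + 1 / a') / 2 * (norm (u - y'))\<^sup>2) = (\<mu> * a' + 1) / 2 * (norm (u - y'))\<^sup>2"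
      using a'0 by (simp add: field_simps)
    ultimately show ?thesis unfolding aQ distrib_left by linarith
  qed
  have a\<Gamma>': "a' * \<Gamma>' u = a * \<Gamma> u + (a' - a) * linearization n \<psi>s xt u" for u
    using t(4,5) by (simp add: \<Gamma>'_def distrib_left mult.assoc[symmetric])
  have \<Gamma>'_le: "a' * \<Gamma>' u \<le> a' * \<psi>s u" if u: "u \<in> D" for u
  proof -
    have "(a' - a) * linearization n \<psi>s xt u \<le> (a' - a) * \<psi>s u"
      using lower[OF u xt] a' by (intro mult_left_mono) auto
    then show ?thesis unfolding a\<Gamma>' using \<Gamma>_le[OF u] by (simp add: algebra_simps)
  qed
  have val': "a' * (\<psi>s x' + P x') \<le> a' * (\<Gamma>' y' + P y') + (norm (y' - x0))\<^sup>2 / 2"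
  proof -
    let ?l = "linearization n \<psi>s xt"
    have Px': "a' * P x' \<le> a * P x + (a' - a) * P y'"
    proof (cases "t = 1")
      case True
      then show ?thesis using t(4,5) by (simp add: x'_def)
    next
      case False
      then have "t < 1" using t(2) by simp
      then have "P x' \<le> (1 - t) * P x + t * P y' - \<mu> / 2 * t * (1 - t) * (norm (x - y'))\<^sup>2"
        unfolding x'_def using strongly_convex_onD(2)[OF P_convex x y' t(1)] by blast
      moreover have "0 \<le> \<mu> / 2 * t * (1 - t) * (norm (x - y'))\<^sup>2" using t(1,2) \<mu> by (intro mult_nonneg_nonneg) auto
      ultimately have "P x' \<le> (1 - t) * P x + t * P y'" by linarith
      then have "a' * P x' \<le> a' * ((1 - t) * P x + t * P y')" using a'0 by simp
      then show ?thesis using t(4,5) by (simp add: distrib_left mult.assoc[symmetric])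
    qed
    have lx': "a' * ?l x' = a * ?l x + (a' - a) * ?l y'"
    proof -
      have "?l x' = (1 - t) * ?l x + t * ?l y'"
        by (simp add: linearization_def x'_def algebra_simps)
      then have "a' * ?l x' = a' * (1 - t) * ?l x + a' * t * ?l y'"
        by (simp add: distrib_left)
      then show ?thesis using t(4,5) by simp
    qed
    have sq: "a' * (L / 2 * (norm (x' - xt))\<^sup>2) = (\<mu> * a + 1) / 2 * (norm (y' - y))\<^sup>2"
    proof -
      have "x' - xt = t *\<^sub>R (y' - y)" by (simp add: x'_def xt_def algebra_simps)
      then have "a' * (L / 2 * (norm (x' - xt))\<^sup>2) = L * (a' * t) * t / 2 * (norm (y' - y))\<^sup>2"
        by (simp add: power_mult_distrib power2_eq_square)
      also have "L * (a' * t) * t = L * (a' - a)\<^sup>2 / a'"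
        unfolding t(4) by (simp add: t_def power2_eq_square)
      also have "\<dots> = \<mu> * a + 1" unfolding quad using a'0 by simp
      finally show ?thesis .
    qed
    have "a' * (\<psi>s x' + P x') \<le> a' * ?l x' + a' * (L / 2 * (norm (x' - xt))\<^sup>2) + a' * P x'"
      using mult_left_mono[OF upper[OF x' xt] less_imp_le[OF a'0]] by (simp add: algebra_simps)
    also have "\<dots> \<le> a * (?l x + P x) + (a' - a) * (?l y' + P y') + (\<mu> * a + 1) / 2 * (norm (y' - y))\<^sup>2"
      unfolding sq lx' using Px' by (simp add: algebra_simps)
    also have "\<dots> \<le> a * (\<psi>s x + P x) + (a' - a) * (?l y' + P y') + (\<mu> * a + 1) / 2 * (norm (y' - y))\<^sup>2"
      using mult_left_mono[OF lower[OF x xt] a] by (simp add: algebra_simps)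
    also have "\<dots> \<le> a * (\<Gamma> y' + P y') + (norm (y' - x0))\<^sup>2 / 2 + (a' - a) * (?l y' + P y')"
      using val min[OF y'] by linarith
    also have "\<dots> = a' * (\<Gamma>' y' + P y') + (norm (y' - x0))\<^sup>2 / 2"
      using a\<Gamma>'[of y'] by (simp add: algebra_simps)
    finally show ?thesis .
  qed
  show "acg_inv (acg_step n \<mu> L \<psi>s \<psi>n x0 s)"
    unfolding acg_inv_def step using a'0 x' y' \<Gamma>' \<Gamma>'_le min' val' by (simp; blast)
  show "acg_A (acg_step n \<mu> L \<psi>s \<psi>n x0 s) = next_A (acg_A s)"
    by (simp add: step a'_def a_def)
qed

abbreviation iter :: "nat \<Rightarrow> acg_state" where "iter \<equiv> acg_iter n \<mu> L \<psi>s \<psi>n x0"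

lemma iter_inv: "acg_inv (iter j)"
proof (induction j)
  case 0
  show ?case unfolding acg_inv_def using x0
    by (auto simp: acg_iter_def intro!: exI[of _ "0 :: real"] exI[of _ "0 :: rvec"])
next
  case (Suc j)
  then show ?case using acg_step_inv(1) by (simp add: acg_iter_def)
qed

lemma A_0: "acg_A (iter 0) = 0"
  by (simp add: acg_iter_def)

lemma A_Suc: "acg_A (iter (Suc j)) = next_A (acg_A (iter j))"
  using acg_step_inv(2)[OF iter_inv[of j]] by (simp add: acg_iter_def)

lemma A_nonneg: "0 \<le> acg_A (iter j)"
  using iter_inv[of j] by (simp add: acg_inv_def)

lemma A_mono: "i \<le> j \<Longrightarrow> acg_A (iter i) \<le> acg_A (iter j)"
  by (rule lift_Suc_mono_le[of "\<lambda>j. acg_A (iter j)"])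
     (auto simp: A_Suc intro!: less_imp_le next_A_quadratic(1) A_nonneg)

lemma A_pos: "0 < j \<Longrightarrow> 0 < acg_A (iter j)"
  using A_mono[of 1 j] next_A_quadratic(1)[of 0] A_Suc[of 0] A_0 by simp

text \<open>
  By the quadratic equation for the increment \<open>a' - a\<close>, its square is at least \<open>a' / L\<close> and at
  least \<open>\<mu> / L * a\<^sup>2\<close>. The first bound makes \<open>A\<close> grow quadratically, the second geometrically.
\<close>

lemma A_quadratic_growth: "real j / (2 * sqrt L) \<le> sqrt (acg_A (iter j))"
proof (induction j)
  case (Suc j)
  define a a' where "a = acg_A (iter j)" and "a' = acg_A (iter (Suc j))"
  have a: "0 \<le> a" "a < a'" "L * (a' - a)\<^sup>2 = (\<mu> * a + 1) * a'"
    using A_nonneg next_A_quadratic by (simp_all add: a_def a'_def A_Suc)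
  have "1 * a' \<le> (\<mu> * a + 1) * a'" using a \<mu> by (intro mult_right_mono) auto
  then have "sqrt a' \<le> sqrt (L * (a' - a)\<^sup>2)" using a by simp
  also have "\<dots> = sqrt L * (a' - a)" unfolding real_sqrt_mult real_sqrt_abs using a(2) by simp
  also have "a' - a = (sqrt a' - sqrt a) * (sqrt a' + sqrt a)"
    using a by (simp add: algebra_simps)
  also have "\<dots> \<le> (sqrt a' - sqrt a) * (2 * sqrt a')"
    using a by (intro mult_left_mono) auto
  finally have "1 * sqrt a' \<le> 2 * sqrt L * (sqrt a' - sqrt a) * sqrt a'"
    using L by (simp add: mult_ac mult_left_mono)
  then have "1 \<le> 2 * sqrt L * (sqrt a' - sqrt a)" using a by (simp add: mult_le_cancel_right)
  then have "1 / (2 * sqrt L) \<le> sqrt a' - sqrt a" using L by (simp add: field_simps)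
  then show ?case using Suc.IH by (simp add: a_def a'_def add_divide_distrib)
qed (simp add: A_0)

lemma A_geometric_growth: "(1 + sqrt (\<mu> / L)) ^ k * acg_A (iter j) \<le> acg_A (iter (j + k))"
proof (induction k)
  case (Suc k)
  define a a' where "a = acg_A (iter (j + k))" and "a' = acg_A (iter (Suc (j + k)))"
  have a: "0 \<le> a" "a < a'" "L * (a' - a)\<^sup>2 = (\<mu> * a + 1) * a'"
    using A_nonneg next_A_quadratic by (simp_all add: a_def a'_def A_Suc)
  have "\<mu> * a * a \<le> (\<mu> * a + 1) * a'" using a \<mu> by (intro mult_mono) auto
  then have "\<mu> / L * a\<^sup>2 \<le> (a' - a)\<^sup>2" using a L by (simp add: power2_eq_square field_simps)
  then have "sqrt (\<mu> / L * a\<^sup>2) \<le> a' - a" using a by (simp add: real_le_lsqrt)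
  moreover have "sqrt (\<mu> / L * a\<^sup>2) = sqrt (\<mu> / L) * a"
    unfolding real_sqrt_mult real_sqrt_abs using a(1) by simp
  ultimately have "(1 + sqrt (\<mu> / L)) * a \<le> a'" by (simp add: distrib_right)
  moreover have "(1 + sqrt (\<mu> / L)) * ((1 + sqrt (\<mu> / L)) ^ k * acg_A (iter j)) \<le> (1 + sqrt (\<mu> / L)) * a"
    unfolding a_def using Suc.IH \<mu> L by (intro mult_left_mono) auto
  ultimately show ?case by (simp add: a'_def mult.assoc)
qed simp

text \<open>
  Both estimates come from the invariant. The minimality of \<open>y\<close> says that \<open>u\<close> is a subgradient of
  \<open>\<Gamma> + P\<close> at \<open>y\<close>, with the modulus \<open>\<mu>\<close> to spare, and \<open>\<Gamma> + P\<close> lies below the objective; \<open>\<eta>\<close> is the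
  resulting error at \<open>x\<close>. The bound on the value at \<open>x\<close>, after completing the square, controls
  \<open>\<parallel>x - y\<parallel>\<close> and \<open>\<eta>\<close> by the distance travelled from \<open>x0\<close>.
\<close>

lemma acg_triple_properties:
  assumes j: "0 < j" and tr: "acg_triple n \<mu> L \<psi>s \<psi>n x0 j = (x, u, \<eta>)"
  obtains y where "x \<in> D" "y \<in> D" "u = (1 / acg_A (iter j)) *\<^sub>R (x0 - y)"
    "\<And>w. w \<in> D \<Longrightarrow> \<psi>s x + P x + u \<bullet> (w - x) - \<eta> + \<mu> / 2 * (norm (w - y))\<^sup>2 \<le> \<psi>s w + P w"
    "(norm (x - y))\<^sup>2 + 2 * acg_A (iter j) * \<eta> \<le> (norm (x - x0))\<^sup>2"
proof -
  define s a y \<Gamma> where "s = iter j" and "a = acg_A s" and "y = acg_y s" and "\<Gamma> = acg_Gamma s"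
  have x: "x = acg_x s" and u: "u = (1 / a) *\<^sub>R (x0 - y)"
    using tr by (auto simp: acg_triple_def Let_def s_def a_def y_def)
  have xD: "x \<in> D" and yD: "y \<in> D" using iter_inv[of j] by (simp_all add: acg_inv_def x y_def s_def)
  have a: "0 < a" using A_pos[OF j] by (simp add: a_def s_def)
  have \<eta>: "\<eta> = \<psi>s x + P x - \<Gamma> y - P y - u \<bullet> (x - y)"
    using tr xD yD by (auto simp: acg_triple_def Let_def s_def[symmetric] x y_def[symmetric] \<Gamma>_def
        \<psi>n_finite u a_def[symmetric])
  have \<Gamma>_le: "\<And>w. w \<in> D \<Longrightarrow> \<Gamma> w \<le> \<psi>s w"
    and min: "\<And>w. w \<in> D \<Longrightarrow> a * (\<Gamma> y + P y) + (norm (y - x0))\<^sup>2 / 2 + (\<mu> * a + 1) / 2 * (norm (w - y))\<^sup>2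
      \<le> a * (\<Gamma> w + P w) + (norm (w - x0))\<^sup>2 / 2"
    and val: "a * (\<psi>s x + P x) \<le> a * (\<Gamma> y + P y) + (norm (y - x0))\<^sup>2 / 2"
    using iter_inv[of j] a by (auto simp: acg_inv_def a_def x y_def \<Gamma>_def s_def mult_le_cancel_left)
  have au: "a * (u \<bullet> z) = (x0 - y) \<bullet> z" for z using a by (simp add: u)
  show thesis
  proof (rule that[of y])
    show "u = (1 / acg_A (iter j)) *\<^sub>R (x0 - y)" by (simp add: u a_def s_def)
    fix w assume w: "w \<in> D"
    have "(norm (w - x0))\<^sup>2 = (norm (w - y))\<^sup>2 + (norm (y - x0))\<^sup>2 - 2 * ((x0 - y) \<bullet> (w - y))"
      by (simp add: power2_norm_eq_inner algebra_simps inner_commute)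
    then have "a * (\<Gamma> y + P y + u \<bullet> (w - y) + \<mu> / 2 * (norm (w - y))\<^sup>2) \<le> a * (\<Gamma> w + P w)"
      using min[OF w] au[of "w - y"] by (simp add: algebra_simps add_divide_distrib)
    then have "\<Gamma> y + P y + u \<bullet> (w - y) + \<mu> / 2 * (norm (w - y))\<^sup>2 \<le> \<Gamma> w + P w"
      using a by (simp add: mult_le_cancel_left)
    then show "\<psi>s x + P x + u \<bullet> (w - x) - \<eta> + \<mu> / 2 * (norm (w - y))\<^sup>2 \<le> \<psi>s w + P w"
      using \<Gamma>_le[OF w] by (simp add: \<eta> inner_diff_right)
  next
    have "a * \<eta> = a * (\<psi>s x + P x) - a * (\<Gamma> y + P y) - (x0 - y) \<bullet> (x - y)"
      using au[of "x - y"] by (simp add: \<eta> algebra_simps)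
    moreover have "(norm (x - x0))\<^sup>2 = (norm (x - y))\<^sup>2 + (norm (y - x0))\<^sup>2 - 2 * ((x0 - y) \<bullet> (x - y))"
      by (simp add: power2_norm_eq_inner algebra_simps inner_commute)
    ultimately show "(norm (x - y))\<^sup>2 + 2 * acg_A (iter j) * \<eta> \<le> (norm (x - x0))\<^sup>2"
      using val unfolding a_def[symmetric] s_def[symmetric] by simp
  qed (use xD yD in auto)
qed

end

section \<open>The proximal subproblems\<close>

locale composite = closed_convex n h
  for n :: nat and h :: "rvec \<Rightarrow> ereal" +
  fixes g :: "rvec \<Rightarrow> real" and m M lam :: real
  assumes g_diff: "\<And>z. z \<in> D \<Longrightarrow> g differentiable (at z within Rn n)"
    and g_lower: "\<And>u z. u \<in> D \<Longrightarrow> z \<in> D \<Longrightarrow>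
      linearization n g z u - m / 2 * (norm (u - z))\<^sup>2 \<le> g u"
    and g_upper: "\<And>u z. u \<in> D \<Longrightarrow> z \<in> D \<Longrightarrow>
      g u \<le> linearization n g z u + M / 2 * (norm (u - z))\<^sup>2"
    and lam: "0 < lam" "2 * lam * m \<le> 1" and M: "0 \<le> M"
begin

definition \<phi> :: "rvec \<Rightarrow> real" where "\<phi> u = g u + H u"

text \<open>
  The natural unit for the length of an accelerated run: \<open>S\<^sup>2\<close> is twice the smoothness constant
  \<open>lam * M + 1 / 2\<close> of the subproblem, and \<open>1 / S\<^sup>2\<close> is the ratio between the strong
  convexity modulus \<open>1 / 2\<close> and that constant.
\<close>

definition S :: real where "S = sqrt (2 * lam * M + 1)"

lemma S: "1 \<le> S" "S\<^sup>2 = 2 * lam * M + 1"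
  using lam M by (auto simp: S_def)

lemma linearization_prox:
  assumes x: "x \<in> D" and z: "z \<in> D"
  shows "linearization n (\<lambda>x. lam * g x + 1 / 4 * (norm (x - z))\<^sup>2) x u
    = lam * linearization n g x u + 1 / 4 * (norm (x - z))\<^sup>2 + 1 / 2 * ((x - z) \<bullet> (u - x))"
proof -
  have xR: "x \<in> Rn n" and zR: "z \<in> Rn n" using x z by auto
  note G = has_derivative_grad[OF xR g_diff[OF x]]
  have sq: "(norm (x - z))\<^sup>2 = (x - z) \<bullet> (x - z)" for x by (rule power2_norm_eq_inner)
  have "grad n (\<lambda>x. lam * g x + 1 / 4 * (norm (x - z))\<^sup>2) x = lam *\<^sub>R grad n g x + (1 / 2) *\<^sub>R (x - z)"
    unfolding sq
  proof (rule grad_eqI[OF xR])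
    show "lam *\<^sub>R grad n g x + (1 / 2) *\<^sub>R (x - z) \<in> Rn n" using G(1) xR zR by simp
    show "((\<lambda>x. lam * g x + 1 / 4 * ((x - z) \<bullet> (x - z))) has_derivative
        (\<bullet>) (lam *\<^sub>R grad n g x + (1 / 2) *\<^sub>R (x - z))) (at x within Rn n)"
      by (rule derivative_eq_intros G(2) refl)+
         (simp add: fun_eq_iff inner_left_distrib inner_commute algebra_simps)
  qed
  then show ?thesis
    by (simp only: linearization_def inner_add_left inner_scaleR_left distrib_left add_ac mult.assoc)
qed

abbreviation \<psi>s :: "rvec \<Rightarrow> rvec \<Rightarrow> real"
  where "\<psi>s z \<equiv> \<lambda>x. lam * g x + 1 / 4 * (norm (x - z))\<^sup>2"

abbreviation \<psi>n :: "rvec \<Rightarrow> rvec \<Rightarrow> ereal"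
  where "\<psi>n z \<equiv> \<lambda>x. ereal lam * h x + ereal (1 / 4 * (norm (x - z))\<^sup>2)"

definition prox_A :: "rvec \<Rightarrow> nat \<Rightarrow> real"
  where "prox_A z j = acg_A (acg_iter n (1 / 2) (lam * M + 1 / 2) (\<psi>s z) (\<psi>n z) z j)"

text \<open>
  Moving half of the proximal term into each part makes the smooth part convex and the
  nonsmooth part strongly convex.
\<close>

lemma acg_prox:
  assumes z: "z \<in> D"
  shows "acg n (1 / 2) (lam * M + 1 / 2) (\<psi>s z) (\<psi>n z) z D (\<lambda>x. lam * H x + 1 / 4 * (norm (x - z))\<^sup>2)"
proof
  show "strongly_convex_on D (1 / 2) (\<lambda>x. lam * H x + 1 / 4 * (norm (x - z))\<^sup>2)"
    using strongly_convex_on_add[OF strongly_convex_on_scale[OF H_convex, of lam]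
      strongly_convex_on_quadratic[OF convex_D, of "1/2" z]] lam by simp
  show "\<exists>y\<in>D. \<forall>u\<in>D. lam * H y + 1 / 4 * (norm (y - z))\<^sup>2 + v \<bullet> y + K / 2 * (norm (y - z))\<^sup>2
      \<le> lam * H u + 1 / 4 * (norm (u - z))\<^sup>2 + v \<bullet> u + K / 2 * (norm (u - z))\<^sup>2"
    if K: "0 < K" for v and K :: real
  proof -
    have "0 < K + 1 / 2" using K by simp
    from prox_point_exists[OF lam(1) this, of v z] obtain y where "y \<in> D"
      "\<And>u. u \<in> D \<Longrightarrow> lam * H y + v \<bullet> y + (K + 1 / 2) / 2 * (norm (y - z))\<^sup>2
        \<le> lam * H u + v \<bullet> u + (K + 1 / 2) / 2 * (norm (u - z))\<^sup>2" by blast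
    then show ?thesis by (intro bexI[of _ y]) (simp_all add: algebra_simps add_divide_distrib)
  qed
  show "0 < lam * M + 1 / 2" using lam M by (simp add: add_nonneg_pos)
  fix u x assume u: "u \<in> D" and x: "x \<in> D"
  have sq: "(norm (u - z))\<^sup>2 = (norm (u - x))\<^sup>2 + (norm (x - z))\<^sup>2 + 2 * ((x - z) \<bullet> (u - x))"
    by (simp add: power2_norm_eq_inner algebra_simps inner_commute)
  show "linearization n (\<psi>s z) x u \<le> \<psi>s z u"
  proof -
    have "lam * (linearization n g x u - m / 2 * (norm (u - x))\<^sup>2) \<le> lam * g u"
      using mult_left_mono[OF g_lower[OF u x], of lam] lam by simp
    moreover have "2 * lam * m * (norm (u - x))\<^sup>2 \<le> 1 * (norm (u - x))\<^sup>2"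
      by (rule mult_right_mono[OF lam(2)]) simp
    ultimately show ?thesis unfolding linearization_prox[OF x z] sq by (simp add: algebra_simps)
  qed
  show "\<psi>s z u \<le> linearization n (\<psi>s z) x u + (lam * M + 1 / 2) / 2 * (norm (u - x))\<^sup>2"
    using mult_left_mono[OF g_upper[OF u x], of lam] lam
    unfolding linearization_prox[OF x z] sq by (simp add: algebra_simps add_divide_distrib)
qed (use z lam(1) in \<open>simp_all add: D_subset h_eq_H h_outside\<close>)

text \<open>
  \<open>approx_prox z x u \<eta>\<close> says that \<open>u\<close> is an \<open>\<eta>\<close>-subgradient at \<open>x\<close> of the function
  minimized by the proximal step from \<open>z\<close>.
\<close>

definition approx_prox :: "rvec \<Rightarrow> rvec \<Rightarrow> rvec \<Rightarrow> real \<Rightarrow> bool"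
  where "approx_prox z x u \<eta> \<longleftrightarrow> (\<forall>w\<in>D.
    lam * \<phi> x + (norm (x - z))\<^sup>2 / 2 + u \<bullet> (w - x) - \<eta> \<le> lam * \<phi> w + (norm (w - z))\<^sup>2 / 2)"

lemma prox_triple:
  assumes z: "z \<in> D" and j: "0 < j" and tr: "prox_acg n g h lam M z j = (x, u, \<eta>)"
  obtains y where "x \<in> D" "y \<in> D" "u = (1 / prox_A z j) *\<^sub>R (z - y)"
    "\<And>w. w \<in> D \<Longrightarrow> lam * \<phi> x + (norm (x - z))\<^sup>2 / 2 + u \<bullet> (w - x) - \<eta> + (norm (w - y))\<^sup>2 / 4
      \<le> lam * \<phi> w + (norm (w - z))\<^sup>2 / 2"
    "(norm (x - y))\<^sup>2 + 2 * prox_A z j * \<eta> \<le> (norm (x - z))\<^sup>2"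
proof -
  interpret acg n "1 / 2" "lam * M + 1 / 2" "\<psi>s z" "\<psi>n z" z D "\<lambda>x. lam * H x + 1 / 4 * (norm (x - z))\<^sup>2"
    by (rule acg_prox[OF z])
  obtain y where y: "x \<in> D" "y \<in> D" "u = (1 / prox_A z j) *\<^sub>R (z - y)"
    "\<And>w. w \<in> D \<Longrightarrow> \<psi>s z x + (lam * H x + 1 / 4 * (norm (x - z))\<^sup>2) + u \<bullet> (w - x) - \<eta>
        + 1 / 2 / 2 * (norm (w - y))\<^sup>2 \<le> \<psi>s z w + (lam * H w + 1 / 4 * (norm (w - z))\<^sup>2)"
    "(norm (x - y))\<^sup>2 + 2 * prox_A z j * \<eta> \<le> (norm (x - z))\<^sup>2"
    using acg_triple_properties[OF j tr[unfolded prox_acg_def]] unfolding prox_A_def by blast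
  show thesis
    by (rule that[OF y(1-3) _ y(5)], drule y(4)) (simp add: \<phi>_def algebra_simps)
qed

lemma prox_triple_approx:
  assumes z: "z \<in> D" and j: "0 < j" and tr: "prox_acg n g h lam M z j = (x, u, \<eta>)"
  shows "approx_prox z x u \<eta>"
proof -
  obtain y where y: "\<And>w. w \<in> D \<Longrightarrow> lam * \<phi> x + (norm (x - z))\<^sup>2 / 2 + u \<bullet> (w - x) - \<eta>
      + (norm (w - y))\<^sup>2 / 4 \<le> lam * \<phi> w + (norm (w - z))\<^sup>2 / 2"
    using prox_triple[OF z j tr] by metis
  have "0 \<le> (norm (w - y))\<^sup>2 / 4" for w by simp
  then show ?thesis unfolding approx_prox_def using y by (smt (verit))
qed

lemma prox_A_mono:
  assumes z: "z \<in> D" and "i \<le> j"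
  shows "prox_A z i \<le> prox_A z j"
  unfolding prox_A_def using acg.A_mono[OF acg_prox[OF z] assms(2)] .

lemma prox_A_nonneg: "z \<in> D \<Longrightarrow> 0 \<le> prox_A z j"
  unfolding prox_A_def using acg.A_nonneg[OF acg_prox] .

lemma prox_A_quadratic:
  assumes z: "z \<in> D" and c: "0 \<le> c" "c * S \<le> real j"
  shows "c\<^sup>2 / 2 \<le> prox_A z j"
proof -
  have S2: "sqrt (lam * M + 1 / 2) = S / sqrt 2"
    by (simp add: S_def real_sqrt_divide[symmetric] add_divide_distrib)
  have "c / sqrt 2 = c * S / (2 * (S / sqrt 2))" using S(1) by (simp add: field_simps)
  also have "\<dots> \<le> real j / (2 * (S / sqrt 2))" using c S(1) by (intro divide_right_mono) auto
  also have "\<dots> \<le> sqrt (prox_A z j)"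
    using acg.A_quadratic_growth[OF acg_prox[OF z], of j] unfolding S2 prox_A_def .
  finally have "(c / sqrt 2)\<^sup>2 \<le> (sqrt (prox_A z j))\<^sup>2" using c by (intro power_mono) auto
  then show ?thesis using prox_A_nonneg[OF z, of j] by (simp add: power_divide)
qed

text \<open>
  \<open>\<lceil>4 S ln S\<rceil>\<close> further iterations multiply \<open>A\<close> by at least \<open>S\<^sup>2\<close>, since each one multiplies it
  by at least \<open>1 + 1 / S\<close> and \<open>ln (1 + 1 / S) \<ge> 1 / (2 S)\<close>.
\<close>

lemma prox_A_geometric:
  assumes z: "z \<in> D" and k: "4 * S * ln S \<le> real k"
  shows "S\<^sup>2 * prox_A z j \<le> prox_A z (j + k)"
proof -
  have S0: "0 < S" using S(1) by simp
  have "1 / 2 / (lam * M + 1 / 2) = 1 / (2 * lam * M + 1)"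
    using lam M by (simp add: field_simps)
  then have "sqrt (1 / 2 / (lam * M + 1 / 2)) = 1 / S"
    by (simp only: S_def real_sqrt_divide real_sqrt_one)
  then have geo: "(1 + 1 / S) ^ k * prox_A z j \<le> prox_A z (j + k)"
    using acg.A_geometric_growth[OF acg_prox[OF z], of k j] unfolding prox_A_def by simp
  have "1 / S / 2 \<le> ln (1 + 1 / S)"
  proof -
    define x where "x = 1 / S"
    have x: "0 \<le> x" "x \<le> 1" using S(1) by (simp_all add: x_def)
    have "x * x \<le> 1 * x" using x by (intro mult_right_mono) auto
    then have "exp (x / 2) \<le> 1 + x"
      using x exp_bound[of "x / 2"] by (auto simp: power2_eq_square)
    then have "exp (1 / S / 2) \<le> 1 + 1 / S" by (simp only: x_def)
    then show ?thesis using S0 by (subst ln_ge_iff) (auto simp: add_pos_pos)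
  qed
  then have "real k * (1 / S / 2) \<le> real k * ln (1 + 1 / S)" by (intro mult_left_mono) auto
  moreover have "2 * ln S \<le> real k * (1 / S / 2)" using k S0 by (simp add: field_simps)
  ultimately have "ln (S\<^sup>2) \<le> ln ((1 + 1 / S) ^ k)"
    using S0 by (simp add: ln_realpow add_pos_pos)
  then have "S\<^sup>2 \<le> (1 + 1 / S) ^ k" using S0 by (subst (asm) ln_le_cancel_iff) (auto simp: add_pos_pos)
  then have "S\<^sup>2 * prox_A z j \<le> (1 + 1 / S) ^ k * prox_A z j"
    using prox_A_nonneg[OF z, of j] by (rule mult_right_mono)
  then show ?thesis using geo by simp
qed

text \<open>
  The threshold \<open>18\<close> is what the quadratic growth guarantees after the compulsory \<open>6 * S\<close>
  iterations. Since \<open>\<eta> \<ge> \<parallel>x - y\<parallel>\<^sup>2 / 4\<close> by strong convexity, \<open>x\<close> and \<open>y\<close> are then close to each other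
  and \<open>u = (z - y) / A\<close> is small compared with \<open>x - z\<close>.
\<close>

lemma prox_estimates:
  assumes z: "z \<in> D" and j: "0 < j" and tr: "prox_acg n g h lam M z j = (x, u, \<eta>)"
    and A: "18 \<le> prox_A z j"
  obtains y where "x \<in> D" "y \<in> D" "0 \<le> \<eta>" "2 * prox_A z j * \<eta> \<le> (norm (x - z))\<^sup>2"
    "3 * norm (x - y) \<le> norm (x - z)" "prox_A z j * norm u \<le> 4 / 3 * norm (x - z)"
    "27 * norm u \<le> 2 * norm (x - z)"
    "\<And>w. w \<in> D \<Longrightarrow> lam * \<phi> x + (norm (x - z))\<^sup>2 / 2 + u \<bullet> (w - x) - \<eta> + (norm (w - y))\<^sup>2 / 4
      \<le> lam * \<phi> w + (norm (w - z))\<^sup>2 / 2"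
proof -
  obtain y where y: "x \<in> D" "y \<in> D" "u = (1 / prox_A z j) *\<^sub>R (z - y)"
    "\<And>w. w \<in> D \<Longrightarrow> lam * \<phi> x + (norm (x - z))\<^sup>2 / 2 + u \<bullet> (w - x) - \<eta> + (norm (w - y))\<^sup>2 / 4
      \<le> lam * \<phi> w + (norm (w - z))\<^sup>2 / 2"
    "(norm (x - y))\<^sup>2 + 2 * prox_A z j * \<eta> \<le> (norm (x - z))\<^sup>2"
    using prox_triple[OF z j tr] by blast
  let ?A = "prox_A z j" and ?d = "norm (x - z)" and ?e = "norm (x - y)"
  have \<eta>: "?e\<^sup>2 / 4 \<le> \<eta>" using y(4)[OF y(1)] by simp
  then have \<eta>0: "0 \<le> \<eta>" by (rule order_trans[rotated]) simp
  have "18 * \<eta> \<le> ?A * \<eta>" using A \<eta>0 by (rule mult_right_mono)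
  then have "9 * ?e\<^sup>2 \<le> ?d\<^sup>2" using y(5) \<eta> zero_le_power2[of ?e] unfolding mult.assoc by linarith
  then have "(3 * ?e)\<^sup>2 \<le> ?d\<^sup>2" by (simp add: power_mult_distrib)
  then have e: "3 * ?e \<le> ?d" by (rule power2_le_imp_le) simp
  have "?A * norm u = norm (z - y)" using A by (simp add: y(3))
  also have "\<dots> \<le> ?d + ?e"
    using norm_triangle_ineq[of "z - x" "x - y"] by (simp add: norm_minus_commute)
  finally have Au: "?A * norm u \<le> 4 / 3 * ?d" using e by simp
  have "18 * norm u \<le> ?A * norm u" using A by (intro mult_right_mono) auto
  then have u: "27 * norm u \<le> 2 * ?d" using Au by simp
  have "2 * ?A * \<eta> \<le> ?d\<^sup>2" using y(5) by (rule order_trans[rotated]) simp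
  then show thesis using that[OF y(1,2) \<eta>0 _ e Au u y(4)] by simp
qed

text \<open>
  Two iterates of one run satisfy subgradient inequalities for the same strongly convex
  function; adding them up shows that their distances to the starting point are comparable.
\<close>

lemma prox_iterates_comparable:
  assumes z: "z \<in> D" and i: "0 < i" and j: "0 < j"
    and tri: "prox_acg n g h lam M z i = (x, u, \<eta>)" and Ai: "18 \<le> prox_A z i"
    and trj: "prox_acg n g h lam M z j = (x', u', \<eta>')" and Aj: "18 \<le> prox_A z j"
  shows "norm (x - z) \<le> 4 * norm (x' - z)"
    and "norm (z - x + u) \<le> 5 * norm (z - x' + u')"
    and "8 * norm (x - z) \<le> 9 * norm (z - x + u)"
proof -
  obtain y where y: "x \<in> D" "0 \<le> \<eta>" "2 * prox_A z i * \<eta> \<le> (norm (x - z))\<^sup>2"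
    "3 * norm (x - y) \<le> norm (x - z)" "27 * norm u \<le> 2 * norm (x - z)"
    "\<And>w. w \<in> D \<Longrightarrow> lam * \<phi> x + (norm (x - z))\<^sup>2 / 2 + u \<bullet> (w - x) - \<eta> + (norm (w - y))\<^sup>2 / 4
      \<le> lam * \<phi> w + (norm (w - z))\<^sup>2 / 2"
    using prox_estimates[OF z i tri Ai] by metis
  obtain y' where y': "x' \<in> D" "0 \<le> \<eta>'" "2 * prox_A z j * \<eta>' \<le> (norm (x' - z))\<^sup>2"
    "3 * norm (x' - y') \<le> norm (x' - z)" "27 * norm u' \<le> 2 * norm (x' - z)"
    "\<And>w. w \<in> D \<Longrightarrow> lam * \<phi> x' + (norm (x' - z))\<^sup>2 / 2 + u' \<bullet> (w - x') - \<eta>' + (norm (w - y'))\<^sup>2 / 4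
      \<le> lam * \<phi> w + (norm (w - z))\<^sup>2 / 2"
    using prox_estimates[OF z j trj Aj] by metis
  define a b t where "a = norm (x - z)" and "b = norm (x' - z)" and "t = norm (x - x')"
  have ab: "0 \<le> b" "a - b \<le> t"
    using norm_triangle_ineq[of "x - x'" "x' - z"] by (simp_all add: a_def b_def t_def)
  have "2 * 18 * \<eta> \<le> a\<^sup>2"
    using y(3) mult_right_mono[OF Ai y(2)] by (simp add: a_def)
  moreover have "2 * 18 * \<eta>' \<le> b\<^sup>2"
    using y'(3) mult_right_mono[OF Aj y'(2)] by (simp add: b_def)
  moreover have "(u - u') \<bullet> (x - x') \<le> 2 / 27 * (a + b) * t"
  proof -
    have "(u - u') \<bullet> (x - x') \<le> norm (u - u') * t" unfolding t_def by (rule norm_cauchy_schwarz)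
    also have "\<dots> \<le> (2 / 27 * (a + b)) * t"
      using norm_triangle_ineq4[of u u'] y(5) y'(5)
      by (intro mult_right_mono) (auto simp: a_def b_def t_def)
    finally show ?thesis .
  qed
  moreover have "(norm (x' - y))\<^sup>2 / 4 + (norm (x - y'))\<^sup>2 / 4 \<le> \<eta> + \<eta>' + (u - u') \<bullet> (x - x')"
    using y(6)[OF y'(1)] y'(6)[OF y(1)] by (simp add: algebra_simps)
  ultimately have sum: "(norm (x' - y))\<^sup>2 / 4 + (norm (x - y'))\<^sup>2 / 4
      \<le> (a\<^sup>2 + b\<^sup>2) / 36 + 2 / 27 * (a + b) * t" by (simp add: add_divide_distrib)
  show le: "norm (x - z) \<le> 4 * norm (x' - z)"
  proof (rule ccontr)
    assume "\<not> ?thesis"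
    then have w: "0 < a - 4 * b" by (simp add: a_def b_def)
    \<comment> \<open>In the nonnegative variables \<open>b\<close>, \<open>w\<close>, \<open>s\<close> the two sides of \<open>sum\<close> differ by a
      quadratic form all of whose coefficients are positive.\<close>
    define w s where "w = a - 4 * b" and "s = t - (a - b)"
    have nn: "0 < w" "0 \<le> s" "0 \<le> b" using w ab by (simp_all add: w_def s_def)
    have a_eq: "a = 4 * b + w" and t_eq: "t = 3 * b + w + s" by (simp_all add: w_def s_def)
    have 1: "5 / 3 * b + 2 / 3 * w + s \<le> norm (x' - y)"
      using norm_triangle_ineq4[of "x - y" "x' - y"] y(4) a_eq t_eq
      by (simp add: a_def t_def)
    have 2: "8 / 3 * b + w + s \<le> norm (x - y')"
      using norm_triangle_ineq4[of "x - y'" "x' - y'"] y'(4) a_eq t_eq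
      by (simp add: b_def t_def)
    have "(5 / 3 * b + 2 / 3 * w + s)\<^sup>2 / 4 + (8 / 3 * b + w + s)\<^sup>2 / 4
        \<le> (norm (x' - y))\<^sup>2 / 4 + (norm (x - y'))\<^sup>2 / 4"
      by (intro add_mono divide_right_mono power_mono 1 2) (use nn in auto)
    also note sum
    finally have fin: "(5 / 3 * b + 2 / 3 * w + s)\<^sup>2 / 4 + (8 / 3 * b + w + s)\<^sup>2 / 4
        \<le> ((4 * b + w)\<^sup>2 + b\<^sup>2) / 36 + 2 / 27 * (5 * b + w) * (3 * b + w + s)"
      by (simp add: a_eq t_eq)
    have "0 < w\<^sup>2" "0 \<le> b * w" "0 \<le> b * s" "0 \<le> w * s" "0 \<le> b\<^sup>2" "0 \<le> s\<^sup>2" using nn by simp_all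
    moreover have "(5 / 3 * b + 2 / 3 * w + s)\<^sup>2 / 4 + (8 / 3 * b + w + s)\<^sup>2 / 4
        - (((4 * b + w)\<^sup>2 + b\<^sup>2) / 36 + 2 / 27 * (5 * b + w) * (3 * b + w + s))
      = 8 / 9 * b\<^sup>2 + 29 / 27 * (b * w) + 7 / 27 * w\<^sup>2 + 97 / 54 * (b * s) + 41 / 54 * (w * s) + s\<^sup>2 / 2"
      by (simp add: power2_eq_square field_simps)
    ultimately show False using fin by linarith
  qed
  have lo: "norm (x - z) - norm u \<le> norm (z - x + u)" for x u :: rvec
    using norm_triangle_ineq4[of "z - x + u" u] by (simp add: norm_minus_commute)
  show "8 * norm (x - z) \<le> 9 * norm (z - x + u)" using lo[of x u] y(5) norm_ge_zero[of "x - z"] by linarith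
  have "norm (z - x + u) \<le> norm (x - z) + norm u"
    using norm_triangle_ineq[of "z - x" u] by (simp add: norm_minus_commute)
  then show "norm (z - x + u) \<le> 5 * norm (z - x' + u')"
    using le lo[of x' u'] y(5) y'(5) norm_ge_zero[of "x' - z"] by linarith
qed

text \<open>
  The left side of the test is of the order \<open>\<parallel>x - z\<parallel>\<^sup>2 / A\<close>, the right side of the order
  \<open>\<sigma> * \<parallel>x - z\<parallel>\<^sup>2\<close>.
\<close>

lemma prox_crit_holds:
  assumes z: "z \<in> D" and j: "0 < j" and \<sigma>: "0 < \<sigma>" "\<sigma> < 1" and A: "18 / \<sigma> \<le> prox_A z j"
  shows "prox_crit \<sigma> z (prox_acg n g h lam M z j)"
proof -
  obtain x u \<eta> where tr: "prox_acg n g h lam M z j = (x, u, \<eta>)" by (metis prod_cases3)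
  let ?A = "prox_A z j" and ?d = "norm (x - z)"
  have "18 * 1 \<le> 18 / \<sigma>" using \<sigma> by (simp add: field_simps)
  then have A18: "18 \<le> ?A" using A by simp
  obtain y where y: "0 \<le> \<eta>" "2 * ?A * \<eta> \<le> ?d\<^sup>2" "?A * norm u \<le> 4 / 3 * ?d" "27 * norm u \<le> 2 * ?d"
    using prox_estimates[OF z j tr A18] by metis
  have "?A * ((norm u)\<^sup>2) = (?A * norm u) * norm u" by (simp add: power2_eq_square)
  also have "\<dots> \<le> (4 / 3 * ?d) * (2 / 27 * ?d)" by (rule mult_mono) (use y(3,4) in simp_all)
  finally have "?A * (norm u)\<^sup>2 \<le> (4 / 3 * ?d) * (2 / 27 * ?d)" .
  then have "?A * ((norm u)\<^sup>2 + 2 * \<eta>) \<le> 6 / 5 * ?d\<^sup>2"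
  proof -
    have "?A * ((norm u)\<^sup>2 + 2 * \<eta>) = ?A * (norm u)\<^sup>2 + 2 * ?A * \<eta>" by (simp add: algebra_simps)
    moreover have "(4 / 3 * ?d) * (2 / 27 * ?d) = 8 / 81 * ?d\<^sup>2" by (simp add: power2_eq_square)
    ultimately show ?thesis
      using y(2) \<open>?A * (norm u)\<^sup>2 \<le> (4 / 3 * ?d) * (2 / 27 * ?d)\<close> zero_le_power2[of ?d] by linarith
  qed
  moreover have "18 \<le> \<sigma> * ?A" using A \<sigma> by (simp add: field_simps)
  then have "18 * ((norm u)\<^sup>2 + 2 * \<eta>) \<le> (\<sigma> * ?A) * ((norm u)\<^sup>2 + 2 * \<eta>)"
    using y(1) by (intro mult_right_mono) auto
  ultimately have "18 * ((norm u)\<^sup>2 + 2 * \<eta>) \<le> \<sigma> * (6 / 5 * ?d\<^sup>2)"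
    using mult_left_mono[of "?A * ((norm u)\<^sup>2 + 2 * \<eta>)" "6 / 5 * ?d\<^sup>2" \<sigma>] \<sigma>
    unfolding mult.assoc[of \<sigma>] by linarith
  moreover have "?d\<^sup>2 \<le> 2 * (norm (z - x + u))\<^sup>2"
  proof -
    have "(8 * ?d)\<^sup>2 \<le> (9 * norm (z - x + u))\<^sup>2"
      using prox_iterates_comparable(3)[OF z j j tr A18 tr A18] by (intro power_mono) auto
    then have "64 * ?d\<^sup>2 \<le> 81 * (norm (z - x + u))\<^sup>2" by (simp add: power_mult_distrib)
    then show ?thesis using zero_le_power2[of "norm (z - x + u)"] by linarith
  qed
  then have "\<sigma> * ?d\<^sup>2 \<le> \<sigma> * (2 * (norm (z - x + u))\<^sup>2)" using \<sigma> by simp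
  moreover have "0 \<le> \<sigma> * (norm (z - x + u))\<^sup>2" using \<sigma> by simp
  ultimately have "(norm u)\<^sup>2 + 2 * \<eta> \<le> \<sigma> * (norm (z - x + u))\<^sup>2" by simp
  then show ?thesis by (simp add: tr prox_crit_def)
qed

text \<open>
  In the subgradient inequality at \<open>z\<close> the terms in \<open>x\<close> and \<open>u\<close> combine to half the difference
  between the square of the residual and the left side of the acceptance test. At a general point \<open>w\<close> there remains a term
  linear in \<open>w - z\<close>, which the square of the residual absorbs.
\<close>

lemma prox_step_decrease:
  assumes ap: "approx_prox z x u \<eta>" and z: "z \<in> D" and crit: "prox_crit \<sigma> z (x, u, \<eta>)"
  shows "lam * \<phi> x + (1 - \<sigma>) / 2 * (norm (z - x + u))\<^sup>2 \<le> lam * \<phi> z"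
proof -
  have "lam * \<phi> x + (norm (x - z))\<^sup>2 / 2 + u \<bullet> (z - x) - \<eta> \<le> lam * \<phi> z"
    using ap z by (auto simp: approx_prox_def dest!: bspec[where x=z])
  moreover have "(norm (z - x + u))\<^sup>2 = (norm (x - z))\<^sup>2 + 2 * (u \<bullet> (z - x)) + (norm u)\<^sup>2"
    by (simp add: power2_norm_eq_inner algebra_simps inner_commute)
  ultimately show ?thesis using crit by (simp add: prox_crit_def algebra_simps diff_divide_distrib)
qed

lemma prox_step_value:
  assumes ap: "approx_prox z x u \<eta>" and w: "w \<in> D" and crit: "prox_crit \<sigma> z (x, u, \<eta>)"
    and \<eta>: "0 \<le> \<eta>" and \<sigma>: "0 < \<sigma>" "\<sigma> < 1"
  shows "(1 - \<sigma>) * (lam * (\<phi> x - \<phi> w)) \<le> (norm (w - z))\<^sup>2 / 2"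
proof -
  define U W r where "U = norm u" and "W = norm (w - z)" and "r = norm (z - x + u)"
  have "lam * \<phi> x + (norm (x - z))\<^sup>2 / 2 + u \<bullet> (w - x) - \<eta> \<le> lam * \<phi> w + W\<^sup>2 / 2"
    using ap w by (simp add: approx_prox_def W_def)
  moreover have "r\<^sup>2 = (norm (x - z))\<^sup>2 + 2 * (u \<bullet> (z - x)) + U\<^sup>2"
    by (simp add: U_def r_def power2_norm_eq_inner algebra_simps inner_commute)
  moreover have "u \<bullet> (w - x) = u \<bullet> (w - z) + u \<bullet> (z - x)" by (simp add: inner_diff_right)
  moreover have "- (u \<bullet> (w - z)) \<le> U * W"
    using Cauchy_Schwarz_ineq2[of u "w - z"] by (simp add: U_def W_def)
  moreover have crit': "U\<^sup>2 + 2 * \<eta> \<le> \<sigma> * r\<^sup>2" using crit by (simp add: prox_crit_def U_def r_def)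
  ultimately have \<Delta>: "lam * (\<phi> x - \<phi> w) \<le> W\<^sup>2 / 2 - (1 - \<sigma>) / 2 * r\<^sup>2 + U * W"
    by (simp add: algebra_simps diff_divide_distrib)
  have "U\<^sup>2 / \<sigma> \<le> r\<^sup>2" using crit' \<eta> \<sigma> by (simp add: field_simps)
  then have "(1 - \<sigma>) / 2 * (U\<^sup>2 / \<sigma>) \<le> (1 - \<sigma>) / 2 * r\<^sup>2" using \<sigma> by (intro mult_left_mono) auto
  then have "lam * (\<phi> x - \<phi> w) \<le> W\<^sup>2 / 2 - (1 - \<sigma>) / 2 * (U\<^sup>2 / \<sigma>) + U * W" using \<Delta> by linarith
  then have "(1 - \<sigma>) * (lam * (\<phi> x - \<phi> w)) \<le> (1 - \<sigma>) * (W\<^sup>2 / 2 - (1 - \<sigma>) / 2 * (U\<^sup>2 / \<sigma>) + U * W)"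
    using \<sigma> by (intro mult_left_mono) auto
  \<comment> \<open>The length \<open>U\<close> of \<open>u\<close> is eliminated by completing the square.\<close>
  also have "\<dots> = W\<^sup>2 / 2 - (\<sigma> * W - (1 - \<sigma>) * U)\<^sup>2 / (2 * \<sigma>)"
    using \<sigma> by (simp add: power2_eq_square field_simps)
  also have "\<dots> \<le> W\<^sup>2 / 2" using \<sigma> by simp
  finally show ?thesis by (simp add: W_def)
qed

end

section \<open>The accelerated inexact proximal point method\<close>

lemma is_first_exists: "P k \<Longrightarrow> \<exists>j\<le>k. is_first P j"
  unfolding is_first_def by (metis LeastI Least_le not_less_Least)

lemma is_first_le: "is_first P j \<Longrightarrow> P k \<Longrightarrow> j \<le> k"
  unfolding is_first_def using not_le by blast

lemma real_nat_ceiling_le: "0 \<le> x \<Longrightarrow> real (nat \<lceil>x\<rceil>) \<le> x + 1"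
  by linarith

text \<open>
  The assumption on \<open>\<epsilon>\<close> relates it to the tolerance \<open>\<rho>\<close> on the residual in such a way that \<open>\<eta> / lam\<close>
  drops below \<open>\<epsilon>\<close> as soon as \<open>A\<close> is of the order \<open>S\<^sup>2\<close>.
\<close>

locale aipp_run = composite n h g m M lam
  for n :: nat and h :: "rvec \<Rightarrow> ereal" and g :: "rvec \<Rightarrow> real" and m M lam :: real +
  fixes \<sigma> \<rho> \<epsilon> lo :: real
  assumes \<sigma>: "0 < \<sigma>" "\<sigma> < 1" and \<rho>: "0 < \<rho>"
    and \<epsilon>: "lam * \<rho>\<^sup>2 \<le> 2 * S\<^sup>2 * \<epsilon>"
    and lo: "\<And>u. u \<in> D \<Longrightarrow> lo \<le> \<phi> u"
begin

text \<open>
  \<open>J\<close> bounds the iterations of a run up to the acceptance of a proximal step: it gives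
  \<open>A \<ge> 18 / \<sigma>\<close>. \<open>J'\<close> bounds the iterations of the continued last run.
\<close>

definition J :: nat where "J = nat \<lceil>6 * S / sqrt \<sigma>\<rceil>"

definition J' :: nat where "J' = J + nat \<lceil>4 * S * ln S\<rceil>"

text \<open>A lower bound on the decrease of \<open>lam * \<phi>\<close> in an iteration that does not stop.\<close>

definition \<delta> :: real where "\<delta> = (1 - \<sigma>) / 2 * (lam * \<rho> / 5)\<^sup>2"

lemma \<delta>_pos: "0 < \<delta>"
  using \<sigma> \<rho> lam by (simp add: \<delta>_def)

lemma J_le: "real J \<le> 7 * S / sqrt \<sigma>"
proof -
  have "sqrt \<sigma> \<le> 1" using \<sigma> by simp
  then have "sqrt \<sigma> * 1 \<le> 1 * S" using S(1) \<sigma> by (intro mult_mono) auto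
  then have "1 \<le> S / sqrt \<sigma>" using \<sigma> by (simp add: le_divide_eq)
  moreover have "real J \<le> 6 * S / sqrt \<sigma> + 1"
    unfolding J_def by (rule real_nat_ceiling_le) (use S(1) \<sigma> in simp)
  ultimately show ?thesis by simp
qed

lemma J'_le: "real J' \<le> S * (8 / sqrt \<sigma> + 4 * ln S)"
proof -
  have "sqrt \<sigma> \<le> 1" using \<sigma> by simp
  then have "sqrt \<sigma> * 1 \<le> 1 * S" using S(1) \<sigma> by (intro mult_mono) auto
  then have "1 \<le> S / sqrt \<sigma>" using \<sigma> by (simp add: le_divide_eq)
  moreover have "real (nat \<lceil>4 * S * ln S\<rceil>) \<le> 4 * S * ln S + 1"
    by (rule real_nat_ceiling_le) (use S(1) in simp)
  moreover have "S * (8 / sqrt \<sigma> + 4 * ln S) = 7 * S / sqrt \<sigma> + S / sqrt \<sigma> + 4 * S * ln S"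
    by (simp add: algebra_simps)
  ultimately show ?thesis using J_le by (simp add: J'_def)
qed

lemma start_le_J: "nat \<lceil>6 * sqrt (2 * lam * M + 1)\<rceil> \<le> J"
proof -
  have "sqrt \<sigma> \<le> 1" using \<sigma> by simp
  then have "6 * S * sqrt \<sigma> \<le> 6 * S * 1" using S(1) by (intro mult_left_mono) auto
  then have "6 * S \<le> 6 * S / sqrt \<sigma>" using \<sigma> by (simp add: le_divide_eq)
  then show ?thesis unfolding J_def S_def by (intro nat_mono ceiling_mono)
qed

lemma after_start:
  assumes z: "z \<in> D" and j: "nat \<lceil>6 * sqrt (2 * lam * M + 1)\<rceil> \<le> j"
  shows "0 < j" and "18 \<le> prox_A z j"
proof -
  have "6 * S \<le> real j" using j unfolding S_def by linarith
  then show "0 < j" using S(1) by (cases j) auto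
  show "18 \<le> prox_A z j" using prox_A_quadratic[OF z _ \<open>6 * S \<le> real j\<close>] by simp
qed

lemma prox_A_J:
  assumes z: "z \<in> D" shows "18 / \<sigma> \<le> prox_A z J"
proof -
  have "6 / sqrt \<sigma> * S = 6 * S / sqrt \<sigma>" by simp
  then have "6 / sqrt \<sigma> * S \<le> real J" unfolding J_def by linarith
  from prox_A_quadratic[OF z _ this] show ?thesis using \<sigma> by (simp add: power_divide)
qed

lemma aipp_step1_exists:
  assumes z: "z \<in> D"
  shows "\<exists>j. aipp_step1 n g h \<sigma> lam M z j"
proof -
  have "prox_crit \<sigma> z (prox_acg n g h lam M z J)"
    by (rule prox_crit_holds[OF z after_start(1)[OF z start_le_J] \<sigma> prox_A_J[OF z]])
  then have "J \<ge> nat \<lceil>6 * sqrt (2 * lam * M + 1)\<rceil> \<and> prox_crit \<sigma> z (prox_acg n g h lam M z J)"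
    using start_le_J by simp
  from is_first_exists[where P="\<lambda>j. j \<ge> nat \<lceil>6 * sqrt (2 * lam * M + 1)\<rceil>
      \<and> prox_crit \<sigma> z (prox_acg n g h lam M z j)", OF this]
  show ?thesis unfolding aipp_step1_def by blast
qed

lemma aipp_step1_properties:
  assumes z: "z \<in> D" and st: "aipp_step1 n g h \<sigma> lam M z j"
    and tr: "prox_acg n g h lam M z j = (x, u, \<eta>)"
  shows "j \<le> J" "0 < j" "18 \<le> prox_A z j" "x \<in> D" "0 \<le> \<eta>" "approx_prox z x u \<eta>" "prox_crit \<sigma> z (x, u, \<eta>)"
proof -
  have j: "nat \<lceil>6 * sqrt (2 * lam * M + 1)\<rceil> \<le> j" and crit: "prox_crit \<sigma> z (prox_acg n g h lam M z j)"
    using st by (auto simp: aipp_step1_def is_first_def)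
  show j0: "0 < j" and A: "18 \<le> prox_A z j" using after_start[OF z j] by auto
  show "prox_crit \<sigma> z (x, u, \<eta>)" using crit tr by simp
  have "prox_crit \<sigma> z (prox_acg n g h lam M z J)"
    by (rule prox_crit_holds[OF z after_start(1)[OF z start_le_J] \<sigma> prox_A_J[OF z]])
  then show "j \<le> J" using is_first_le[OF st[unfolded aipp_step1_def]] start_le_J by blast
  show "x \<in> D" "0 \<le> \<eta>" "approx_prox z x u \<eta>"
    using prox_estimates[OF z j0 tr A] prox_triple_approx[OF z j0 tr] by metis+
qed

lemma continue_decrease:
  assumes z: "z \<in> D" and st: "aipp_step1 n g h \<sigma> lam M z j"
    and tr: "prox_acg n g h lam M z j = (x, u, \<eta>)" and large: "lam * \<rho> / 5 < norm (z - x + u)"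
  shows "\<delta> + lam * \<phi> x \<le> lam * \<phi> z"
proof -
  have "(lam * \<rho> / 5)\<^sup>2 \<le> (norm (z - x + u))\<^sup>2"
    using large lam \<rho> by (intro power_mono) auto
  then have "\<delta> \<le> (1 - \<sigma>) / 2 * (norm (z - x + u))\<^sup>2"
    unfolding \<delta>_def using \<sigma> by (intro mult_left_mono) auto
  then show ?thesis
    using prox_step_decrease[OF _ z] aipp_step1_properties(6,7)[OF z st tr] by fastforce
qed

text \<open>
  The tolerance on \<open>\<eta>\<close> is met once \<open>A\<close> exceeds \<open>S\<^sup>2\<close>, because the distance of all iterates to
  the starting point is already known to be of the order of \<open>lam * \<rho>\<close>.
\<close>

lemma final_iterate:
  assumes z: "z \<in> D" and st: "aipp_step1 n g h \<sigma> lam M z j"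
    and tr: "prox_acg n g h lam M z j = (x, u, \<eta>)" and small: "norm (z - x + u) \<le> lam * \<rho> / 5"
  defines "Q \<equiv> \<lambda>i. i \<ge> j \<and> prox_crit \<sigma> z (prox_acg n g h lam M z i)
      \<and> snd (snd (prox_acg n g h lam M z i)) / lam \<le> \<epsilon>"
  shows "Q J'"
    and "is_first Q i \<Longrightarrow> prox_acg n g h lam M z i = (x', u', \<eta>') \<Longrightarrow>
      i \<le> J' \<and> x' \<in> D \<and> 0 \<le> \<eta>' \<and> \<eta>' \<le> lam * \<epsilon> \<and> approx_prox z x' u' \<eta>' \<and> prox_crit \<sigma> z (x', u', \<eta>')
      \<and> norm (z - x' + u') \<le> lam * \<rho>"
proof -
  note st_props = aipp_step1_properties[OF z st tr]
  have near: "norm (z - x' + u') \<le> lam * \<rho>" "norm (x' - z) \<le> 9 / 8 * lam * \<rho>"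
    if i: "0 < i" "18 \<le> prox_A z i" and tri: "prox_acg n g h lam M z i = (x', u', \<eta>')" for i x' u' \<eta>'
    using prox_iterates_comparable[OF z i(1) st_props(2) tri i(2) tr st_props(3)] small by linarith+
  show Q: "Q J'"
  proof -
    have J: "J \<le> J'" by (simp add: J'_def)
    have J'0: "0 < J'" using J st_props(1,2) by linarith
    have AJ: "18 / \<sigma> \<le> prox_A z J'" using prox_A_J[OF z] prox_A_mono[OF z J] by linarith
    have "18 * 1 \<le> 18 / \<sigma>" using \<sigma> by (simp add: field_simps)
    then have AJ18: "18 \<le> prox_A z J" "18 \<le> prox_A z J'" using prox_A_J[OF z] AJ by simp_all
    have crit: "prox_crit \<sigma> z (prox_acg n g h lam M z J')" by (rule prox_crit_holds[OF z J'0 \<sigma> AJ])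
    obtain x' u' \<eta>' where tr': "prox_acg n g h lam M z J' = (x', u', \<eta>')" by (metis prod_cases3)
    have "S\<^sup>2 * prox_A z J \<le> prox_A z J'"
      unfolding J'_def by (rule prox_A_geometric[OF z]) linarith
    then have A: "S\<^sup>2 * 18 \<le> prox_A z J'"
      using mult_left_mono[OF AJ18(1), of "S\<^sup>2"] by simp
    obtain y where y: "0 \<le> \<eta>'" "2 * prox_A z J' * \<eta>' \<le> (norm (x' - z))\<^sup>2"
      using prox_estimates[OF z J'0 tr' AJ18(2)] by metis
    have "2 * (S\<^sup>2 * 18) * \<eta>' \<le> 2 * prox_A z J' * \<eta>'" using A y(1) by (intro mult_right_mono) auto
    also have "\<dots> \<le> (norm (x' - z))\<^sup>2" by (rule y(2))
    also have "\<dots> \<le> (9 / 8 * lam * \<rho>)\<^sup>2" using near(2)[OF J'0 AJ18(2) tr'] by (intro power_mono) auto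
    also have "\<dots> \<le> 18 * (lam * \<rho>)\<^sup>2"
    proof -
      have "(9 / 8 * lam * \<rho>)\<^sup>2 = 81 / 64 * (lam * \<rho>)\<^sup>2" by (simp add: power2_eq_square)
      then show ?thesis using zero_le_power2[of "lam * \<rho>"] by linarith
    qed
    also have "\<dots> = 18 * (lam * (lam * \<rho>\<^sup>2))" by (simp add: power_mult_distrib power2_eq_square)
    also have "\<dots> \<le> 18 * (lam * (2 * S\<^sup>2 * \<epsilon>))" using \<epsilon> lam by (intro mult_left_mono) auto
    finally have "(36 * S\<^sup>2) * \<eta>' \<le> (36 * S\<^sup>2) * (lam * \<epsilon>)" by (simp add: mult_ac)
    then have "\<eta>' \<le> lam * \<epsilon>" using S(1) by (simp add: mult_le_cancel_left)
    then have "snd (snd (prox_acg n g h lam M z J')) / lam \<le> \<epsilon>"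
      using lam tr' by (simp add: divide_le_eq mult.commute)
    then show ?thesis using crit J st_props(1) by (simp add: Q_def)
  qed
  assume fi: "is_first Q i" and tri: "prox_acg n g h lam M z i = (x', u', \<eta>')"
  have "i \<le> J'" by (rule is_first_le[OF fi Q])
  moreover have i: "j \<le> i" and crit: "prox_crit \<sigma> z (x', u', \<eta>')" and "\<eta>' / lam \<le> \<epsilon>"
    using fi tri by (auto simp: is_first_def Q_def)
  moreover have i0: "0 < i" and Ai: "18 \<le> prox_A z i"
    using i st_props(2,3) prox_A_mono[OF z i] by auto
  moreover have "x' \<in> D" "0 \<le> \<eta>'" "approx_prox z x' u' \<eta>'"
    using prox_estimates[OF z i0 tri Ai] prox_triple_approx[OF z i0 tri] by metis+
  ultimately show "i \<le> J' \<and> x' \<in> D \<and> 0 \<le> \<eta>' \<and> \<eta>' \<le> lam * \<epsilon> \<and> approx_prox z x' u' \<eta>'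
      \<and> prox_crit \<sigma> z (x', u', \<eta>') \<and> norm (z - x' + u') \<le> lam * \<rho>"
    using near(1)[OF i0 Ai tri] lam by (simp add: divide_le_eq mult.commute)
qed

lemma aipp_stops:
  assumes z: "z \<in> D" and st: "aipp_step1 n g h \<sigma> lam M z j"
    and tr: "prox_acg n g h lam M z j = (x, u, \<eta>)" and small: "norm (z - x + u) \<le> lam * \<rho> / 5"
  shows "\<exists>out N. aipp n g h \<sigma> lam M \<rho> \<epsilon> z out N"
proof -
  obtain i where i: "is_first (\<lambda>i. i \<ge> j \<and> prox_crit \<sigma> z (prox_acg n g h lam M z i)
      \<and> snd (snd (prox_acg n g h lam M z i)) / lam \<le> \<epsilon>) i"
    using is_first_exists[where P="\<lambda>i. i \<ge> j \<and> prox_crit \<sigma> z (prox_acg n g h lam M z i)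
      \<and> snd (snd (prox_acg n g h lam M z i)) / lam \<le> \<epsilon>", OF final_iterate(1)[OF z st tr small]] by blast
  obtain x' u' \<eta>' where "prox_acg n g h lam M z i = (x', u', \<eta>')" by (metis prod_cases3)
  from aipp_stop[OF st tr small i this] show ?thesis by blast
qed

text \<open>The iterations that do not stop are counted by the multiples of \<open>\<delta>\<close> above the lower bound.\<close>

lemma aipp_terminates:
  assumes "z \<in> D"
  shows "\<exists>out N. aipp n g h \<sigma> lam M \<rho> \<epsilon> z out N"
proof -
  have "\<exists>out N. aipp n g h \<sigma> lam M \<rho> \<epsilon> z out N" if "lam * (\<phi> z - lo) \<le> real k * \<delta>" "z \<in> D" for k z
    using that
  proof (induction k arbitrary: z)
    case (0 z)
    obtain j where j: "aipp_step1 n g h \<sigma> lam M z j" using aipp_step1_exists[OF 0(2)] by blast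
    obtain x u \<eta> where tr: "prox_acg n g h lam M z j = (x, u, \<eta>)" by (metis prod_cases3)
    note p = aipp_step1_properties[OF 0(2) j tr]
    have "norm (z - x + u) \<le> lam * \<rho> / 5"
    proof (rule ccontr)
      assume "\<not> ?thesis"
      then have "\<delta> + lam * \<phi> x \<le> lam * \<phi> z" using continue_decrease[OF 0(2) j tr] by simp
      moreover have "lam * \<phi> z \<le> lam * lo" using 0(1) by (simp add: algebra_simps)
      moreover have "lam * lo \<le> lam * \<phi> x" using lo[OF p(4)] lam by simp
      ultimately show False using \<delta>_pos by linarith
    qed
    then show ?case using aipp_stops[OF 0(2) j tr] by blast
  next
    case (Suc k z)
    obtain j where j: "aipp_step1 n g h \<sigma> lam M z j" using aipp_step1_exists[OF Suc(3)] by blast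
    obtain x u \<eta> where tr: "prox_acg n g h lam M z j = (x, u, \<eta>)" by (metis prod_cases3)
    note p = aipp_step1_properties[OF Suc(3) j tr]
    show ?case
    proof (cases "norm (z - x + u) \<le> lam * \<rho> / 5")
      case True
      then show ?thesis using aipp_stops[OF Suc(3) j tr] by blast
    next
      case False
      then have "\<delta> + lam * \<phi> x \<le> lam * \<phi> z" using continue_decrease[OF Suc(3) j tr] by simp
      then have "lam * (\<phi> x - lo) \<le> real k * \<delta>" using Suc(2) by (simp add: algebra_simps)
      then obtain out N where "aipp n g h \<sigma> lam M \<rho> \<epsilon> x out N" using Suc.IH[OF _ p(4)] by blast
      then show ?thesis using aipp_continue[OF j tr] False by (metis not_le)
    qed
  qed
  moreover obtain k :: nat where "lam * (\<phi> z - lo) \<le> real k * \<delta>"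
    using \<delta>_pos reals_Archimedean3 less_imp_le by metis
  ultimately show ?thesis using assms by blast
qed

text \<open>
  Every iteration that does not stop lowers \<open>lam * \<phi>\<close> by \<open>\<delta>\<close>, so a run is short if \<open>\<phi>\<close> is close
  to its infimum at the starting point.  Since one proximal step brings \<open>\<phi>\<close> close to the infimum
  in any case, the second bound on \<open>N\<close> involves only the distance to a competitor \<open>w\<close>.
\<close>

lemma aipp_properties:
  assumes "aipp n g h \<sigma> lam M \<rho> \<epsilon> z out N" and "z \<in> D"
  shows "(\<exists>zm x u \<eta>. out = (zm, x, (1 / lam) *\<^sub>R u, \<eta> / lam) \<and> x \<in> D \<and> zm \<in> D \<and> approx_prox zm x u \<eta>
        \<and> \<eta> \<le> lam * \<epsilon> \<and> norm (zm - x + u) \<le> lam * \<rho> \<and> \<phi> x \<le> \<phi> z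
        \<and> (\<forall>w\<in>D. (1 - \<sigma>) * (lam * (\<phi> x - \<phi> w)) \<le> (norm (w - z))\<^sup>2 / 2))
      \<and> real N * \<delta> \<le> real J * (lam * (\<phi> z - lo)) + real J' * \<delta>
      \<and> (\<forall>w\<in>D. (1 - \<sigma>) * (real N * \<delta>) \<le> (1 - \<sigma>) * ((real J + real J') * \<delta>)
          + real J * ((norm (w - z))\<^sup>2 / 2 + (1 - \<sigma>) * (lam * (\<phi> w - lo))))"
  using assms
proof (induction rule: aipp.induct)
  case (aipp_continue z j x u \<eta> out N)
  note z = \<open>z \<in> D\<close> and st = aipp_continue.hyps(1) and tr = aipp_continue.hyps(2)
  note p = aipp_step1_properties[OF z st tr]
  have dec: "\<delta> + lam * \<phi> x \<le> lam * \<phi> z" using continue_decrease[OF z st tr] aipp_continue.hyps(3) by simp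
  have "0 \<le> lam * (\<phi> z - \<phi> x)" using dec \<delta>_pos by (simp add: algebra_simps)
  then have le: "\<phi> x \<le> \<phi> z" using lam by (simp add: zero_le_mult_iff)
  have val: "(1 - \<sigma>) * (lam * (\<phi> x - \<phi> w)) \<le> (norm (w - z))\<^sup>2 / 2" if "w \<in> D" for w
    by (rule prox_step_value[OF p(6) that p(7,5) \<sigma>])
  note IH = aipp_continue.IH[OF p(4)]
  from IH[THEN conjunct1] obtain zm x' u' \<eta>'
    where out: "out = (zm, x', (1 / lam) *\<^sub>R u', \<eta>' / lam)" "x' \<in> D" "zm \<in> D"
      "approx_prox zm x' u' \<eta>'" "\<eta>' \<le> lam * \<epsilon>" "norm (zm - x' + u') \<le> lam * \<rho>" "\<phi> x' \<le> \<phi> x"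
    by (elim exE conjE)
  have val': "(1 - \<sigma>) * (lam * (\<phi> x' - \<phi> w)) \<le> (norm (w - z))\<^sup>2 / 2" if "w \<in> D" for w
  proof -
    have "(1 - \<sigma>) * (lam * (\<phi> x' - \<phi> w)) \<le> (1 - \<sigma>) * (lam * (\<phi> x - \<phi> w))"
      using out(7) \<sigma> lam by (intro mult_left_mono) auto
    then show ?thesis using val[OF that] by linarith
  qed
  have N: "real N * \<delta> \<le> real J * (lam * (\<phi> x - lo)) + real J' * \<delta>"
    by (rule IH[THEN conjunct2, THEN conjunct1])
  have j\<delta>: "real j * \<delta> \<le> real J * \<delta>" using p(1) \<delta>_pos by simp
  have A: "real (j + N) * \<delta> \<le> real J * (lam * (\<phi> z - lo)) + real J' * \<delta>"
  proof -
    have "real J * (\<delta> + lam * (\<phi> x - lo)) \<le> real J * (lam * (\<phi> z - lo))"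
      using dec by (intro mult_left_mono) (auto simp: algebra_simps)
    then show ?thesis using N j\<delta> by (simp add: algebra_simps)
  qed
  have B: "(1 - \<sigma>) * (real (j + N) * \<delta>) \<le> (1 - \<sigma>) * ((real J + real J') * \<delta>)
      + real J * ((norm (w - z))\<^sup>2 / 2 + (1 - \<sigma>) * (lam * (\<phi> w - lo)))" if w: "w \<in> D" for w
  proof -
    have "real (j + N) * \<delta> \<le> (real J + real J') * \<delta> + real J * (lam * (\<phi> x - lo))"
      using N j\<delta> by (simp add: algebra_simps)
    then have "(1 - \<sigma>) * (real (j + N) * \<delta>)
        \<le> (1 - \<sigma>) * ((real J + real J') * \<delta> + real J * (lam * (\<phi> x - lo)))"
      using \<sigma> by (intro mult_left_mono) auto
    also have "\<dots> = (1 - \<sigma>) * ((real J + real J') * \<delta>) + real J * ((1 - \<sigma>) * (lam * (\<phi> x - lo)))"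
      by (simp add: algebra_simps)
    also have "(1 - \<sigma>) * (lam * (\<phi> x - lo))
        = (1 - \<sigma>) * (lam * (\<phi> x - \<phi> w)) + (1 - \<sigma>) * (lam * (\<phi> w - lo))"
      by (simp add: algebra_simps)
    also have "real J * ((1 - \<sigma>) * (lam * (\<phi> x - \<phi> w)) + (1 - \<sigma>) * (lam * (\<phi> w - lo)))
        \<le> real J * ((norm (w - z))\<^sup>2 / 2 + (1 - \<sigma>) * (lam * (\<phi> w - lo)))"
      using val[OF w] by (intro mult_left_mono) auto
    finally show ?thesis by simp
  qed
  show ?case
    by (intro conjI exI[of _ zm] exI[of _ x'] exI[of _ u'] exI[of _ \<eta>'] ballI A B val' out(1-6)
        order_trans[OF out(7) le])
next
  case (aipp_stop z j x u \<eta> i x' u' \<eta>')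
  note z = \<open>z \<in> D\<close> and st = aipp_stop.hyps(1) and tr = aipp_stop.hyps(2)
  have f: "i \<le> J' \<and> x' \<in> D \<and> 0 \<le> \<eta>' \<and> \<eta>' \<le> lam * \<epsilon> \<and> approx_prox z x' u' \<eta>'
      \<and> prox_crit \<sigma> z (x', u', \<eta>') \<and> norm (z - x' + u') \<le> lam * \<rho>"
    by (rule final_iterate(2)[OF z st tr aipp_stop.hyps(3,4,5)])
  have "(1 - \<sigma>) * (lam * (\<phi> x' - \<phi> z)) \<le> (norm (z - z))\<^sup>2 / 2"
    using prox_step_value[OF _ z _ _ \<sigma>] f by blast
  then have le: "\<phi> x' \<le> \<phi> z" using \<sigma> lam by (simp add: mult_le_0_iff)
  have i: "real i * \<delta> \<le> real J' * \<delta>" using f \<delta>_pos by simp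
  have lo': "0 \<le> lam * (\<phi> w - lo)" if "w \<in> D" for w using lo[OF that] lam by simp
  have A: "real i * \<delta> \<le> real J * (lam * (\<phi> z - lo)) + real J' * \<delta>"
    using i mult_nonneg_nonneg[OF of_nat_0_le_iff lo'[OF z], of J] by linarith
  have B: "(1 - \<sigma>) * (real i * \<delta>) \<le> (1 - \<sigma>) * ((real J + real J') * \<delta>)
      + real J * ((norm (w - z))\<^sup>2 / 2 + (1 - \<sigma>) * (lam * (\<phi> w - lo)))" if w: "w \<in> D" for w
  proof -
    have "(1 - \<sigma>) * (real i * \<delta>) \<le> (1 - \<sigma>) * ((real J + real J') * \<delta>)"
      using i \<sigma> mult_nonneg_nonneg[OF of_nat_0_le_iff less_imp_le[OF \<delta>_pos], of J]
      by (intro mult_left_mono) (auto simp: distrib_right)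
    moreover have "0 \<le> real J * ((norm (w - z))\<^sup>2 / 2 + (1 - \<sigma>) * (lam * (\<phi> w - lo)))"
      using \<sigma> lam lo[OF w] by (intro mult_nonneg_nonneg add_nonneg_nonneg) auto
    ultimately show ?thesis by linarith
  qed
  have val: "(1 - \<sigma>) * (lam * (\<phi> x' - \<phi> w)) \<le> (norm (w - z))\<^sup>2 / 2" if "w \<in> D" for w
    using prox_step_value[OF _ that _ _ \<sigma>] f by blast
  show ?case
    using f by (intro conjI exI[of _ z] exI[of _ x'] exI[of _ u'] exI[of _ \<eta>'] ballI A B val le z) auto
qed

end

section \<open>The refinement step\<close>

context composite
begin

text \<open>
  The refined point is the proximal point of the linearized objective.  It is compared with the
  proximal point \<open>p\<close> obtained after tilting that objective by the residual \<open>r\<close>: the point \<open>x\<close> is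
  an approximate minimizer of the tilted problem, hence close to \<open>p\<close>, and proximal points depend
  nonexpansively on the tilt.
\<close>

lemma refine_properties:
  assumes lip: "\<And>x y. x \<in> D \<Longrightarrow> y \<in> D \<Longrightarrow> norm (grad n g x - grad n g y) \<le> M * norm (x - y)"
    and x: "x \<in> D" and ap: "approx_prox zm x u \<eta>" and \<eta>: "\<eta> \<le> lam * \<epsilon>"
    and small: "norm (zm - x + u) \<le> lam * \<rho>"
    and ref: "refine n g h lam M x = (zg, vg)"
  shows "zg \<in> D" and "\<phi> zg \<le> \<phi> x" and "vg - grad n g zg \<in> eps_subdiff n 0 h zg"
    and "norm vg \<le> 2 * (\<rho> + sqrt (2 * (M + 1 / lam) * \<epsilon>))"
proof -
  define K v where "K = M + 1 / lam" and "v = grad n g x"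
  have K: "0 < K" "M \<le> K" using M lam by (simp_all add: K_def add_nonneg_pos)
  define Q where "Q w = linearization n g x w + H w + K / 2 * (norm (w - x))\<^sup>2" for w
  have zg: "zg = argmin_Rn n (\<lambda>u. ereal (linearization n g x u) + h u + ereal (K / 2 * (norm (u - x))\<^sup>2))"
    and vg: "vg = K *\<^sub>R (x - zg) + grad n g zg - v"
    using ref by (auto simp: refine_def Let_def K_def v_def)
  obtain y where y: "y \<in> D" "\<And>w. w \<in> D \<Longrightarrow> 1 * H y + v \<bullet> y + K / 2 * (norm (y - x))\<^sup>2
      \<le> 1 * H w + v \<bullet> w + K / 2 * (norm (w - x))\<^sup>2"
    using prox_point_exists[of 1 K v x] K by auto
  have y': "Q y \<le> Q w" if "w \<in> D" for w
    using y(2)[OF that] by (simp add: Q_def linearization_def v_def inner_diff_right)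
  show zgD: "zg \<in> D" unfolding zg
    by (rule argmin_Rn_attained(1)[where Q=Q, OF D_subset _ _ y(1) y'])
       (simp_all add: Q_def h_eq_H h_outside)
  have min: "Q zg \<le> Q w" if "w \<in> D" for w unfolding zg
    by (rule argmin_Rn_attained(2)[where Q=Q, OF D_subset _ _ y(1) y' that])
       (simp_all add: Q_def h_eq_H h_outside)
  have tilt: "H q + (K *\<^sub>R (x - q) - s) \<bullet> (w - q) \<le> H w"
    if q: "q \<in> D" and qmin: "\<And>w. w \<in> D \<Longrightarrow> H q + s \<bullet> q + K / 2 * (norm (q - x))\<^sup>2
        \<le> H w + s \<bullet> w + K / 2 * (norm (w - x))\<^sup>2" and w: "w \<in> D" for q s w
  proof -
    have "strongly_convex_on D (0 + 0) (\<lambda>w. (0 + s \<bullet> w) + H w)"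
      by (rule strongly_convex_on_add[OF strongly_convex_on_affine[OF convex_D] H_convex])
    then have "strongly_convex_on D 0 (\<lambda>w. H w + s \<bullet> w)" by (simp add: add.commute)
    from prox_point_subgradient[OF this q qmin w] show ?thesis by (simp add: algebra_simps)
  qed
  have zg_sub: "H zg + (K *\<^sub>R (x - zg) - v) \<bullet> (w - zg) \<le> H w" if "w \<in> D" for w
    by (rule tilt[OF zgD _ that], drule min) (simp add: Q_def linearization_def v_def inner_diff_right)
  have vgR: "vg \<in> Rn n" "grad n g zg \<in> Rn n"
    using vg has_derivative_grad(1)[OF D_Rn g_diff] x zgD by (simp_all add: v_def)
  have "h w \<ge> h zg + ereal ((vg - grad n g zg) \<bullet> (w - zg) - 0)" if "w \<in> Rn n" for w
  proof (cases "w \<in> D")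
    case True
    then show ?thesis using zg_sub[OF True] by (simp add: h_eq_H zgD vg)
  qed (simp add: h_outside that)
  then show "vg - grad n g zg \<in> eps_subdiff n 0 h zg"
    using vgR zgD by (simp add: eps_subdiff_def)
  show "\<phi> zg \<le> \<phi> x"
  proof -
    have "g zg \<le> linearization n g x zg + K / 2 * (norm (zg - x))\<^sup>2"
      using g_upper[OF zgD x] mult_right_mono[of "M / 2" "K / 2" "(norm (zg - x))\<^sup>2"] K by simp
    then show ?thesis using min[OF x] by (simp add: \<phi>_def Q_def linearization_def)
  qed
  define r where "r = (1 / lam) *\<^sub>R (zm - x + u)"
  have r: "norm r \<le> \<rho>" and lr: "lam *\<^sub>R r = zm - x + u"
    using small lam by (simp_all add: r_def divide_le_eq mult.commute)
  obtain p where p: "p \<in> D" "\<And>w. w \<in> D \<Longrightarrow> 1 * H p + (v - r) \<bullet> p + K / 2 * (norm (p - x))\<^sup>2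
      \<le> 1 * H w + (v - r) \<bullet> w + K / 2 * (norm (w - x))\<^sup>2"
    using prox_point_exists[of 1 K "v - r" x] K by auto
  have p_sub: "H p + (K *\<^sub>R (x - p) - (v - r)) \<bullet> (w - p) \<le> H w" if "w \<in> D" for w
    by (rule tilt[OF p(1) _ that]) (use p(2) in simp)
  have near_p: "(K * norm (x - p))\<^sup>2 \<le> 2 * K * \<epsilon>"
  proof -
    have "lam * \<phi> x + (norm (x - zm))\<^sup>2 / 2 + u \<bullet> (p - x) - \<eta> \<le> lam * \<phi> p + (norm (p - zm))\<^sup>2 / 2"
      using ap p(1) by (simp add: approx_prox_def)
    moreover have "(norm (p - zm))\<^sup>2 = (norm (p - x))\<^sup>2 + (norm (x - zm))\<^sup>2 + 2 * ((x - zm) \<bullet> (p - x))"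
      by (simp add: power2_norm_eq_inner algebra_simps inner_commute)
    moreover have "lam * (r \<bullet> (p - x)) = u \<bullet> (p - x) - (x - zm) \<bullet> (p - x)"
      unfolding inner_scaleR_left[symmetric] lr by (simp add: algebra_simps)
    moreover have "lam * (\<phi> x - \<phi> p + r \<bullet> (p - x)) = lam * \<phi> x - lam * \<phi> p + lam * (r \<bullet> (p - x))"
      by (simp add: right_diff_distrib distrib_left)
    ultimately have "lam * (\<phi> x - \<phi> p + r \<bullet> (p - x)) \<le> \<eta> + (norm (p - x))\<^sup>2 / 2"
      by linarith
    also have "\<dots> \<le> lam * (\<epsilon> + 1 / lam * ((norm (p - x))\<^sup>2 / 2))"
      using \<eta> lam by (simp add: distrib_left)
    finally have "\<phi> x - \<phi> p + r \<bullet> (p - x) \<le> \<epsilon> + 1 / lam * ((norm (p - x))\<^sup>2 / 2)"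
      using lam by (simp only: mult_le_cancel_left_pos)
    moreover have "g p \<le> g x + v \<bullet> (p - x) + M / 2 * (norm (p - x))\<^sup>2"
      using g_upper[OF p(1) x] by (simp add: linearization_def v_def)
    moreover have "K / 2 * (norm (p - x))\<^sup>2 = M / 2 * (norm (p - x))\<^sup>2 + 1 / lam * ((norm (p - x))\<^sup>2 / 2)"
      by (simp add: K_def distrib_right add_divide_distrib)
    ultimately have "H x - H p + (r - v) \<bullet> (p - x) \<le> \<epsilon> + K / 2 * (norm (p - x))\<^sup>2"
      unfolding \<phi>_def inner_diff_left[of r] by linarith
    moreover have "H p + K * (norm (p - x))\<^sup>2 - (r - v) \<bullet> (p - x) \<le> H x"
      using p_sub[OF x] by (simp add: power2_norm_eq_inner algebra_simps inner_commute)
    ultimately have "K * (norm (x - p))\<^sup>2 \<le> 2 * \<epsilon>" by (simp add: norm_minus_commute)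
    then have "K * (K * (norm (x - p))\<^sup>2) \<le> K * (2 * \<epsilon>)" using K by (intro mult_left_mono) auto
    then show ?thesis by (simp add: power_mult_distrib power2_eq_square mult_ac)
  qed
  have p_zg: "K * norm (p - zg) \<le> \<rho>"
  proof -
    have "K * (norm (p - zg))\<^sup>2 \<le> r \<bullet> (p - zg)"
      using p_sub[OF zgD] zg_sub[OF p(1)]
      by (simp add: power2_norm_eq_inner algebra_simps inner_commute)
    also have "\<dots> \<le> norm r * norm (p - zg)" by (rule norm_cauchy_schwarz)
    also have "\<dots> \<le> \<rho> * norm (p - zg)" using r by (intro mult_right_mono) auto
    finally have "(K * norm (p - zg)) * norm (p - zg) \<le> \<rho> * norm (p - zg)"
      by (simp add: power2_eq_square)
    moreover have "0 \<le> \<rho>" using r norm_ge_zero[of r] by linarith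
    ultimately show ?thesis by (cases "p = zg") (auto simp: mult_le_cancel_right)
  qed
  have "norm (x - zg) \<le> norm (x - p) + norm (p - zg)"
    using norm_triangle_ineq[of "x - p" "p - zg"] by simp
  then have "K * norm (x - zg) \<le> K * (norm (x - p) + norm (p - zg))" using K by simp
  also have "\<dots> \<le> sqrt (2 * K * \<epsilon>) + \<rho>"
    using real_le_rsqrt[OF near_p] p_zg by (simp add: distrib_left)
  finally have q: "K * norm (x - zg) \<le> \<rho> + sqrt (2 * K * \<epsilon>)" by simp
  have "norm vg \<le> norm (K *\<^sub>R (x - zg)) + norm (grad n g zg - grad n g x)"
    unfolding vg v_def using norm_triangle_ineq[of "K *\<^sub>R (x - zg)" "grad n g zg - grad n g x"]
    by (simp add: algebra_simps)
  also have "\<dots> \<le> K * norm (x - zg) + M * norm (x - zg)"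
    using lip[OF zgD x] K by (simp add: norm_minus_commute)
  also have "\<dots> \<le> 2 * (K * norm (x - zg))"
    using mult_right_mono[OF K(2), of "norm (x - zg)"] by simp
  finally show "norm vg \<le> 2 * (\<rho> + sqrt (2 * (M + 1 / lam) * \<epsilon>))"
    using mult_left_mono[OF q, of 2] unfolding K_def[symmetric] by (rule order_trans) simp
qed

end

section \<open>The quadratic penalty method\<close>

text \<open>
  Defined outside of the locale below because it must depend on \<open>\<sigma>\<close> alone. The three terms
  account for the first and last proximal steps of a pass, for the logarithm \<open>4 * ln S\<close>, and for the
  proximal steps counted by \<open>R\<close>.
\<close>

definition rate_const :: "real \<Rightarrow> real"
  where "rate_const \<sigma> = 15 / sqrt \<sigma> + 12 + 22400 / (sqrt \<sigma> * (1 - \<sigma>)\<^sup>2)"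

lemma rate_const_pos: "0 < \<sigma> \<Longrightarrow> \<sigma> < 1 \<Longrightarrow> 0 < rate_const \<sigma>"
  unfolding rate_const_def by (intro add_pos_nonneg) simp_all

locale qp = closed_convex n h
  for n :: nat and h :: "rvec \<Rightarrow> ereal" +
  fixes l :: nat and A :: "nat \<Rightarrow> nat \<Rightarrow> real" and b :: rvec and f :: "rvec \<Rightarrow> real"
    and m L chat :: real and z0 :: rvec and \<sigma> \<rho> \<eta> :: real
  assumes C1: "cond_C1 l n A b h" and C2: "cond_C2 n f h m L" and C3: "cond_C3 l n A b f h chat"
    and z0: "z0 \<in> D" and \<sigma>: "0 < \<sigma>" "\<sigma> < 1" and \<rho>: "0 < \<rho>" and \<eta>: "0 < \<eta>"
begin

abbreviation Av :: "rvec \<Rightarrow> rvec" where "Av \<equiv> mat_vec l n A"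

abbreviation ATv :: "rvec \<Rightarrow> rvec" where "ATv \<equiv> mat_vec n l (mat_adjoint A)"

definition \<alpha> :: real where "\<alpha> = mat_norm l n A"

definition lam :: real where "lam = 1 / (2 * m)"

definition Lip :: "real \<Rightarrow> real" where "Lip c = L + c * \<alpha>\<^sup>2"

definition pen :: "real \<Rightarrow> rvec \<Rightarrow> real" where "pen c = penalized l n A b f c"

definition c0 :: real where "c0 = chat + L / \<alpha>\<^sup>2"

definition R :: real where "R = R_val l n A b f h chat \<sigma> z0 lam"

definition T :: real where "T = 2 * R / (\<eta>\<^sup>2 * (1 - \<sigma>) * lam) + chat"

definition \<Theta> :: real where "\<Theta> = (L + T * \<alpha>\<^sup>2) / m"

lemma \<alpha>: "0 < \<alpha>"
  using C1 mat_norm_pos unfolding \<alpha>_def cond_C1_def by blast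

lemma m: "0 < m" "m \<le> L"
  using C2 by (auto simp: cond_C2_def)

lemma lam: "0 < lam" "lam * m = 1 / 2"
  using m by (simp_all add: lam_def)

lemma chat: "0 \<le> chat"
  using C3 by (simp add: cond_C3_def)

lemma c0: "chat < c0" "0 < c0" "L \<le> c0 * \<alpha>\<^sup>2"
  using chat \<alpha> m by (auto simp: c0_def distrib_right add_nonneg_pos)

lemma f_diff: "z \<in> D \<Longrightarrow> f differentiable (at z within Rn n)"
  using C2 by (simp add: cond_C2_def)

lemma f_lip: "x \<in> D \<Longrightarrow> y \<in> D \<Longrightarrow> norm (grad n f x - grad n f y) \<le> L * norm (x - y)"
  using C2 by (simp add: cond_C2_def)

text \<open>The operator norm of the adjoint, read off from \<open>\<parallel>A\<^sup>* w\<parallel>\<^sup>2 = (A A\<^sup>* w) \<bullet> w\<close>.\<close>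

lemma norm_adjoint_le: "norm (ATv w) \<le> \<alpha> * norm w"
proof -
  have "(norm (ATv w))\<^sup>2 = Av (ATv w) \<bullet> w" by (simp add: power2_norm_eq_inner mat_adjoint)
  also have "\<dots> \<le> norm (Av (ATv w)) * norm w" by (rule norm_cauchy_schwarz)
  also have "\<dots> \<le> (\<alpha> * norm (ATv w)) * norm w"
    unfolding \<alpha>_def by (intro mult_right_mono norm_mat_vec_le) simp
  finally have "norm (ATv w) * norm (ATv w) \<le> (\<alpha> * norm w) * norm (ATv w)"
    by (simp add: power2_eq_square mult_ac)
  moreover have "0 \<le> \<alpha> * norm w" using \<alpha> by simp
  ultimately show ?thesis by (cases "ATv w = 0") (auto simp: mult_le_cancel_right)
qed

lemma adjoint_inner: "ATv w \<bullet> d = w \<bullet> Av d" "d \<bullet> ATv w = Av d \<bullet> w"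
  using mat_adjoint[of l n A d w] by (simp_all add: inner_commute)

lemma penalty_has_derivative:
  assumes z: "z \<in> D"
  shows "(pen c has_derivative (\<lambda>d. (grad n f z + c *\<^sub>R ATv (Av z - b)) \<bullet> d)) (at z within Rn n)"
proof -
  note Ader = bounded_linear_imp_has_derivative[OF bounded_linear_mat_vec]
  have *: "pen c = (\<lambda>z. f z + c / 2 * ((Av z - b) \<bullet> (Av z - b)))"
    by (rule ext) (simp add: pen_def penalized_def power2_norm_eq_inner)
  show ?thesis unfolding *
    by (rule derivative_eq_intros Ader has_derivative_grad(2)[OF D_Rn[OF z] f_diff[OF z]] refl)+
       (simp add: fun_eq_iff adjoint_inner algebra_simps inner_commute)
qed

lemma grad_penalty: "z \<in> D \<Longrightarrow> grad n (pen c) z = grad n f z + c *\<^sub>R ATv (Av z - b)"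
  by (rule grad_eqI) (simp_all add: penalty_has_derivative has_derivative_grad(1) f_diff)

lemma penalty_gap:
  assumes z: "z \<in> D" and u: "u \<in> D"
  shows "pen c u - linearization n (pen c) z u
    = f u - linearization n f z u + c / 2 * (norm (Av (u - z)))\<^sup>2"
proof -
  define p q where "p = Av u - b" and "q = Av z - b"
  have d: "Av (u - z) = p - q" using linear_diff[OF linear_mat_vec] by (simp add: p_def q_def)
  show ?thesis
    unfolding linearization_def grad_penalty[OF z]
    unfolding pen_def penalized_def p_def[symmetric] q_def[symmetric]
      inner_add_left inner_scaleR_left adjoint_inner(1) d power2_norm_eq_inner
    by (simp add: algebra_simps inner_commute add_divide_distrib diff_divide_distrib)
qed

lemma grad_penalty_lip:
  assumes "0 \<le> c" and x: "x \<in> D" and y: "y \<in> D"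
  shows "norm (grad n (pen c) x - grad n (pen c) y) \<le> Lip c * norm (x - y)"
proof -
  have "ATv (Av x - b) - ATv (Av y - b) = ATv (Av (x - y))"
    using linear_diff[OF linear_mat_vec] by (simp flip: linear_diff[OF linear_mat_vec])
  then have "grad n (pen c) x - grad n (pen c) y = (grad n f x - grad n f y) + c *\<^sub>R ATv (Av (x - y))"
    using x y by (simp add: grad_penalty algebra_simps)
  then have "norm (grad n (pen c) x - grad n (pen c) y)
      \<le> norm (grad n f x - grad n f y) + c * norm (ATv (Av (x - y)))"
    using norm_triangle_ineq[of "grad n f x - grad n f y" "c *\<^sub>R ATv (Av (x - y))"] assms(1) by simp
  also have "\<dots> \<le> L * norm (x - y) + c * (\<alpha> * (\<alpha> * norm (x - y)))"
  proof -
    have "norm (ATv (Av (x - y))) \<le> \<alpha> * norm (Av (x - y))" by (rule norm_adjoint_le)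
    also have "\<dots> \<le> \<alpha> * (\<alpha> * norm (x - y))"
      using norm_mat_vec_le \<alpha> unfolding \<alpha>_def by (intro mult_left_mono) auto
    finally show ?thesis using assms(1) f_lip[OF x y] by (intro add_mono mult_left_mono) auto
  qed
  finally show ?thesis by (simp add: Lip_def power2_eq_square algebra_simps)
qed

lemma Lip_nonneg: "0 \<le> c \<Longrightarrow> 0 \<le> Lip c"
  using m by (simp add: Lip_def)

lemma composite_penalty:
  assumes c: "0 \<le> c"
  shows "composite n h (pen c) m (Lip c) lam"
proof
  fix z assume z: "z \<in> D"
  show "pen c differentiable (at z within Rn n)"
    using penalty_has_derivative[OF z] by (auto simp: differentiable_def)
  fix u assume u: "u \<in> D"
  have low: "linearization n f z u - m / 2 * (norm (u - z))\<^sup>2 \<le> f u"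
    using C2 z u by (simp add: cond_C2_def)
  have "0 \<le> c / 2 * (norm (Av (u - z)))\<^sup>2" using c by simp
  then show "linearization n (pen c) z u - m / 2 * (norm (u - z))\<^sup>2 \<le> pen c u"
    using low penalty_gap[OF z u, of c] by linarith
next
  fix u z assume u: "u \<in> D" and z: "z \<in> D"
  show "pen c u \<le> linearization n (pen c) z u + Lip c / 2 * (norm (u - z))\<^sup>2"
  proof (rule descent_lemma[OF convex_D D_subset _ grad_penalty_lip[OF c] z u])
    fix z assume "z \<in> D"
    then show "pen c differentiable (at z within Rn n)"
      using penalty_has_derivative by (auto simp: differentiable_def)
  qed
qed (use lam Lip_nonneg[OF c] in auto)

section \<open>The optimal value and the constant R\<close>

definition lo :: real where "lo = real_of_ereal (phi_inf l n A b f h chat)"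

definition \<phi>c :: "real \<Rightarrow> rvec \<Rightarrow> real" where "\<phi>c c u = pen c u + H u"

lemma phi_eq: "u \<in> D \<Longrightarrow> phi l n A b f h c u = ereal (\<phi>c c u)"
  by (simp add: phi_def \<phi>c_def pen_def penalized_def h_eq_H)

lemma feasible_nonempty: "feasible l n A b h \<noteq> {}"
  using C1 by (simp add: cond_C1_def)

lemma feasibleD: "w \<in> feasible l n A b h \<Longrightarrow> w \<in> D" "w \<in> feasible l n A b h \<Longrightarrow> \<phi>c c w = \<phi>c d w"
  by (auto simp: feasible_def \<phi>c_def pen_def penalized_def)

lemma phi_inf_eq: "phi_inf l n A b f h chat = ereal lo"
proof -
  obtain w where w: "w \<in> feasible l n A b h" using feasible_nonempty by blast
  have "phi_inf l n A b f h chat \<le> phi l n A b f h chat w"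
    unfolding phi_inf_def using feasibleD(1)[OF w] by (intro INF_lower) simp
  then have "phi_inf l n A b f h chat < \<infinity>"
    using phi_eq[OF feasibleD(1)[OF w]] by (auto intro: order.strict_trans1)
  then show ?thesis using C3 unfolding lo_def cond_C3_def
    by (cases "phi_inf l n A b f h chat") auto
qed

lemma lo_le:
  assumes u: "u \<in> D"
  shows "lo + (c - chat) / 2 * (norm (Av u - b))\<^sup>2 \<le> \<phi>c c u"
proof -
  have "phi_inf l n A b f h chat \<le> phi l n A b f h chat u"
    unfolding phi_inf_def using u by (intro INF_lower) simp
  then have "lo \<le> \<phi>c chat u" by (simp add: phi_inf_eq phi_eq[OF u])
  then show ?thesis by (simp add: \<phi>c_def pen_def penalized_def diff_divide_distrib algebra_simps)
qed

text \<open>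
  \<open>R\<close> enters the analysis only as a greatest lower bound: estimates are proved for every feasible
  competitor \<open>w\<close>, on which the value of \<open>\<phi>c\<close> is the same for all penalty parameters.
\<close>

lemma R_greatest:
  assumes "\<And>w. w \<in> feasible l n A b h \<Longrightarrow>
    X \<le> (norm (w - z0))\<^sup>2 / 2 + (1 - \<sigma>) * (lam * (\<phi>c c w - lo))"
  shows "X \<le> R"
proof -
  let ?F = "feasible l n A b h"
  let ?r = "\<lambda>u. ereal ((norm (z0 - u))\<^sup>2 / 2)
         + ereal ((1 - \<sigma>) * lam) * (phi l n A b f h chat u - phi_inf l n A b f h chat)"
  have r: "?r w = ereal ((norm (w - z0))\<^sup>2 / 2 + (1 - \<sigma>) * (lam * (\<phi>c c w - lo)))" if "w \<in> ?F" for w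
    using feasibleD[OF that] by (simp add: phi_eq phi_inf_eq norm_minus_commute mult.assoc feasibleD(2)[OF that, of chat c])
  have lower: "ereal X \<le> (INF w\<in>?F. ?r w)"
    by (rule INF_greatest) (use assms r in simp)
  obtain w where w: "w \<in> ?F" using feasible_nonempty by blast
  have "(INF w\<in>?F. ?r w) \<le> ?r w" using w by (rule INF_lower)
  then have "(INF w\<in>?F. ?r w) < \<infinity>" unfolding r[OF w] by (rule order.strict_trans1) simp
  then show ?thesis unfolding R_def R_val_def
    using lower by (cases "INF w\<in>?F. ?r w") auto
qed

lemma R_nonneg: "0 \<le> R"
proof (rule R_greatest)
  fix w assume w: "w \<in> feasible l n A b h"
  have "lo \<le> \<phi>c chat w" using lo_le[OF feasibleD(1)[OF w], of chat] by simp
  then show "0 \<le> (norm (w - z0))\<^sup>2 / 2 + (1 - \<sigma>) * (lam * (\<phi>c chat w - lo))"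
    using \<sigma> lam by simp
qed

lemma T_ge: "chat \<le> T"
  using R_nonneg \<sigma> lam by (simp add: T_def)

text \<open>
  The bounds on \<open>c0 * \<alpha>\<^sup>2\<close> and \<open>T * \<alpha>\<^sup>2\<close> let \<open>\<Theta>\<close> control every penalty parameter that occurs.
\<close>

lemma \<Theta>_ge: "L \<le> m * \<Theta>" "1 \<le> \<Theta>" "c0 * \<alpha>\<^sup>2 \<le> m * \<Theta>" "T * \<alpha>\<^sup>2 \<le> m * \<Theta>"
proof -
  have m\<Theta>: "m * \<Theta> = L + T * \<alpha>\<^sup>2" using m by (simp add: \<Theta>_def)
  have T: "0 \<le> T * \<alpha>\<^sup>2" using T_ge chat by simp
  show "L \<le> m * \<Theta>" "T * \<alpha>\<^sup>2 \<le> m * \<Theta>" using m\<Theta> T m by simp_all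
  then have "m * 1 \<le> m * \<Theta>" using m by linarith
  then show "1 \<le> \<Theta>" using m by (simp add: mult_le_cancel_left_pos)
  have "c0 * \<alpha>\<^sup>2 = L + chat * \<alpha>\<^sup>2" using \<alpha> by (simp add: c0_def distrib_right)
  then show "c0 * \<alpha>\<^sup>2 \<le> m * \<Theta>" using m\<Theta> mult_right_mono[OF T_ge, of "\<alpha>\<^sup>2"] by simp
qed

section \<open>One pass for a fixed penalty parameter\<close>

text \<open>The unit \<open>S\<close> of the accelerated runs, as a function of the penalty parameter.\<close>

definition cond_root :: "real \<Rightarrow> real" where "cond_root c = sqrt (2 * lam * Lip c + 1)"

lemma aipp_run_penalty:
  assumes c: "c0 \<le> c"
  shows "aipp_run n h (pen c) m (Lip c) lam \<sigma> (\<rho> / 4) (\<rho>\<^sup>2 / (32 * (Lip c + 2 * m))) lo"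
proof -
  have c': "0 \<le> c" "chat \<le> c" using c c0 by simp_all
  note lam_m = lam(2)
  interpret composite n h "pen c" m "Lip c" lam by (rule composite_penalty[OF c'(1)])
  have M: "0 \<le> Lip c" by (rule Lip_nonneg[OF c'(1)])
  show ?thesis
  proof
    have "lam * (Lip c + 2 * m) \<le> 2 * lam * Lip c + 1"
    proof -
      have "lam * (Lip c + 2 * m) = lam * Lip c + 2 * (lam * m)" by (simp add: distrib_left)
      moreover have "0 \<le> lam * Lip c" using lam M by simp
      ultimately show ?thesis using lam_m by simp
    qed
    then have "(lam * (Lip c + 2 * m)) * \<rho>\<^sup>2 \<le> S\<^sup>2 * \<rho>\<^sup>2"
      unfolding S(2) by (rule mult_right_mono) simp
    then show "lam * (\<rho> / 4)\<^sup>2 \<le> 2 * S\<^sup>2 * (\<rho>\<^sup>2 / (32 * (Lip c + 2 * m)))"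
      using M m by (simp add: power_divide field_simps)
    show "lo \<le> composite.\<phi> h (pen c) u" if "u \<in> D" for u
    proof -
      have "0 \<le> (c - chat) / 2 * (norm (Av u - b))\<^sup>2" using c' by simp
      then show ?thesis using lo_le[OF that, of c] by (simp add: \<phi>_def \<phi>c_def)
    qed
  qed (use \<sigma> \<rho> in auto)
qed

lemma qp_pass_eq: "qp_pass l n A b f h z0 \<sigma> L m \<rho> c zv N \<longleftrightarrow>
  (\<exists>zm z w \<epsilon>. aipp n (pen c) h \<sigma> lam (Lip c) (\<rho> / 4) (\<rho>\<^sup>2 / (32 * (Lip c + 2 * m))) z0 (zm, z, w, \<epsilon>) N
    \<and> zv = refine n (pen c) h lam (Lip c) z)"
  by (simp add: qp_pass_def Let_def lam_def Lip_def \<alpha>_def pen_def)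

lemma pass_exists:
  assumes "c0 \<le> c"
  shows "\<exists>zg vg N. qp_pass l n A b f h z0 \<sigma> L m \<rho> c (zg, vg) N"
proof -
  interpret aipp_run n h "pen c" m "Lip c" lam \<sigma> "\<rho> / 4" "\<rho>\<^sup>2 / (32 * (Lip c + 2 * m))" lo
    by (rule aipp_run_penalty[OF assms])
  show ?thesis using aipp_terminates[OF z0] unfolding qp_pass_eq by (metis prod.exhaust)
qed

text \<open>
  The refinement step doubles the sum of the two error contributions, each of which the tolerances
  \<open>\<rho> / 4\<close> and \<open>\<rho>\<^sup>2 / (32 (M + 2 m))\<close> make equal to \<open>\<rho> / 4\<close>. The last two bounds compare the run with all
  feasible points and then pass to the infimum \<open>R\<close>.
\<close>

lemma pass_properties:
  assumes c: "c0 \<le> c" and pass: "qp_pass l n A b f h z0 \<sigma> L m \<rho> c (zg, vg) N"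
  shows "\<exists>s\<in>eps_subdiff n 0 h zg. vg = grad n f zg + s + ATv (c *\<^sub>R (Av zg - b))"
    and "norm vg \<le> \<rho>"
    and "(1 - \<sigma>) * (lam * ((c - chat) / 2 * (norm (Av zg - b))\<^sup>2)) \<le> R"
    and "real N \<le> cond_root c * (15 / sqrt \<sigma> + 4 * ln (cond_root c)
      + 22400 / (sqrt \<sigma> * (1 - \<sigma>)\<^sup>2) * (m\<^sup>2 * R / \<rho>\<^sup>2))"
proof -
  interpret aipp_run n h "pen c" m "Lip c" lam \<sigma> "\<rho> / 4" "\<rho>\<^sup>2 / (32 * (Lip c + 2 * m))" lo
    by (rule aipp_run_penalty[OF c])
  have c': "0 \<le> c" "chat \<le> c" using c c0 by simp_all
  have M: "0 \<le> Lip c" by (rule Lip_nonneg[OF c'(1)])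
  obtain zm z w \<epsilon> where run: "aipp n (pen c) h \<sigma> lam (Lip c) (\<rho> / 4) (\<rho>\<^sup>2 / (32 * (Lip c + 2 * m))) z0 (zm, z, w, \<epsilon>) N"
    and ref: "refine n (pen c) h lam (Lip c) z = (zg, vg)"
    using pass unfolding qp_pass_eq by metis
  note props = aipp_properties[OF run z0]
  from props[THEN conjunct1] obtain u \<eta>' where z: "z \<in> D" "approx_prox zm z u \<eta>'"
    "\<eta>' \<le> lam * (\<rho>\<^sup>2 / (32 * (Lip c + 2 * m)))" "norm (zm - z + u) \<le> lam * (\<rho> / 4)"
    and val: "\<And>w. w \<in> D \<Longrightarrow> (1 - \<sigma>) * (lam * (\<phi> z - \<phi> w)) \<le> (norm (w - z0))\<^sup>2 / 2"
    by auto
  note ref_props = refine_properties[OF grad_penalty_lip[OF c'(1)] z ref]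
  have \<phi>_eq: "\<phi> u = \<phi>c c u" for u by (simp add: \<phi>_def \<phi>c_def)
  have lin: "c *\<^sub>R ATv x = ATv (c *\<^sub>R x)" for x using linear_scale[OF linear_mat_vec] by simp
  show "\<exists>s\<in>eps_subdiff n 0 h zg. vg = grad n f zg + s + ATv (c *\<^sub>R (Av zg - b))"
    by (rule bexI[OF _ ref_props(3)]) (simp add: grad_penalty[OF ref_props(1)] lin)
  show "norm vg \<le> \<rho>"
  proof -
    have "1 / lam = 2 * m" using m by (simp add: lam_def)
    moreover have "2 * d * (\<rho>\<^sup>2 / (32 * d)) = (\<rho> / 4)\<^sup>2" if "0 < d" for d
      using that by (simp add: power_divide)
    from this[of "Lip c + 2 * m"] have "2 * (Lip c + 2 * m) * (\<rho>\<^sup>2 / (32 * (Lip c + 2 * m))) = (\<rho> / 4)\<^sup>2"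
      using M m by simp
    ultimately have "2 * (Lip c + 1 / lam) * (\<rho>\<^sup>2 / (32 * (Lip c + 2 * m))) = (\<rho> / 4)\<^sup>2"
      by (simp only:)
    then have "sqrt (2 * (Lip c + 1 / lam) * (\<rho>\<^sup>2 / (32 * (Lip c + 2 * m)))) = \<rho> / 4"
      using \<rho> by simp
    then show ?thesis using ref_props(4) by simp
  qed
  show "(1 - \<sigma>) * (lam * ((c - chat) / 2 * (norm (Av zg - b))\<^sup>2)) \<le> R"
  proof (rule R_greatest[where c=c])
    fix w assume w: "w \<in> feasible l n A b h"
    have "(c - chat) / 2 * (norm (Av zg - b))\<^sup>2 \<le> (\<phi> z - \<phi> w) + (\<phi>c c w - lo)"
      using lo_le[OF ref_props(1), of c] ref_props(2) unfolding \<phi>_eq by linarith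
    then have "(1 - \<sigma>) * (lam * ((c - chat) / 2 * (norm (Av zg - b))\<^sup>2))
        \<le> (1 - \<sigma>) * (lam * ((\<phi> z - \<phi> w) + (\<phi>c c w - lo)))"
      using \<sigma> lam by (intro mult_left_mono) auto
    also have "\<dots> = (1 - \<sigma>) * (lam * (\<phi> z - \<phi> w)) + (1 - \<sigma>) * (lam * (\<phi>c c w - lo))"
      by (simp only: distrib_left)
    finally show "(1 - \<sigma>) * (lam * ((c - chat) / 2 * (norm (Av zg - b))\<^sup>2))
        \<le> (norm (w - z0))\<^sup>2 / 2 + (1 - \<sigma>) * (lam * (\<phi>c c w - lo))"
      using val[OF feasibleD(1)[OF w]] by linarith
  qed
  have cond_root: "cond_root c = S" by (simp add: cond_root_def S_def)
  have Nle: "(1 - \<sigma>) * (real N * \<delta>) \<le> (1 - \<sigma>) * ((real J + real J') * \<delta>) + real J * R"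
  proof (cases "J = 0")
    case True
    obtain w where w: "w \<in> feasible l n A b h" using feasible_nonempty by blast
    show ?thesis using props[THEN conjunct2, THEN conjunct2, THEN bspec, OF feasibleD(1)[OF w]] True by simp
  next
    case False
    have "((1 - \<sigma>) * (real N * \<delta>) - (1 - \<sigma>) * ((real J + real J') * \<delta>)) / real J \<le> R"
    proof (rule R_greatest[where c=c])
      fix w assume w: "w \<in> feasible l n A b h"
      show "((1 - \<sigma>) * (real N * \<delta>) - (1 - \<sigma>) * ((real J + real J') * \<delta>)) / real J
          \<le> (norm (w - z0))\<^sup>2 / 2 + (1 - \<sigma>) * (lam * (\<phi>c c w - lo))"
        using props[THEN conjunct2, THEN conjunct2, THEN bspec, OF feasibleD(1)[OF w]] False
        by (simp add: divide_le_eq \<phi>_eq mult.commute)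
    qed
    then show ?thesis using False by (simp add: divide_le_eq mult.commute)
  qed
  have \<delta>: "(1 - \<sigma>) * \<delta> = (1 - \<sigma>)\<^sup>2 * \<rho>\<^sup>2 / (3200 * m\<^sup>2)"
    unfolding \<delta>_def using m by (simp add: lam_def power2_eq_square)
  have \<delta>0: "0 < (1 - \<sigma>) * \<delta>" using \<delta>_pos \<sigma> by simp
  have "((1 - \<sigma>) * \<delta>) * real N \<le> ((1 - \<sigma>) * \<delta>) * (real J + real J' + real J * (R / ((1 - \<sigma>) * \<delta>)))"
  proof -
    have "d * (j * (r / d)) = j * r" if "0 < d" for d j r :: real using that by simp
    from this[OF \<delta>0, of "real J" R]
    have "((1 - \<sigma>) * \<delta>) * (real J + real J' + real J * (R / ((1 - \<sigma>) * \<delta>)))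
        = ((1 - \<sigma>) * \<delta>) * (real J + real J') + real J * R" by (simp only: distrib_left)
    moreover have "((1 - \<sigma>) * \<delta>) * real N \<le> ((1 - \<sigma>) * \<delta>) * (real J + real J') + real J * R"
      using Nle by (simp only: mult_ac)
    ultimately show ?thesis by simp
  qed
  then have "real N \<le> real J + real J' + real J * (R / ((1 - \<sigma>) * \<delta>))"
    using \<delta>0 by (simp only: mult_le_cancel_left_pos)
  also have "R / ((1 - \<sigma>) * \<delta>) = 3200 / (1 - \<sigma>)\<^sup>2 * (m\<^sup>2 * R / \<rho>\<^sup>2)"
    unfolding \<delta> using m \<rho> by simp
  also have "real J + real J' + real J * (3200 / (1 - \<sigma>)\<^sup>2 * (m\<^sup>2 * R / \<rho>\<^sup>2))
      \<le> 7 * S / sqrt \<sigma> + S * (8 / sqrt \<sigma> + 4 * ln S) + 7 * S / sqrt \<sigma> * (3200 / (1 - \<sigma>)\<^sup>2 * (m\<^sup>2 * R / \<rho>\<^sup>2))"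
    using R_nonneg by (intro add_mono mult_right_mono J_le J'_le) simp
  also have "\<dots> = S * (15 / sqrt \<sigma> + 4 * ln S + 22400 / (sqrt \<sigma> * (1 - \<sigma>)\<^sup>2) * (m\<^sup>2 * R / \<rho>\<^sup>2))"
    by (simp add: algebra_simps)
  finally show "real N \<le> cond_root c * (15 / sqrt \<sigma> + 4 * ln (cond_root c)
      + 22400 / (sqrt \<sigma> * (1 - \<sigma>)\<^sup>2) * (m\<^sup>2 * R / \<rho>\<^sup>2))" unfolding cond_root .
qed

section \<open>Doubling the penalty parameter\<close>

text \<open>
  Only parameters below \<open>T\<close> are ever doubled, so \<open>cmax\<close> bounds all parameters that occur.
\<close>

definition cmax :: real where "cmax = max c0 (2 * T)"

lemma cmax_le: "cmax * \<alpha>\<^sup>2 \<le> 2 * (m * \<Theta>)"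
  using \<Theta>_ge m by (auto simp: cmax_def max_def)

lemma large_penalty_stops:
  assumes c: "c0 \<le> c" and "T \<le> c" and pass: "qp_pass l n A b f h z0 \<sigma> L m \<rho> c (zg, vg) N"
  shows "norm (Av zg - b) \<le> \<eta>"
proof (rule ccontr)
  assume "\<not> ?thesis"
  then have "\<eta>\<^sup>2 < (norm (Av zg - b))\<^sup>2" using \<eta> by (intro power_strict_mono) auto
  moreover have cc: "0 < c - chat" using c c0 by simp
  ultimately have "(c - chat) / 2 * \<eta>\<^sup>2 < (c - chat) / 2 * (norm (Av zg - b))\<^sup>2"
    by (intro mult_strict_left_mono) auto
  then have "(1 - \<sigma>) * (lam * ((c - chat) / 2 * \<eta>\<^sup>2)) < (1 - \<sigma>) * (lam * ((c - chat) / 2 * (norm (Av zg - b))\<^sup>2))"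
    using \<sigma> lam(1) by (simp only: mult_less_cancel_left_pos diff_gt_0_iff_gt)
  also have "\<dots> \<le> R" by (rule pass_properties(3)[OF c pass])
  finally have "c - chat < 2 * R / (\<eta>\<^sup>2 * (1 - \<sigma>) * lam)"
    using \<sigma> lam \<eta> by (simp add: less_divide_eq mult_ac)
  then show False using \<open>T \<le> c\<close> by (simp add: T_def)
qed

text \<open>
  From \<open>c0\<close> on the penalty term dominates the smoothness constant, because \<open>m \<le> L \<le> c * \<alpha>\<^sup>2\<close>.
\<close>

lemma cond_root_le:
  assumes c: "c0 \<le> c"
  shows "cond_root c \<le> sqrt 3 * (\<alpha> / sqrt m * sqrt c)" and "c \<le> cmax \<Longrightarrow> ln (cond_root c) \<le> 3 * log1_plus \<Theta>"
    and "1 \<le> cond_root c"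
proof -
  have "L \<le> c * \<alpha>\<^sup>2" using c0(3) mult_right_mono[OF c, of "\<alpha>\<^sup>2"] by simp
  then have "m + Lip c \<le> 3 * (c * \<alpha>\<^sup>2)" using m by (simp add: Lip_def)
  then have "(m + Lip c) / m \<le> 3 * (c * \<alpha>\<^sup>2) / m" using m by (intro divide_right_mono) auto
  then have le: "2 * lam * Lip c + 1 \<le> 3 * (c * \<alpha>\<^sup>2 / m)"
    using m by (simp add: lam_def add_divide_distrib)
  have pos: "0 \<le> 2 * lam * Lip c" using Lip_nonneg[of c] c c0 lam by simp
  have "cond_root c \<le> sqrt (3 * (c * \<alpha>\<^sup>2 / m))" unfolding cond_root_def using le by simp
  also have "\<dots> = sqrt 3 * (\<alpha> / sqrt m * sqrt c)"
    using \<alpha> by (simp add: real_sqrt_mult real_sqrt_divide)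
  finally show "cond_root c \<le> sqrt 3 * (\<alpha> / sqrt m * sqrt c)" .
  show S1: "1 \<le> cond_root c" unfolding cond_root_def using pos by simp
  assume "c \<le> cmax"
  then have "c * \<alpha>\<^sup>2 \<le> 2 * (m * \<Theta>)" using cmax_le mult_right_mono[of c cmax "\<alpha>\<^sup>2"] by simp
  then have "c * \<alpha>\<^sup>2 / m \<le> 2 * \<Theta>" using m by (simp add: divide_le_eq mult_ac)
  then have "(cond_root c)\<^sup>2 \<le> 6 * \<Theta>" using le pos by (simp add: cond_root_def)
  then have "ln ((cond_root c)\<^sup>2) \<le> ln (6 * \<Theta>)" using S1 \<Theta>_ge(2) by (intro ln_mono) auto
  moreover have "ln ((cond_root c)\<^sup>2) = 2 * ln (cond_root c)" using S1 by (simp add: ln_realpow)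
  moreover have "ln (6 * \<Theta>) = ln 6 + ln \<Theta>" using \<Theta>_ge(2) by (simp add: ln_mult)
  moreover have "ln 6 \<le> (6 - 1 :: real)" by (rule ln_le_minus_one) simp
  moreover have "ln \<Theta> \<le> log1_plus \<Theta>" "1 \<le> log1_plus \<Theta>" by (auto simp: log1_plus_def)
  ultimately show "ln (cond_root c) \<le> 3 * log1_plus \<Theta>" by simp
qed

abbreviation C :: real where "C \<equiv> rate_const \<sigma>"

text \<open>The cost of a pass divided by the square root of the penalty parameter.\<close>

definition W :: real where
  "W = sqrt 3 * (\<alpha> / sqrt m) * (C * (m\<^sup>2 * R / \<rho>\<^sup>2 + log1_plus \<Theta>))"

lemma C_pos: "0 < C"
  by (rule rate_const_pos[OF \<sigma>])

lemma rate_nonneg: "0 \<le> m\<^sup>2 * R / \<rho>\<^sup>2 + log1_plus \<Theta>"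
  using R_nonneg by (simp add: log1_plus_def)

lemma pass_cost:
  assumes c: "c0 \<le> c" "c \<le> cmax" and pass: "qp_pass l n A b f h z0 \<sigma> L m \<rho> c (zg, vg) N"
  shows "real N \<le> W * sqrt c"
proof -
  define E l1 where "E = m\<^sup>2 * R / \<rho>\<^sup>2" and "l1 = log1_plus \<Theta>"
  have E: "0 \<le> E" "1 \<le> l1" using R_nonneg by (simp_all add: E_def l1_def log1_plus_def)
  let ?a = "15 / sqrt \<sigma>" and ?b = "22400 / (sqrt \<sigma> * (1 - \<sigma>)\<^sup>2)"
  have ab: "0 \<le> ?a" "0 \<le> ?b" using \<sigma> by auto
  have "real N \<le> cond_root c * (?a + 4 * ln (cond_root c) + ?b * E)"
    unfolding E_def by (rule pass_properties(4)[OF c(1) pass])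
  also have "\<dots> \<le> cond_root c * (C * (E + l1))"
  proof (rule mult_left_mono)
    have "?a * 1 \<le> ?a * l1" using ab E by (intro mult_left_mono) auto
    moreover have "0 \<le> ?a * E" "0 \<le> 12 * E" "0 \<le> ?b * l1" using ab E by (auto intro!: mult_nonneg_nonneg)
    moreover have "C * (E + l1) = ?a * E + ?a * l1 + 12 * E + 12 * l1 + ?b * E + ?b * l1"
      by (simp add: rate_const_def distrib_left distrib_right)
    ultimately show "?a + 4 * ln (cond_root c) + ?b * E \<le> C * (E + l1)"
      using cond_root_le(2)[OF c] unfolding l1_def[symmetric] by linarith
  qed (use cond_root_le(3)[OF c(1)] in simp)
  also have "\<dots> \<le> (sqrt 3 * (\<alpha> / sqrt m * sqrt c)) * (C * (E + l1))"
    using cond_root_le(1)[OF c(1)] C_pos E by (intro mult_right_mono) auto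
  finally show ?thesis by (simp add: W_def E_def l1_def mult_ac)
qed

text \<open>
  The costs of the passes grow like the square roots of the penalty parameters, that is
  geometrically; the potential \<open>4 sqrt cmax - 3 sqrt c\<close> sums them up, because
  \<open>3 * (sqrt 2 - 1) \<ge> 1\<close>.
\<close>

lemma qp_aipp_from_properties:
  assumes "qp_aipp_from l n A b f h z0 \<sigma> L m \<rho> \<eta> c out N" and "c0 \<le> c" and "c \<le> cmax"
  shows "(\<exists>s\<in>eps_subdiff n 0 h (fst out). fst (snd out) = grad n f (fst out) + s + ATv (snd (snd out)))
    \<and> norm (fst (snd out)) \<le> \<rho> \<and> norm (Av (fst out) - b) \<le> \<eta>
    \<and> real N \<le> W * (4 * sqrt cmax - 3 * sqrt c)"
  using assms
proof (induction rule: qp_aipp_from.induct)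
  case (qp_double c zg vg N out N')
  have c: "c0 \<le> c" "c \<le> cmax" by fact+
  have "\<not> T \<le> c" using large_penalty_stops[OF c(1) _ qp_double.hyps(1)] qp_double.hyps(2) by auto
  then have c2: "c0 \<le> 2 * c" "2 * c \<le> cmax" using c c0 by (auto simp: cmax_def)
  note IH = qp_double.IH[OF c2]
  have W: "0 \<le> W" unfolding W_def using \<alpha> m C_pos rate_nonneg by simp
  have "real (N + N') \<le> W * sqrt c + W * (4 * sqrt cmax - 3 * sqrt (2 * c))"
    using IH pass_cost[OF c qp_double.hyps(1)] by simp
  also have "\<dots> = W * (4 * sqrt cmax - (3 * sqrt 2 - 1) * sqrt c)"
    by (simp add: real_sqrt_mult algebra_simps)
  also have "\<dots> \<le> W * (4 * sqrt cmax - 3 * sqrt c)"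
  proof -
    have "4 / 3 \<le> sqrt 2" by (rule real_le_rsqrt) (simp add: power2_eq_square)
    then have "3 * sqrt c \<le> (3 * sqrt 2 - 1) * sqrt c" using c c0 by (intro mult_right_mono) auto
    then show ?thesis using W by (intro mult_left_mono) auto
  qed
  finally show ?case using IH by blast
next
  case (qp_stop c zg vg N)
  have c: "c0 \<le> c" "c \<le> cmax" by fact+
  have W: "0 \<le> W" unfolding W_def using \<alpha> m C_pos rate_nonneg by simp
  have "real N \<le> W * sqrt c" by (rule pass_cost[OF c qp_stop.hyps(1)])
  also have "\<dots> \<le> W * (4 * sqrt cmax - 3 * sqrt c)"
    using c W by (intro mult_left_mono) auto
  finally show ?case
    using pass_properties(1,2)[OF c(1) qp_stop.hyps(1)] qp_stop.hyps(2) by simp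
qed

lemma qp_aipp_from_exists:
  assumes "c0 \<le> c"
  shows "\<exists>out N. qp_aipp_from l n A b f h z0 \<sigma> L m \<rho> \<eta> c out N"
proof -
  have "\<exists>out N. qp_aipp_from l n A b f h z0 \<sigma> L m \<rho> \<eta> c out N"
    if "T \<le> 2 ^ k * c" "c0 \<le> c" for k c
    using that
  proof (induction k arbitrary: c)
    case (0 c)
    obtain zg vg N where p: "qp_pass l n A b f h z0 \<sigma> L m \<rho> c (zg, vg) N"
      using pass_exists[OF 0(2)] by blast
    have "norm (Av zg - b) \<le> \<eta>" by (rule large_penalty_stops[OF 0(2) _ p]) (use 0(1) in simp)
    then show ?case using qp_aipp_from.qp_stop[OF p] by blast
  next
    case (Suc k c)
    obtain zg vg N where p: "qp_pass l n A b f h z0 \<sigma> L m \<rho> c (zg, vg) N"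
      using pass_exists[OF Suc(3)] by blast
    have "T \<le> 2 ^ k * (2 * c)" "c0 \<le> 2 * c" using Suc(2,3) c0 by (auto simp: mult_ac)
    then obtain out N' where "qp_aipp_from l n A b f h z0 \<sigma> L m \<rho> \<eta> (2 * c) out N'"
      using Suc.IH by blast
    then show ?case
      using qp_aipp_from.qp_stop[OF p] qp_aipp_from.qp_double[OF p] by (meson not_le)
  qed
  moreover obtain k where "T / c < 2 ^ k" using real_arch_pow[of 2 "T / c"] by auto
  then have "T \<le> 2 ^ k * c" using assms c0 by (simp add: divide_less_eq)
  ultimately show ?thesis using assms by blast
qed

lemma iteration_bound:
  "W * (4 * sqrt cmax - 3 * sqrt c0) \<le> 10 * C * (sqrt \<Theta> * (m\<^sup>2 * R / \<rho>\<^sup>2 + log1_plus \<Theta>))"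
proof -
  let ?r = "m\<^sup>2 * R / \<rho>\<^sup>2 + log1_plus \<Theta>"
  have W: "0 \<le> W" unfolding W_def using \<alpha> m C_pos rate_nonneg by simp
  have "W * (4 * sqrt cmax - 3 * sqrt c0) \<le> W * (4 * sqrt cmax)"
    using W c0 by (intro mult_left_mono) auto
  also have "\<dots> = 4 * sqrt 3 * (\<alpha> / sqrt m * sqrt cmax) * (C * ?r)"
    by (simp add: W_def mult_ac)
  also have "\<alpha> / sqrt m * sqrt cmax = sqrt (cmax * \<alpha>\<^sup>2 / m)"
    using \<alpha> by (simp add: real_sqrt_mult real_sqrt_divide)
  also have "4 * sqrt 3 * sqrt (cmax * \<alpha>\<^sup>2 / m) * (C * ?r) \<le> 4 * sqrt 3 * sqrt (2 * \<Theta>) * (C * ?r)"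
  proof -
    have "cmax * \<alpha>\<^sup>2 / m \<le> 2 * \<Theta>" using cmax_le m by (simp add: divide_le_eq mult_ac)
    then show ?thesis using C_pos rate_nonneg by (intro mult_right_mono mult_left_mono) auto
  qed
  also have "\<dots> = (4 * (sqrt 3 * sqrt 2)) * (C * (sqrt \<Theta> * ?r))"
    by (simp add: real_sqrt_mult mult_ac)
  also have "\<dots> \<le> 10 * (C * (sqrt \<Theta> * ?r))"
  proof (rule mult_right_mono)
    have "sqrt 3 * sqrt 2 \<le> 5 / 2"
      unfolding real_sqrt_mult[symmetric] by (rule real_le_lsqrt) (simp_all add: power2_eq_square)
    then show "4 * (sqrt 3 * sqrt 2) \<le> 10" by linarith
  qed (use C_pos rate_nonneg \<Theta>_ge in simp)
  finally show ?thesis by (simp add: mult.assoc)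
qed

end

theorem theorem4p4:
  fixes \<sigma> :: real
  assumes "0 < \<sigma>" and "\<sigma> < 1"
  shows "\<exists>C>0.
    \<forall>(l :: nat) (n :: nat) (A :: nat \<Rightarrow> nat \<Rightarrow> real) (b :: rvec)
      (f :: rvec \<Rightarrow> real) (h :: rvec \<Rightarrow> ereal)
      (m\<^sub>f :: real) (L\<^sub>f :: real) (chat :: real) (z0 :: rvec) (\<rho> :: real) (\<eta> :: real).
      cond_C1 l n A b h \<and> cond_C2 n f h m\<^sub>f L\<^sub>f \<and> cond_C3 l n A b f h chat
      \<and> z0 \<in> edom n h \<and> 0 < \<rho> \<and> 0 < \<eta> \<longrightarrow>
      (let lam = 1 / (2 * m\<^sub>f);
           R = R_val l n A b f h chat \<sigma> z0 lam;
           T = 2 * R / (\<eta>\<^sup>2 * (1 - \<sigma>) * lam) + chat;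
           \<Theta> = (L\<^sub>f + T * (mat_norm l n A)\<^sup>2) / m\<^sub>f
       in (\<exists>out N. qp_aipp l n A b f h chat z0 \<sigma> L\<^sub>f m\<^sub>f \<rho> \<eta> out N)
          \<and> (\<forall>z v p N. qp_aipp l n A b f h chat z0 \<sigma> L\<^sub>f m\<^sub>f \<rho> \<eta> (z, v, p) N \<longrightarrow>
               (\<exists>s \<in> eps_subdiff n 0 h z.
                  v = grad n f z + s + mat_vec n l (mat_adjoint A) p)
               \<and> norm v \<le> \<rho>
               \<and> norm (mat_vec l n A z - b) \<le> \<eta>
               \<and> real N \<le> C * (sqrt \<Theta> * (m\<^sub>f\<^sup>2 * R / \<rho>\<^sup>2 + log1_plus \<Theta>))))"
proof (intro exI[of _ "10 * rate_const \<sigma>"] conjI allI impI)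
  show "0 < 10 * rate_const \<sigma>" using rate_const_pos[OF assms] by simp
  fix l n A b f h m L chat z0 and \<rho> \<eta> :: real
  assume asm: "cond_C1 l n A b h \<and> cond_C2 n f h m L \<and> cond_C3 l n A b f h chat
      \<and> z0 \<in> edom n h \<and> 0 < \<rho> \<and> 0 < \<eta>"
  interpret qp n h l A b f m L chat z0 \<sigma> \<rho> \<eta>
    using asm assms by unfold_locales (auto simp: cond_C1_def)
  show "let lam = 1 / (2 * m);
           R = R_val l n A b f h chat \<sigma> z0 lam;
           T = 2 * R / (\<eta>\<^sup>2 * (1 - \<sigma>) * lam) + chat;
           \<Theta> = (L + T * (mat_norm l n A)\<^sup>2) / m
       in (\<exists>out N. qp_aipp l n A b f h chat z0 \<sigma> L m \<rho> \<eta> out N)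
          \<and> (\<forall>z v p N. qp_aipp l n A b f h chat z0 \<sigma> L m \<rho> \<eta> (z, v, p) N \<longrightarrow>
               (\<exists>s \<in> eps_subdiff n 0 h z.
                  v = grad n f z + s + mat_vec n l (mat_adjoint A) p)
               \<and> norm v \<le> \<rho>
               \<and> norm (mat_vec l n A z - b) \<le> \<eta>
               \<and> real N \<le> 10 * C * (sqrt \<Theta> * (m\<^sup>2 * R / \<rho>\<^sup>2 + log1_plus \<Theta>)))"
    unfolding Let_def lam_def[symmetric] R_def[symmetric] T_def[symmetric] \<alpha>_def[symmetric]
      \<Theta>_def[symmetric] qp_aipp_def c0_def[symmetric]
  proof (intro conjI allI impI)
    show "\<exists>out N. qp_aipp_from l n A b f h z0 \<sigma> L m \<rho> \<eta> c0 out N"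
      by (rule qp_aipp_from_exists) simp
    fix z v p N assume run: "qp_aipp_from l n A b f h z0 \<sigma> L m \<rho> \<eta> c0 (z, v, p) N"
    have "c0 \<le> cmax" by (simp add: cmax_def)
    from qp_aipp_from_properties[OF run order_refl this] iteration_bound
    show "\<exists>s\<in>eps_subdiff n 0 h z. v = grad n f z + s + ATv p" "norm v \<le> \<rho>" "norm (Av z - b) \<le> \<eta>"
      "real N \<le> 10 * C * (sqrt \<Theta> * (m\<^sup>2 * R / \<rho>\<^sup>2 + log1_plus \<Theta>))"
      by auto
  qed
qed

end
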